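(* The mapping $$f_{\mathrm N}(G)=\bigcup_{(u,v,w)\in\Delta_G,\ \Omega'\subseteq\Omega}\big\{\Gamma_{\mathtt{ov},u}\cup\Gamma_{\mathtt{cc}}\cup\Omega'\big\},$$ where $\Gamma_{\mathtt{ov},u},\Gamma_{\mathtt{cc}},\Omega$ are taken with respect to the ordered triple $(u,v,w)$ and $(u,v,w)$ ranges over ordered triples of distinct vertices with $\{u,v,w\}\in\Delta_G$, is a candidate function for the class of non-uniform CA graphs, and it can be computed in $\mathcal{O}(k+\log n)$ space, where $n=|V(G)|$ and $k=|K_G|$.
   Context: Graphs are finite, undirected, without self-loops; standing assumption: twin-free (no distinct $u,v$ with $N[u]=N[v]$) and no universal vertex, where $N[v]$ is the closed neighbourhood. An arc is a connected proper subset of the circle. A CA representation of $G$ is a bijection $\rho$ from $V(G)$ to a set of arcs (pairwise distinct endpoints) with $u\neq v$ adjacent iff $\rho(u)\cap\rho(v)\neq\emptyset$; $G$ is a CA graph if it has one. Intersection types of distinct arcs $A,B$: $\mathtt{di}$ disjoint; $\mathtt{cd}$ $A\subsetneq B$; $\mathtt{cs}$ $B\subsetneq A$; $\mathtt{cc}$ $A\cup B$ is the whole circle and neither contains the other; $\mathtt{ov}$ $A\cap B,A\setminus B,B\setminus A$ nonempty and $A\cup B$ not the whole circle. Sets $A,B$ overlap ($A\between B$) if $A\cap B,A\setminus B,B\setminus A\neq\emptyset$. Neighborhood matrix $\lambda_G$, for $u\neq v$ the first applicable value: $\mathtt{di}$ if nonadjacent; $\mathtt{cd}$ if $N[u]\subsetneq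 N[v]$; $\mathtt{cs}$ if $N[v]\subsetneq N[u]$; $\mathtt{cc}$ if $N[u]\between N[v]$, $N[u]\cup N[v]=V(G)$, all $w\in N[u]\setminus N[v]$ satisfy $N[w]\subset N[u]$ and all $w\in N[v]\setminus N[u]$ satisfy $N[w]\subset N[v]$; $\mathtt{ov}$ otherwise; $x\,\alpha\,y$ means $(\lambda_G)_{x,y}=\alpha$, and $x\,\alpha\,a,b(,c)$ means $x\,\alpha$ each listed vertex. $\mathcal{N}(G)$: CA representations $\rho$ with intersection type of $\rho(x),\rho(y)$ equal to $(\lambda_G)_{x,y}$ for all $x\neq y$; $\rho[V']=\{\rho(x)\mid x\in V'\}$. An $\mathtt{ov}$-triangle is a set of three vertices pairwise in relation $\mathtt{ov}$; three pairwise intersecting arcs form a non-Helly triangle if their common intersection is empty. $N_T(x)$ for $x\in T$: vertices outside $T$ adjacent to $x$ and to no other vertex of $T$. $\Delta_G$: $\mathtt{ov}$-triangles $T$ with $\bigcup_{t\in T}N[t]=V(G)$ and $y\,\mathtt{cd}\,x$ for all $x\in T$, $y\in N_T(x)$. A CA graph is uniform if for all $\mathtt{ov}$-triangles $T$ and all $\rho\in\mathcal{N}(G)$, $T\in\Delta_G$ implies $\rho[T]$ is a non-Helly triangle; a CA graph that is not uniform is non-uniform. For an ordered triple $T=(u,v,w)$: $\Gamma_{\mathtt{ov},u}=\{x\in V(G)\setminus T\mid x\,\mathtt{ov}\,u,v,\ x\,\mathtt{di}\,w\}$; $\Gamma_{\mathtt{cc}}=\{x\in V(G)\setminus T\mid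 (x\,\mathtt{ov}\,u,w\text{ and }x\,\mathtt{di}\,v)\text{ or }\exists a\in T: x\,\mathtt{cc}\,a\}$; $\Omega=\{x\in V(G)\setminus T\mid x\,\mathtt{ov}\,u,v,w\}$. $K_G=\{x\in V(G)\mid\exists\{u,v,w\}\in\Delta_G: x\,\mathtt{ov}\,u,v,w\}$. A nonempty $X\subseteq V(G)$ is a flip set if there exist $\rho\in\mathcal{N}(G)$ and a point $p$ on the circle with $x\in X\iff p\in\rho(x)$. A function $f$ with $f(G)\subseteq\mathcal{P}(V(G))$ is label-independent if for all isomorphic $G,H$ and every isomorphism $\pi:G\to H$, $f(H)=\{\pi(X)\mid X\in f(G)\}$. $f$ is a candidate function for a class $\mathcal{C}$ of CA graphs if every $G\in\mathcal{C}$ has a flip set in $f(G)$ and $f$ is label-independent. *)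

theory Defs
  imports "HOL-Analysis.Analysis"
begin

section \<open>Graphs\<close>

type_synonym 'v ugraph = "'v set \<times> 'v set set"

abbreviation verts :: "'v ugraph \<Rightarrow> 'v set" where "verts G \<equiv> fst G"
abbreviation edges :: "'v ugraph \<Rightarrow> 'v set set" where "edges G \<equiv> snd G"

definition simple_graph :: "'v ugraph \<Rightarrow> bool" where
  "simple_graph G \<longleftrightarrow> finite (verts G) \<and> (\<forall>e\<in>edges G. e \<subseteq> verts G \<and> card e = 2)"

definition adj :: "'v ugraph \<Rightarrow> 'v \<Rightarrow> 'v \<Rightarrow> bool" where
  "adj G u v \<longleftrightarrow> {u, v} \<in> edges G"

definition closed_nbh :: "'v ugraph \<Rightarrow> 'v \<Rightarrow> 'v set" where
  "closed_nbh G v = insert v {u \<in> verts G. adj G u v}"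

definition twin_free :: "'v ugraph \<Rightarrow> bool" where
  "twin_free G \<longleftrightarrow>
    \<not> (\<exists>u\<in>verts G. \<exists>v\<in>verts G. u \<noteq> v \<and> closed_nbh G u = closed_nbh G v)"

definition has_universal_vertex :: "'v ugraph \<Rightarrow> bool" where
  "has_universal_vertex G \<longleftrightarrow> (\<exists>v\<in>verts G. closed_nbh G v = verts G)"

text \<open>All graphs under consideration are twin-free and have no universal vertex.\<close>

definition std_graph :: "'v ugraph \<Rightarrow> bool" where
  "std_graph G \<longleftrightarrow> simple_graph G \<and> twin_free G \<and> \<not> has_universal_vertex G"

definition graph_iso :: "('v \<Rightarrow> 'w) \<Rightarrow> 'v ugraph \<Rightarrow> 'w ugraph \<Rightarrow> bool" where
  "graph_iso \<pi> G H \<longleftrightarrow> bij_betw \<pi> (verts G) (verts H) \<and>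
    (\<forall>u\<in>verts G. \<forall>v\<in>verts G. adj G u v \<longleftrightarrow> adj H (\<pi> u) (\<pi> v))"


section \<open>Arcs, intersection types and circular-arc representations\<close>

definition circle :: "complex set" where
  "circle = sphere 0 1"

definition is_arc :: "complex set \<Rightarrow> bool" where
  "is_arc A \<longleftrightarrow> A \<subset> circle \<and> connected A"

definition endpoints :: "complex set \<Rightarrow> complex set" where
  "endpoints A = top_of_set circle frontier_of A"

definition overlap :: "'a set \<Rightarrow> 'a set \<Rightarrow> bool" where
  "overlap A B \<longleftrightarrow> A \<inter> B \<noteq> {} \<and> A - B \<noteq> {} \<and> B - A \<noteq> {}"

datatype itype = DI | CD | CS | CC | OV

fun has_itype :: "itype \<Rightarrow> complex set \<Rightarrow> complex set \<Rightarrow> bool" where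
  "has_itype DI A B \<longleftrightarrow> A \<inter> B = {}"
| "has_itype CD A B \<longleftrightarrow> A \<subset> B"
| "has_itype CS A B \<longleftrightarrow> B \<subset> A"
| "has_itype CC A B \<longleftrightarrow> A \<union> B = circle \<and> \<not> A \<subseteq> B \<and> \<not> B \<subseteq> A"
| "has_itype OV A B \<longleftrightarrow> overlap A B \<and> A \<union> B \<noteq> circle"

text \<open>
  Pairwise distinct endpoints: each arc has two different endpoints, and different arcs share none.
  The former rules out the empty set, single points and the circle minus a point.  Arcs may or may
  not contain their endpoints.
\<close>

definition ca_rep :: "'v ugraph \<Rightarrow> ('v \<Rightarrow> complex set) \<Rightarrow> bool" where
  "ca_rep G \<rho> \<longleftrightarrow> inj_on \<rho> (verts G) \<and>
    (\<forall>v\<in>verts G. is_arc (\<rho> v) \<and> card (endpoints (\<rho> v)) = 2) \<and>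
    (\<forall>u\<in>verts G. \<forall>v\<in>verts G. u \<noteq> v \<longrightarrow> endpoints (\<rho> u) \<inter> endpoints (\<rho> v) = {}) \<and>
    (\<forall>u\<in>verts G. \<forall>v\<in>verts G. u \<noteq> v \<longrightarrow> (adj G u v \<longleftrightarrow> \<rho> u \<inter> \<rho> v \<noteq> {}))"

definition ca_graph :: "'v ugraph \<Rightarrow> bool" where
  "ca_graph G \<longleftrightarrow> std_graph G \<and> (\<exists>\<rho>. ca_rep G \<rho>)"

text \<open>
  The neighbourhood matrix; only its entries for distinct vertices are meaningful.  (Since there
  are no loops, the diagonal entries come out as \<open>DI\<close>.)
\<close>

definition nbh_matrix :: "'v ugraph \<Rightarrow> 'v \<Rightarrow> 'v \<Rightarrow> itype" where
  "nbh_matrix G u v =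
    (let N = closed_nbh G in
     if \<not> adj G u v then DI
     else if N u \<subset> N v then CD
     else if N v \<subset> N u then CS
     else if overlap (N u) (N v) \<and> N u \<union> N v = verts G \<and>
          (\<forall>w \<in> N u - N v. N w \<subseteq> N u) \<and> (\<forall>w \<in> N v - N u. N w \<subseteq> N v) then CC
     else OV)"

definition normalized_reps :: "'v ugraph \<Rightarrow> ('v \<Rightarrow> complex set) set" where
  "normalized_reps G = {\<rho>. ca_rep G \<rho> \<and>
    (\<forall>x\<in>verts G. \<forall>y\<in>verts G. x \<noteq> y \<longrightarrow> has_itype (nbh_matrix G x y) (\<rho> x) (\<rho> y))}"


section \<open>Uniform and non-uniform CA graphs\<close>

definition ov_triangle :: "'v ugraph \<Rightarrow> 'v set \<Rightarrow> bool" where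
  "ov_triangle G T \<longleftrightarrow> T \<subseteq> verts G \<and> card T = 3 \<and>
    (\<forall>x\<in>T. \<forall>y\<in>T. x \<noteq> y \<longrightarrow> nbh_matrix G x y = OV)"

definition non_helly_triangle :: "complex set set \<Rightarrow> bool" where
  "non_helly_triangle S \<longleftrightarrow> card S = 3 \<and> (\<forall>A\<in>S. is_arc A) \<and>
    (\<forall>A\<in>S. \<forall>B\<in>S. A \<inter> B \<noteq> {}) \<and> \<Inter>S = {}"

definition private_nbh :: "'v ugraph \<Rightarrow> 'v set \<Rightarrow> 'v \<Rightarrow> 'v set" where
  "private_nbh G T x = {y \<in> verts G - T. adj G y x \<and> (\<forall>t\<in>T. t \<noteq> x \<longrightarrow> \<not> adj G y t)}"

definition Delta :: "'v ugraph \<Rightarrow> 'v set set" where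
  "Delta G = {T. ov_triangle G T \<and> (\<Union>t\<in>T. closed_nbh G t) = verts G \<and>
    (\<forall>x\<in>T. \<forall>y\<in>private_nbh G T x. nbh_matrix G y x = CD)}"

definition uniform :: "'v ugraph \<Rightarrow> bool" where
  "uniform G \<longleftrightarrow> ca_graph G \<and>
    (\<forall>T. ov_triangle G T \<longrightarrow> (\<forall>\<rho>\<in>normalized_reps G.
      T \<in> Delta G \<longrightarrow> non_helly_triangle (\<rho> ` T)))"

definition nonuniform_ca_graphs :: "'v ugraph set" where
  "nonuniform_ca_graphs = {G. ca_graph G \<and> \<not> uniform G}"


section \<open>Flip sets and candidate functions\<close>

definition flip_set :: "'v ugraph \<Rightarrow> 'v set \<Rightarrow> bool" where
  "flip_set G X \<longleftrightarrow> X \<noteq> {} \<and> X \<subseteq> verts G \<and>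
    (\<exists>\<rho>\<in>normalized_reps G. \<exists>p\<in>circle. \<forall>x\<in>verts G. x \<in> X \<longleftrightarrow> p \<in> \<rho> x)"

definition label_independent :: "('v ugraph \<Rightarrow> 'v set set) \<Rightarrow> bool" where
  "label_independent f \<longleftrightarrow>
    (\<forall>G H \<pi>. std_graph G \<longrightarrow> std_graph H \<longrightarrow> graph_iso \<pi> G H \<longrightarrow> f H = (\<lambda>X. \<pi> ` X) ` f G)"

definition candidate_function :: "('v ugraph \<Rightarrow> 'v set set) \<Rightarrow> 'v ugraph set \<Rightarrow> bool" where
  "candidate_function f C \<longleftrightarrow>
    (\<forall>G. std_graph G \<longrightarrow> f G \<subseteq> Pow (verts G)) \<and>
    (\<forall>G\<in>C. \<exists>X\<in>f G. flip_set G X) \<and>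
    label_independent f"


section \<open>The function for non-uniform CA graphs\<close>

definition Gamma_ov :: "'v ugraph \<Rightarrow> 'v \<Rightarrow> 'v \<Rightarrow> 'v \<Rightarrow> 'v set" where
  "Gamma_ov G u v w = {x \<in> verts G - {u, v, w}.
    nbh_matrix G x u = OV \<and> nbh_matrix G x v = OV \<and> nbh_matrix G x w = DI}"

definition Gamma_cc :: "'v ugraph \<Rightarrow> 'v \<Rightarrow> 'v \<Rightarrow> 'v \<Rightarrow> 'v set" where
  "Gamma_cc G u v w = {x \<in> verts G - {u, v, w}.
    (nbh_matrix G x u = OV \<and> nbh_matrix G x w = OV \<and> nbh_matrix G x v = DI) \<or>
    (\<exists>a\<in>{u, v, w}. nbh_matrix G x a = CC)}"

definition Omega :: "'v ugraph \<Rightarrow> 'v \<Rightarrow> 'v \<Rightarrow> 'v \<Rightarrow> 'v set" where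
  "Omega G u v w = {x \<in> verts G - {u, v, w}.
    nbh_matrix G x u = OV \<and> nbh_matrix G x v = OV \<and> nbh_matrix G x w = OV}"

definition f_N :: "'v ugraph \<Rightarrow> 'v set set" where
  "f_N G = {Gamma_ov G u v w \<union> Gamma_cc G u v w \<union> \<Omega>' | u v w \<Omega>'.
    distinct [u, v, w] \<and> {u, v, w} \<in> Delta G \<and> \<Omega>' \<subseteq> Omega G u v w}"

definition K_set :: "'v ugraph \<Rightarrow> 'v set" where
  "K_set G = {x \<in> verts G. \<exists>u v w. {u, v, w} \<in> Delta G \<and>
    nbh_matrix G x u = OV \<and> nbh_matrix G x v = OV \<and> nbh_matrix G x w = OV}"


section \<open>Space-bounded Turing machines\<close>

text \<open>
  Deterministic Turing machines with a two-way read-only input tape, finitely many two-way infinite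
  work tapes and a write-only output tape.  States and work symbols are initial segments of the
  natural numbers, with work symbol \<open>0\<close> as the blank; the transition function is relevant only
  on the resulting finite domain.  Only work tape cells count towards the space usage.
\<close>

datatype io_sym = Zero | One | Hash
datatype in_sym = LeftEnd | Sym io_sym | RightEnd
datatype move = MoveLeft | Stay | MoveRight

record tm =
  n_states :: nat
  n_syms :: nat
  n_tapes :: nat
  start_state :: nat
  halt_state :: nat
  delta :: "nat \<Rightarrow> in_sym \<Rightarrow> nat list \<Rightarrow> nat \<times> move \<times> (nat \<times> move) list \<times> io_sym option"

definition wf_tm :: "tm \<Rightarrow> bool" where
  "wf_tm M \<longleftrightarrow> 0 < n_syms M \<and> start_state M < n_states M \<and> halt_state M < n_states M \<and>
    (\<forall>q a ws. q < n_states M \<longrightarrow> length ws = n_tapes M \<longrightarrow> set ws \<subseteq> {..<n_syms M} \<longrightarrow>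
      (case delta M q a ws of (q', d, acts, out) \<Rightarrow>
        q' < n_states M \<and> length acts = n_tapes M \<and> fst ` set acts \<subseteq> {..<n_syms M}))"

text \<open>A work tape consists of its contents and the position of its head.\<close>

type_synonym work_tape = "(int \<Rightarrow> nat) \<times> int"

record tm_config =
  state :: nat
  in_pos :: nat
  works :: "work_tape list"
  out_tape :: "io_sym list"

definition init_config :: "tm \<Rightarrow> tm_config" where
  "init_config M = \<lparr>state = start_state M, in_pos = 0,
    works = replicate (n_tapes M) (\<lambda>_. 0, 0), out_tape = []\<rparr>"

text \<open>
  The input \<open>xs\<close> occupies the positions \<open>1\<close> to \<open>length xs\<close>, between two end markers that the input
  head cannot cross.
\<close>

definition read_input :: "io_sym list \<Rightarrow> nat \<Rightarrow> in_sym" where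
  "read_input xs i =
    (if i = 0 then LeftEnd else if i \<le> length xs then Sym (xs ! (i - 1)) else RightEnd)"

fun move_input :: "nat \<Rightarrow> move \<Rightarrow> nat \<Rightarrow> nat" where
  "move_input l MoveLeft i = i - 1"
| "move_input l Stay i = i"
| "move_input l MoveRight i = min (Suc i) (Suc l)"

fun move_work :: "move \<Rightarrow> int \<Rightarrow> int" where
  "move_work MoveLeft i = i - 1"
| "move_work Stay i = i"
| "move_work MoveRight i = i + 1"

fun act_work :: "work_tape \<Rightarrow> nat \<times> move \<Rightarrow> work_tape" where
  "act_work (t, h) (b, d) = (t(h := b), move_work d h)"

definition step :: "tm \<Rightarrow> io_sym list \<Rightarrow> tm_config \<Rightarrow> tm_config" where
  "step M xs c =
    (if state c = halt_state M then c
     else case delta M (state c) (read_input xs (in_pos c)) (map (\<lambda>(t, h). t h) (works c)) of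
       (q, d, acts, out) \<Rightarrow>
         \<lparr>state = q, in_pos = move_input (length xs) d (in_pos c),
          works = map2 act_work (works c) acts,
          out_tape = out_tape c @ (case out of None \<Rightarrow> [] | Some a \<Rightarrow> [a])\<rparr>)"

definition run :: "tm \<Rightarrow> io_sym list \<Rightarrow> nat \<Rightarrow> tm_config" where
  "run M xs t = (step M xs ^^ t) (init_config M)"

definition halts_with :: "tm \<Rightarrow> io_sym list \<Rightarrow> io_sym list \<Rightarrow> bool" where
  "halts_with M xs ys \<longleftrightarrow>
    (\<exists>t. state (run M xs t) = halt_state M \<and> out_tape (run M xs t) = ys)"

text \<open>
  The pairs of a work tape and a cell visited by its head; this set is finite for halting runs.
\<close>

definition visited_cells :: "tm \<Rightarrow> io_sym list \<Rightarrow> (nat \<times> int) set" where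
  "visited_cells M xs = {(i, snd (works (run M xs t) ! i)) | i t. i < n_tapes M}"

definition space_used :: "tm \<Rightarrow> io_sym list \<Rightarrow> nat" where
  "space_used M xs = card (visited_cells M xs)"


section \<open>Computing set-valued graph functions in bounded space\<close>

text \<open>
  A graph on \<open>{..<n}\<close> is given by the rows of its adjacency matrix, and a family of vertex sets by
  listing its members, in any order and possibly with repetitions, as characteristic vectors.
  Every row and every characteristic vector is terminated by \<open>Hash\<close>.
\<close>

definition encode_set :: "nat \<Rightarrow> nat set \<Rightarrow> io_sym list" where
  "encode_set n X = map (\<lambda>j. if j \<in> X then One else Zero) [0..<n] @ [Hash]"

definition encode_sets :: "nat \<Rightarrow> nat set list \<Rightarrow> io_sym list" where
  "encode_sets n Xs = concat (map (encode_set n) Xs)"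

definition encode_graph :: "nat ugraph \<Rightarrow> io_sym list" where
  "encode_graph G =
    (let n = card (verts G) in encode_sets n (map (\<lambda>i. {j. adj G i j}) [0..<n]))"

definition computable_in_O_space ::
    "(nat ugraph \<Rightarrow> nat set set) \<Rightarrow> (nat ugraph \<Rightarrow> real) \<Rightarrow> bool" where
  "computable_in_O_space f s \<longleftrightarrow>
    (\<exists>M c. wf_tm M \<and>
      (\<forall>G n. std_graph G \<longrightarrow> verts G = {..<n} \<longrightarrow>
        (\<exists>Xs. set Xs = f G \<and> halts_with M (encode_graph G) (encode_sets n Xs)) \<and>
        real (space_used M (encode_graph G)) \<le> c * s G + c))"

end

theory Submission
  imports Defs
begin

text \<open>
  Flip sets.  Let \<open>T\<close> be a triangle of \<open>\<Delta>\<^sub>G\<close> that is Helly in a normalized representation, chosen with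
  maximal total neighbourhood size.  Its arcs do not cover the circle, so they are ordered
  \<open>u, v, w\<close> like intervals, and \<open>N[u] \<union> N[w] = V(G)\<close>.  As \<open>u\<close> and \<open>w\<close> are in relation \<open>ov\<close> rather
  than \<open>cc\<close>, some vertex \<open>z\<close> overlaps \<open>u\<close> (or symmetrically \<open>w\<close>) across its outer endpoint.  A point just
  beyond that endpoint lies in \<open>z\<close> and outside \<open>T\<close>.  An arc through this point contains no arc of \<open>T\<close>,
  since it would be universal, be in relation \<open>cc\<close> with \<open>w\<close>, or could replace \<open>u\<close> in \<open>T\<close> against
  maximality; the remaining intersection patterns are those of the sets defining \<open>f_N\<close>.

  Space.  Everything except the choice of \<open>\<Omega>'\<close> is first-order definable, so it is evaluated with finitely
  many counters up to \<open>n\<close>, stored in binary.  The subsets \<open>\<Omega>' \<subseteq> \<Omega>\<close> are enumerated by binary counting on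
  one tape with \<open>card \<Omega> \<le> k\<close> cells.  The machine is obtained from a while program over named tapes; its
  states are the finitely many stacks of programs that remain to be executed.
\<close>

subsection \<open>Arcs in angular coordinates\<close>

text \<open>The inner endpoint of \<open>u\<close> lies in both \<open>v\<close> and
  \<open>w\<close>. Hence an arc that meets \<open>u\<close>, is not contained in it and misses
  \<open>v\<close> or \<open>w\<close> must pass through the outer endpoint. This places the arcs of
  \<open>Gamma_ov\<close> and the \<open>ov\<close> case of \<open>Gamma_cc\<close> in the flip set.
  Arcs overlapping all three may or may not contain the point, so their choice is left to the set
  \<Omega>'. Maximality is measured by closed neighbourhoods because the entry \<open>CS\<close> is
  a strict inclusion of them: exchanging \<open>u\<close> for a vertex containing it strictly
  increases the sum.

  On the machine side, space depends on every intermediate configuration and not only on the result.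
  The program logic therefore proves termination together with a bound \<open>B\<close> on all head
  positions along the execution. One machine has to serve all inputs, so \<open>B\<close> is a
  parameter of each triple, and only the number of tapes enters the constant.\<close>

definition ang :: "complex \<Rightarrow> complex \<Rightarrow> real" where
  "ang t z = Arg2pi (z / t)"

lemma circle_iff: "z \<in> circle \<longleftrightarrow> cmod z = 1"
  by (auto simp: circle_def)

lemma circle_nonzero: "z \<in> circle \<Longrightarrow> z \<noteq> 0"
  by (auto simp: circle_iff)

lemma circle_mult_cis [simp]: "t \<in> circle \<Longrightarrow> t * cis \<theta> \<in> circle"
  by (simp add: circle_iff norm_mult)

lemma mult_cis_ang:
  assumes "t \<in> circle" "z \<in> circle"
  shows "t * cis (ang t z) = z"
proof -
  have "cmod (z / t) = 1" using assms by (simp add: circle_iff norm_divide)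
  then have "cis (Arg2pi (z / t)) = z / t"
    using Arg2pi_eq[of "z / t"] by (simp add: cis_conv_exp)
  then show ?thesis using circle_nonzero[OF assms(1)] by (simp add: ang_def)
qed

lemma ang_ge_0: "0 \<le> ang t z" and ang_less_2pi: "ang t z < 2 * pi"
  by (simp_all add: ang_def Arg2pi_ge_0 Arg2pi_lt_2pi)

lemma ang_mult_cis:
  assumes "t \<in> circle" "0 \<le> \<theta>" "\<theta> < 2 * pi"
  shows "ang t (t * cis \<theta>) = \<theta>"
  using assms circle_nonzero[OF assms(1)]
  by (auto simp: ang_def cis_conv_exp intro!: Arg2pi_unique[of 1])

lemma ang_self [simp]: "t \<in> circle \<Longrightarrow> ang t t = 0"
  using ang_mult_cis[of t 0] by simp

lemma ang_pos:
  assumes "t \<in> circle" "z \<in> circle" "z \<noteq> t"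
  shows "0 < ang t z"
  using ang_ge_0[of t z] mult_cis_ang[OF assms(1,2)] assms(3)
  by (cases "ang t z = 0") auto

text \<open>\<open>Arg2pi\<close> jumps only at the nonnegative reals, and on the circle
  \<open>z / t\<close> lies there only for \<open>z = t\<close>. So an arc avoiding the base point
  \<open>t\<close> can be handled as an interval of angles.\<close>

lemma continuous_on_ang:
  assumes "t \<in> circle"
  shows "continuous_on (circle - {t}) (ang t)"
proof -
  have t0: "t \<noteq> 0" using assms circle_nonzero by blast
  have "continuous (at z within circle - {t}) (ang t)" if z: "z \<in> circle" "z \<noteq> t" for z
  proof -
    have "z / t \<notin> \<real>\<^sub>\<ge>\<^sub>0"
    proof
      assume "z / t \<in> \<real>\<^sub>\<ge>\<^sub>0"
      then obtain r where r: "r \<ge> 0" "z / t = of_real r"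
        by (auto elim!: nonneg_Reals_cases)
      have "cmod (z / t) = 1" using assms z by (simp add: circle_iff norm_divide)
      then have "r = 1" using r by simp
      then show False using r t0 z by simp
    qed
    then have "isCont (\<lambda>z. Arg2pi (z / t)) z"
      using t0 isCont_o2[of z "\<lambda>z. z / t" Arg2pi] continuous_at_Arg2pi by simp
    then show ?thesis
      unfolding ang_def using continuous_at_imp_continuous_at_within by blast
  qed
  then show ?thesis
    by (simp add: continuous_on_eq_continuous_within)
qed

lemma connected_ang_between:
  assumes t: "t \<in> circle" "t \<notin> A" and A: "A \<subseteq> circle" "connected A"
    and "x \<in> A" "y \<in> A" "ang t x \<le> \<theta>" "\<theta> \<le> ang t y"
  shows "t * cis \<theta> \<in> A"
proof -
  have "connected (ang t ` A)"
    using A t by (intro connected_continuous_image continuous_on_subset[OF continuous_on_ang]) auto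
  then have "is_interval (ang t ` A)" by (simp add: is_interval_connected_1)
  then have "\<theta> \<in> ang t ` A"
    using assms by (auto simp: is_interval_1)
  then show ?thesis
    using mult_cis_ang[OF t(1)] A by auto
qed

lemma endpoints_eq:
  assumes "A \<subseteq> circle"
  shows "endpoints A = circle \<inter> closure A \<inter> closure (circle - A)"
proof -
  have "circle \<inter> A = A" "circle \<inter> (circle - A) = circle - A" using assms by blast+
  then show ?thesis
    using assms by (auto simp: endpoints_def frontier_of_closures closure_of_subtopology)
qed

text \<open>The summand \<open>2 * pi\<close> is due to \<open>z\<close> preceding \<open>y\<close>
  as seen from \<open>t\<close>: the way from \<open>y\<close> to \<open>z\<close> passes
  \<open>t\<close>.\<close>

lemma ang_shift:
  assumes "t \<in> circle" "y \<in> circle" "z \<in> circle" "ang t z < ang t y"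
  shows "ang y z = ang t z - ang t y + 2 * pi"
proof -
  have t0: "t \<noteq> 0" using assms circle_nonzero by blast
  have "z / y = (t * cis (ang t z)) / (t * cis (ang t y))"
    using mult_cis_ang[of t] assms by simp
  also have "\<dots> = cis (ang t z - ang t y)" using t0 by (simp add: cis_divide)
  also have "\<dots> = cis (ang t z - ang t y + 2 * pi)" by (simp flip: cis_mult)
  finally have e: "z = y * cis (ang t z - ang t y + 2 * pi)"
    using circle_nonzero[OF assms(2)] by (simp add: field_simps)
  show ?thesis
    by (subst e, rule ang_mult_cis)
       (use assms ang_ge_0[of t z] ang_less_2pi[of t y] in auto)
qed

text \<open>With \<open>y'\<close> as new base point the angles increase in the order
  \<open>t\<close>, \<open>y\<close>, \<open>q\<close>, so a connected set with \<open>t\<close> and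
  \<open>q\<close> but without \<open>y'\<close> would contain \<open>y\<close>.\<close>

lemma connected_not_separated:
  assumes "A \<subseteq> circle" "connected A" "t \<in> A" "q \<in> A" "y \<in> circle - A" "y' \<in> circle - A"
    and "ang t y < ang t q" "ang t q < ang t y'"
  shows False
proof -
  have c: "t \<in> circle" "q \<in> circle" "y \<in> circle" "y' \<in> circle" using assms by auto
  have y0: "0 < ang t y" using ang_pos[OF c(1,3)] assms(3,5) by auto
  have "ang t t < ang t y'" using assms(7,8) ang_ge_0[of t y] c by simp
  then have t': "ang y' t = - ang t y' + 2 * pi" using ang_shift[OF c(1,4,1)] c by simp
  have "ang y' y = ang t y - ang t y' + 2 * pi"
      "ang y' q = ang t q - ang t y' + 2 * pi"
    using ang_shift[OF c(1,4,3)] ang_shift[OF c(1,4,2)] assms(7,8) by simp_all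
  then have "ang y' t \<le> ang y' y" "ang y' y \<le> ang y' q" using t' y0 assms(7) by auto
  then have "y' * cis (ang y' y) \<in> A"
    using connected_ang_between[of y' A t q "ang y' y"] assms(1-4,6) c(4) by blast
  then show False using mult_cis_ang[OF c(4,3)] assms(5) by simp
qed

text \<open>\<alpha> and \<beta> are the infimum and supremum of the angles in \<open>A\<close>.
  Whether they are attained stays open, since arcs may lack their endpoints. The base point itself
  can be an endpoint, which shows as \<alpha> = 0 or \<beta> = \<open>2 * pi\<close>.\<close>

lemma arc_parametrization:
  assumes t: "t \<in> circle" "t \<notin> A" and A: "A \<subseteq> circle" "connected A" "A \<noteq> {}"
  obtains \<alpha> \<beta> where "0 \<le> \<alpha>" "\<alpha> \<le> \<beta>" "\<beta> \<le> 2 * pi"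
    "\<And>\<theta>. \<alpha> < \<theta> \<Longrightarrow> \<theta> < \<beta> \<Longrightarrow> t * cis \<theta> \<in> A"
    "\<And>z. z \<in> A \<Longrightarrow> \<alpha> \<le> ang t z \<and> ang t z \<le> \<beta>"
    "t * cis \<alpha> \<in> endpoints A" "t * cis \<beta> \<in> endpoints A"
proof -
  let ?I = "ang t ` A"
  define \<alpha> \<beta> where "\<alpha> = Inf ?I" and "\<beta> = Sup ?I"
  have bb: "bdd_below ?I" by (meson ang_ge_0 bdd_belowI2)
  have ba: "bdd_above ?I" by (meson ang_less_2pi bdd_aboveI2 less_imp_le)
  have ne: "?I \<noteq> {}" using A by auto
  have bounds: "\<alpha> \<le> ang t z \<and> ang t z \<le> \<beta>" if "z \<in> A" for z
    unfolding \<alpha>_def \<beta>_def using that bb ba by (auto intro: cInf_lower cSup_upper)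
  have a0: "0 \<le> \<alpha>" unfolding \<alpha>_def by (intro cInf_greatest ne) (auto simp: ang_ge_0)
  have b1: "\<beta> \<le> 2 * pi" unfolding \<beta>_def
    by (intro cSup_least ne) (auto intro: less_imp_le ang_less_2pi)
  have ab: "\<alpha> \<le> \<beta>" using A bounds by fastforce
  have mid: "t * cis \<theta> \<in> A" if \<theta>: "\<alpha> < \<theta>" "\<theta> < \<beta>" for \<theta>
  proof -
    obtain x where x: "x \<in> A" "ang t x < \<theta>"
      using \<theta>(1) cInf_lessD[OF ne] unfolding \<alpha>_def by blast
    obtain y where y: "y \<in> A" "\<theta> < ang t y"
      using \<theta>(2) less_cSupD[OF ne] unfolding \<beta>_def by blast
    show ?thesis
      using connected_ang_between[OF t A(1,2) x(1) y(1)] x(2) y(2) by simp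
  qed
  have img: "(\<lambda>\<theta>. t * cis \<theta>) ` ?I = A"
  proof -
    have "(\<lambda>\<theta>. t * cis \<theta>) ` ?I = (\<lambda>z. z) ` A"
      unfolding image_image using A mult_cis_ang[OF t(1)] by (intro image_cong) auto
    then show ?thesis by simp
  qed
  have cont: "continuous_on X (\<lambda>\<theta>. t * cis \<theta>)" for X
    by (intro continuous_intros)
  have closA: "t * cis \<theta> \<in> closure A" if "\<theta> \<in> closure ?I" for \<theta>
    using image_closure_subset[OF cont[of "closure ?I"] closed_closure[of A]] img that closure_subset[of A]
    by blast
  have closC: "t * cis \<theta> \<in> closure (circle - A)"
    if \<theta>: "\<theta> \<in> closure X" and X: "\<And>\<phi>. \<phi> \<in> X \<Longrightarrow> 0 \<le> \<phi> \<and> \<phi> < 2 * pi \<and> (\<phi> < \<alpha> \<or> \<beta> < \<phi>)" for \<theta> X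
  proof -
    have "t * cis \<phi> \<in> circle - A" if "\<phi> \<in> X" for \<phi>
      using bounds[of "t * cis \<phi>"] X[OF that] ang_mult_cis[OF t(1), of \<phi>] t(1) by auto
    then have "(\<lambda>\<theta>. t * cis \<theta>) ` X \<subseteq> closure (circle - A)" using closure_subset by fastforce
    then show ?thesis using image_closure_subset[OF cont[of "closure X"] closed_closure[of "circle - A"]] \<theta> by blast
  qed
  have tc: "t \<in> closure (circle - A)" by (rule subsetD[OF closure_subset]) (simp add: t)
  \<comment> \<open>At angle 0 the limit point is \<open>t\<close>, which is outside
    \<open>A\<close>; otherwise the angles just below \<alpha> belong to points outside
    \<open>A\<close>. The other end is analogous.\<close>
  have "t * cis \<alpha> \<in> closure (circle - A)"
  proof (cases "\<alpha> = 0")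
    case True then show ?thesis using tc by simp
  next
    case False
    then have "\<alpha> \<in> closure {0<..<\<alpha>}" using a0 by simp
    then show ?thesis by (rule closC) (use ab b1 in auto)
  qed
  moreover have "t * cis \<beta> \<in> closure (circle - A)"
  proof (cases "\<beta> = 2 * pi")
    case True then show ?thesis using tc by simp
  next
    case False
    then have "\<beta> \<in> closure {\<beta><..<2*pi}" using b1 by simp
    then show ?thesis by (rule closC) (use ab a0 in auto)
  qed
  moreover have "t * cis \<alpha> \<in> closure A" "t * cis \<beta> \<in> closure A"
    using closA closure_contains_Inf[OF ne bb] closure_contains_Sup[OF ne ba]
    unfolding \<alpha>_def \<beta>_def by auto
  ultimately show thesis
    using that[OF a0 ab b1 mid bounds] t(1) by (simp add: endpoints_eq[OF A(1)])
qed


section \<open>Overlapping arcs as intervals of angles\<close>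

definition arc_on :: "complex \<Rightarrow> complex set \<Rightarrow> real \<Rightarrow> real \<Rightarrow> bool" where
  "arc_on t A \<alpha> \<beta> \<longleftrightarrow> 0 \<le> \<alpha> \<and> \<alpha> < \<beta> \<and> \<beta> \<le> 2 * pi \<and>
    (\<forall>\<theta>. \<alpha> < \<theta> \<and> \<theta> < \<beta> \<longrightarrow> t * cis \<theta> \<in> A) \<and> (\<forall>z\<in>A. \<alpha> \<le> ang t z \<and> ang t z \<le> \<beta>) \<and>
    endpoints A = {t * cis \<alpha>, t * cis \<beta>}"

text \<open>The overlap with \<open>B\<close> excludes the degenerate shapes: \<alpha> = \<beta>
  would make \<open>A\<close> a single point, and two angles describing the same point would make
  \<open>A\<close> contain the circle without \<open>t\<close>, hence \<open>B\<close>. So the two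
  angles give both endpoints.\<close>

lemma arc_on_exists:
  assumes t: "t \<in> circle" "t \<notin> A" "t \<notin> B"
    and A: "A \<subseteq> circle" "connected A" "card (endpoints A) = 2" and B: "B \<subseteq> circle" "overlap A B"
  shows "\<exists>\<alpha> \<beta>. arc_on t A \<alpha> \<beta>"
proof -
  have "A \<noteq> {}" using B by (auto simp: overlap_def)
  then obtain \<alpha> \<beta> where *: "0 \<le> \<alpha>" "\<alpha> \<le> \<beta>" "\<beta> \<le> 2 * pi"
    "\<And>\<theta>. \<alpha> < \<theta> \<Longrightarrow> \<theta> < \<beta> \<Longrightarrow> t * cis \<theta> \<in> A"
    "\<And>z. z \<in> A \<Longrightarrow> \<alpha> \<le> ang t z \<and> ang t z \<le> \<beta>"
    "t * cis \<alpha> \<in> endpoints A" "t * cis \<beta> \<in> endpoints A"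
    using arc_parametrization[OF t(1,2) A(1,2)] by metis
  have "\<alpha> \<noteq> \<beta>"
  proof
    assume "\<alpha> = \<beta>"
    then have "z = t * cis \<alpha>" if "z \<in> A" for z
      using *(5)[OF that] mult_cis_ang[OF t(1), of z] A(1) that by force
    then show False using B by (auto simp: overlap_def)
  qed
  then have ab: "\<alpha> < \<beta>" using * by simp
  have "t * cis \<alpha> \<noteq> t * cis \<beta>"
  proof
    assume eq: "t * cis \<alpha> = t * cis \<beta>"
    have aa: "ang t (t * cis \<alpha>) = \<alpha>" using ang_mult_cis[OF t(1)] * ab by auto
    have b2: "\<beta> = 2 * pi"
    proof (rule ccontr)
      assume "\<beta> \<noteq> 2 * pi"
      then have "ang t (t * cis \<beta>) = \<beta>" using ang_mult_cis[OF t(1)] * ab by auto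
      then show False using aa eq ab by simp
    qed
    then have "\<alpha> = 0" using aa eq ang_self[OF t(1)] by simp
    then have "z \<in> A" if "z \<in> circle" "z \<noteq> t" for z
      using *(4)[of "ang t z"] b2 mult_cis_ang[OF t(1) that(1)] ang_pos[OF t(1) that]
        ang_less_2pi[of t z] by simp
    then have "B \<subseteq> A" using B t by auto
    then show False using B by (auto simp: overlap_def)
  qed
  then have "endpoints A = {t * cis \<alpha>, t * cis \<beta>}"
    using * A(3) card_seteq[of "endpoints A" "{t * cis \<alpha>, t * cis \<beta>}"]
    by (simp add: card_ge_0_finite)
  then show ?thesis unfolding arc_on_def using * ab by blast
qed

lemma arc_on_subset:
  assumes "t \<in> circle" "A \<subseteq> circle" "arc_on t A \<alpha> \<beta>" "arc_on t B \<gamma> \<delta>" "\<gamma> < \<alpha>" "\<beta> < \<delta>"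
  shows "A \<subseteq> B"
proof
  fix z assume z: "z \<in> A"
  then have "t * cis (ang t z) \<in> B" using assms unfolding arc_on_def
    by (meson le_less_trans less_le_trans)
  then show "z \<in> B" using mult_cis_ang[OF assms(1)] assms(2) z by auto
qed

text \<open>Disjoint endpoints make the comparisons strict, as \<open>arc_on_subset\<close> needs
  because it is unknown whether endpoints belong to their arcs; the overlap then rules out
  \<open>B \<subseteq> A\<close>.\<close>

lemma arc_on_overlap:
  assumes "t \<in> circle" "A \<subseteq> circle" "B \<subseteq> circle" "arc_on t A \<alpha> \<beta>" "arc_on t B \<gamma> \<delta>"
    "overlap A B" "endpoints A \<inter> endpoints B = {}" "\<alpha> < \<gamma>"
  shows "\<gamma> < \<beta>" "\<beta> < \<delta>"
proof -
  have ne: "\<gamma> \<noteq> \<beta>" "\<beta> \<noteq> \<delta>"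
    using assms(4,5,7) by (auto simp: arc_on_def)
  obtain z where "z \<in> A" "z \<in> B" using assms(6) by (auto simp: overlap_def)
  then have "\<gamma> \<le> ang t z" "ang t z \<le> \<beta>" using assms(4,5) by (auto simp: arc_on_def)
  then show "\<gamma> < \<beta>" using ne by linarith
  show "\<beta> < \<delta>"
  proof (rule ccontr)
    assume "\<not> \<beta> < \<delta>"
    then have "B \<subseteq> A" using arc_on_subset[OF assms(1,3,5,4,8)] ne by linarith
    then show False using assms(6) by (auto simp: overlap_def)
  qed
qed

text \<open>The Helly property of intervals, applied to the complements of the three arcs.\<close>

lemma common_point_not_covering:
  assumes "U \<subseteq> circle" "connected U" "V \<subseteq> circle" "connected V" "W \<subseteq> circle" "connected W"
    and "U \<union> V \<noteq> circle" "V \<union> W \<noteq> circle" "U \<union> W \<noteq> circle" and q: "q \<in> U" "q \<in> V" "q \<in> W"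
  shows "\<exists>t\<in>circle. t \<notin> U \<and> t \<notin> V \<and> t \<notin> W"
proof (rule ccontr)
  assume c: "\<not> ?thesis"
  obtain t where t: "t \<in> circle" "t \<notin> U" "t \<notin> V" using assms(1,3,7) by blast
  obtain y where y: "y \<in> circle" "y \<notin> V" "y \<notin> W" using assms(3,5,8) by blast
  obtain y' where y': "y' \<in> circle" "y' \<notin> U" "y' \<notin> W" using assms(1,5,9) by blast
  have m: "t \<in> W" "y \<in> U" "y' \<in> V" using c t y y' by blast+
  have y1: "t * cis (ang t y) = y" "t * cis (ang t y') = y'"
    using mult_cis_ang t y y' by auto
  have qc: "q \<in> circle" using q assms by auto
  \<comment> \<open>Seen from \<open>t\<close>, the set \<open>U\<close> joins \<open>y\<close> to
    \<open>q\<close> without \<open>y'\<close>, and \<open>V\<close> joins \<open>y'\<close> to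
    \<open>q\<close> without \<open>y\<close>. So \<open>q\<close> lies strictly between
    \<open>y\<close> and \<open>y'\<close>, while \<open>W\<close> contains \<open>t\<close> and
    \<open>q\<close> but neither of these two.\<close>
  have "\<not> (ang t y \<le> ang t y' \<and> ang t y' \<le> ang t q)" "\<not> (ang t q \<le> ang t y' \<and> ang t y' \<le> ang t y)"
    using connected_ang_between[OF t(1,2) assms(1,2), of _ _ "ang t y'"] y1 y' q m by auto
  moreover
  have "\<not> (ang t y' \<le> ang t y \<and> ang t y \<le> ang t q)" "\<not> (ang t q \<le> ang t y \<and> ang t y \<le> ang t y')"
    using connected_ang_between[OF t(1,3) assms(3,4), of _ _ "ang t y"] y1 y q m by auto
  ultimately consider "ang t y < ang t q" "ang t q < ang t y'" | "ang t y' < ang t q" "ang t q < ang t y"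
    by linarith
  then show False
  proof cases
    case 1
    then show ?thesis
      using connected_not_separated[OF assms(5,6) m(1) q(3), of y y'] y y' by simp
  next
    case 2
    then show ?thesis
      using connected_not_separated[OF assms(5,6) m(1) q(3), of y' y] y y' by simp
  qed
qed

lemma sorted_triple:
  fixes \<alpha> :: "'a \<Rightarrow> real"
  assumes "card T = 3" "inj_on \<alpha> T"
  obtains u v w where "T = {u, v, w}" "\<alpha> u < \<alpha> v" "\<alpha> v < \<alpha> w"
proof -
  obtain x y z where T: "T = {x, y, z}" "x \<noteq> y" "y \<noteq> z" "x \<noteq> z"
    using assms(1) by (auto simp: card_3_iff)
  then have ne: "\<alpha> x \<noteq> \<alpha> y" "\<alpha> y \<noteq> \<alpha> z" "\<alpha> x \<noteq> \<alpha> z"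
    using assms(2) by (auto simp: inj_on_def)
  then show thesis
    using that[of x y z] that[of x z y] that[of y x z] that[of y z x] that[of z x y] that[of z y x]
      T(1) by (smt (verit) insert_commute)
qed

text \<open>Here \<open>a\<close>, \<open>c\<close> are the outer and \<open>b\<close>, \<open>d\<close> the inner endpoints of the extreme arcs.\<close>

lemma helly_triangle_order:
  fixes \<rho> :: "'a \<Rightarrow> complex set"
  assumes T: "card T = 3"
    and arcs: "\<And>x. x \<in> T \<Longrightarrow> \<rho> x \<subseteq> circle \<and> connected (\<rho> x) \<and> card (endpoints (\<rho> x)) = 2"
    and disj: "\<And>x y. x \<in> T \<Longrightarrow> y \<in> T \<Longrightarrow> x \<noteq> y \<Longrightarrow> endpoints (\<rho> x) \<inter> endpoints (\<rho> y) = {}"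
    and ov: "\<And>x y. x \<in> T \<Longrightarrow> y \<in> T \<Longrightarrow> x \<noteq> y \<Longrightarrow> overlap (\<rho> x) (\<rho> y) \<and> \<rho> x \<union> \<rho> y \<noteq> circle"
    and helly: "\<Inter> (\<rho> ` T) \<noteq> {}"
  obtains u v w a b c d where "T = {u, v, w}" "u \<noteq> v" "v \<noteq> w" "u \<noteq> w"
    "endpoints (\<rho> u) = {a, b}" "a \<notin> \<rho> v" "a \<notin> \<rho> w" "b \<in> \<rho> v" "b \<in> \<rho> w"
    "endpoints (\<rho> w) = {c, d}" "c \<notin> \<rho> v" "c \<notin> \<rho> u" "d \<in> \<rho> v" "d \<in> \<rho> u"
    "\<rho> v \<subseteq> \<rho> u \<union> \<rho> w"
proof -
  obtain q where q: "\<And>x. x \<in> T \<Longrightarrow> q \<in> \<rho> x" using helly by auto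
  obtain t where t: "t \<in> circle" "\<And>x. x \<in> T \<Longrightarrow> t \<notin> \<rho> x"
  proof -
    obtain x y z where x: "T = {x, y, z}" "x \<noteq> y" "y \<noteq> z" "x \<noteq> z"
      using T by (auto simp: card_3_iff)
    then have "\<exists>t\<in>circle. t \<notin> \<rho> x \<and> t \<notin> \<rho> y \<and> t \<notin> \<rho> z"
      using common_point_not_covering[of "\<rho> x" "\<rho> y" "\<rho> z" q] arcs ov q by simp
    then show thesis using that x(1) by blast
  qed
  have "\<exists>\<alpha> \<beta>. arc_on t (\<rho> x) \<alpha> \<beta>" if x: "x \<in> T" for x
  proof -
    obtain y where y: "y \<in> T" "y \<noteq> x"
      using T x by (metis card_3_iff insertCI)
    show ?thesis using arc_on_exists[of t "\<rho> x" "\<rho> y"] arcs ov[OF x y(1)] t x y by auto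
  qed
  then obtain \<alpha> \<beta> where on: "\<And>x. x \<in> T \<Longrightarrow> arc_on t (\<rho> x) (\<alpha> x) (\<beta> x)" by metis
  have "inj_on \<alpha> T"
  proof (rule inj_onI)
    fix x y assume xy: "x \<in> T" "y \<in> T" "\<alpha> x = \<alpha> y"
    then have "t * cis (\<alpha> x) \<in> endpoints (\<rho> x) \<inter> endpoints (\<rho> y)"
      using on by (auto simp: arc_on_def)
    then show "x = y" using disj xy by blast
  qed
  then obtain u v w where uvw: "T = {u, v, w}" "\<alpha> u < \<alpha> v" "\<alpha> v < \<alpha> w"
    using sorted_triple[OF T] by metis
  then have ne: "u \<noteq> v" "v \<noteq> w" "u \<noteq> w" by auto
  have mem: "u \<in> T" "v \<in> T" "w \<in> T" using uvw by auto
  \<comment> \<open>Overlapping intervals have their left and right ends in the same order. The six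
    angles are thus ordered as the left ends of \<open>u\<close>, \<open>v\<close>, \<open>w\<close>
    followed by their right ends.\<close>
  have step: "\<alpha> y < \<beta> x \<and> \<beta> x < \<beta> y" if "x \<in> T" "y \<in> T" "x \<noteq> y" "\<alpha> x < \<alpha> y" for x y
    using arc_on_overlap[OF t(1) _ _ on[OF that(1)] on[OF that(2)]] that arcs ov disj by blast
  have o: "\<alpha> w < \<beta> u" "\<beta> u < \<beta> v" "\<beta> v < \<beta> w"
    using step[of u w] step[of u v] step[of v w] mem ne uvw by auto
  have range: "0 \<le> \<alpha> u" "\<beta> w \<le> 2 * pi"
    using on mem by (auto simp: arc_on_def)
  have ins: "t * cis \<theta> \<in> \<rho> x" if "x \<in> T" "\<alpha> x < \<theta>" "\<theta> < \<beta> x" for x \<theta>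
    using on[OF that(1)] that by (auto simp: arc_on_def)
  have bnd: "\<alpha> x \<le> ang t z \<and> ang t z \<le> \<beta> x" if "x \<in> T" "z \<in> \<rho> x" for x z
    using on[OF that(1)] that by (auto simp: arc_on_def)
  have angb: "ang t (t * cis \<theta>) = \<theta>" if "\<alpha> u \<le> \<theta>" "\<theta> < 2 * pi" for \<theta>
    using that range ang_mult_cis[OF t(1)] by simp
  have a: "t * cis (\<alpha> u) \<notin> \<rho> x" if "x \<in> T" "\<alpha> u < \<alpha> x" for x
    using bnd[OF that(1), of "t * cis (\<alpha> u)"] angb[of "\<alpha> u"] that o range uvw by auto
  \<comment> \<open>The angle \<open>2 * pi\<close> is not a value of \<open>ang\<close>; there the
    endpoint is \<open>t\<close> itself, which lies in no arc of the triangle.\<close>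
  have c: "t * cis (\<beta> w) \<notin> \<rho> x" if "x \<in> T" "\<beta> x < \<beta> w" for x
  proof (cases "\<beta> w = 2 * pi")
    case True then show ?thesis using t that by simp
  next
    case False
    then show ?thesis
      using bnd[OF that(1), of "t * cis (\<beta> w)"] angb[of "\<beta> w"] that o range uvw by auto
  qed
  \<comment> \<open>The arc \<open>w\<close> begins before \<open>u\<close> ends, so no gap between
    them is left for \<open>v\<close>.\<close>
  have "\<rho> v \<subseteq> \<rho> u \<union> \<rho> w"
  proof
    fix z assume z: "z \<in> \<rho> v"
    then have zc: "t * cis (ang t z) = z" using mult_cis_ang t arcs mem by blast
    show "z \<in> \<rho> u \<union> \<rho> w"
      using bnd[OF mem(2) z] ins[OF mem(1), of "ang t z"] ins[OF mem(3), of "ang t z"] zc o uvw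
      by (cases "ang t z < \<beta> u") auto
  qed
  then show thesis
    using that[of u v w "t * cis (\<alpha> u)" "t * cis (\<beta> u)" "t * cis (\<beta> w)" "t * cis (\<alpha> w)"]
      uvw ne on mem a c ins o by (auto simp: arc_on_def insert_commute)
qed

text \<open>From a point outside both arcs, \<open>X\<close> is an interval containing the two ends
  of \<open>A\<close> and hence everything between them. Used contrapositively: an arc overlapping
  \<open>u\<close> and containing its outer endpoint misses the inner one.\<close>

lemma arc_contains_overlapped:
  assumes "A \<subseteq> circle" "connected A" "X \<subseteq> circle" "connected X"
    and "endpoints A \<subseteq> X" "X \<union> A \<noteq> circle"
  shows "A \<subseteq> X"
proof
  fix s assume s: "s \<in> A"
  obtain t where t: "t \<in> circle" "t \<notin> X" "t \<notin> A" using assms by blast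
  obtain \<alpha> \<beta> where *: "0 \<le> \<alpha>" "\<alpha> \<le> \<beta>" "\<beta> \<le> 2 * pi"
    "\<And>z. z \<in> A \<Longrightarrow> \<alpha> \<le> ang t z \<and> ang t z \<le> \<beta>"
    "t * cis \<alpha> \<in> endpoints A" "t * cis \<beta> \<in> endpoints A"
    using arc_parametrization[OF t(1,3) assms(1,2)] s by (metis empty_iff)
  have ne: "t * cis \<alpha> \<noteq> t" "t * cis \<beta> \<noteq> t" using * assms(5) t by auto
  then have "\<beta> < 2 * pi" using * by (cases "\<beta> = 2 * pi") auto
  then have "ang t (t * cis \<alpha>) = \<alpha>" "ang t (t * cis \<beta>) = \<beta>"
    using ang_mult_cis[OF t(1)] * by auto
  then have "t * cis (ang t s) \<in> X"
    using connected_ang_between[OF t(1,2) assms(3,4), of "t * cis \<alpha>" "t * cis \<beta>"] *(4)[OF s] * assms(5)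
    by auto
  then show "s \<in> X" using mult_cis_ang[OF t(1)] s assms(1) by auto
qed

lemma connected_meets_endpoints:
  assumes "A \<subseteq> circle" "X \<subseteq> circle" "connected X" "X \<inter> A \<noteq> {}" "\<not> X \<subseteq> A"
  shows "X \<inter> endpoints A \<noteq> {}"
  unfolding endpoints_def
  using assms by (intro connectedin_Int_frontier_of) (auto simp: connectedin_subtopology)

text \<open>As \<open>a\<close> is no endpoint of any \<open>B\<close>, membership in each
  \<open>B\<close> is constant near \<open>a\<close>, and finitely many such neighbourhoods still
  leave a neighbourhood of \<open>a\<close>. Being an endpoint of \<open>A\<close>, the point
  \<open>a\<close> is approached from both sides of \<open>A\<close>.\<close>

lemma point_beyond_endpoint:
  assumes A: "A \<subseteq> circle" "a \<in> endpoints A" and "finite \<B>"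
    and B: "\<And>B. B \<in> \<B> \<Longrightarrow> B \<subseteq> circle \<and> a \<notin> endpoints B"
  obtains p p' where "p \<in> circle" "p \<notin> A" "\<And>B. B \<in> \<B> \<Longrightarrow> p \<in> B \<longleftrightarrow> a \<in> B"
    "p' \<in> A" "\<And>B. B \<in> \<B> \<Longrightarrow> p' \<in> B \<longleftrightarrow> a \<in> B"
proof -
  define D where "D = (\<Union>B\<in>\<B>. (if a \<in> closure B then {} else closure B) \<union>
    (if a \<in> closure (circle - B) then {} else closure (circle - B)))"
  have "closed D" unfolding D_def using \<open>finite \<B>\<close> by (intro closed_UN) auto
  then have "open (- D)" by (rule open_Compl)
  moreover have "a \<in> - D" by (auto simp: D_def)
  moreover have a: "a \<in> circle" "a \<in> closure (circle - A)" "a \<in> closure A"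
    using A endpoints_eq by auto
  ultimately obtain p p' where p: "p \<in> circle - A" "p \<in> - D" and p': "p' \<in> A" "p' \<in> - D"
    by (metis IntI disjoint_iff open_Int_closure_eq_empty)
  have "p \<in> B \<longleftrightarrow> a \<in> B" if "B \<in> \<B>" and p: "p \<in> circle" "p \<in> - D" for B p
  proof -
    have pD: "p \<notin> (if a \<in> closure B then {} else closure B)"
      "p \<notin> (if a \<in> closure (circle - B) then {} else closure (circle - B))"
      using p(2) \<open>B \<in> \<B>\<close> unfolding D_def by blast+
    have "a \<notin> closure B \<or> a \<notin> closure (circle - B)"
      using B[OF \<open>B \<in> \<B>\<close>] a endpoints_eq[of B] by blast
    then show ?thesis
    proof
      assume n: "a \<notin> closure B"
      then have "p \<notin> closure B" using pD(1) by simp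
      then show ?thesis using n closure_subset[of B] by blast
    next
      assume n: "a \<notin> closure (circle - B)"
      then have "p \<notin> closure (circle - B)" using pD(2) by simp
      then show ?thesis using n a(1) p(1) closure_subset[of "circle - B"] by blast
    qed
  qed
  then show thesis using that p p' A by blast
qed

subsection \<open>The neighbourhood matrix\<close>

lemma adj_commute: "adj G u v \<longleftrightarrow> adj G v u"
  by (simp add: adj_def insert_commute)

lemma adj_verts:
  assumes "simple_graph G" "adj G u v"
  shows "u \<in> verts G" "v \<in> verts G" "u \<noteq> v"
  using assms by (auto simp: simple_graph_def adj_def dest!: bspec)

lemma closed_nbh_iff: "w \<in> closed_nbh G v \<longleftrightarrow> w = v \<or> w \<in> verts G \<and> adj G v w"
  by (auto simp: closed_nbh_def adj_commute)

text \<open>The \<open>CC\<close> entry without the overlap requirement. It is separated out because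
  it is exactly what fails for an \<open>OV\<close> pair.\<close>

definition cc_cond :: "'v ugraph \<Rightarrow> 'v \<Rightarrow> 'v \<Rightarrow> bool" where
  "cc_cond G u v \<longleftrightarrow> closed_nbh G u \<union> closed_nbh G v = verts G \<and>
    (\<forall>w \<in> closed_nbh G u - closed_nbh G v. closed_nbh G w \<subseteq> closed_nbh G u) \<and>
    (\<forall>w \<in> closed_nbh G v - closed_nbh G u. closed_nbh G w \<subseteq> closed_nbh G v)"

lemma cc_cond_commute: "cc_cond G u v \<longleftrightarrow> cc_cond G v u"
  by (auto simp: cc_cond_def)

lemma nbh_matrix_DI_iff: "nbh_matrix G u v = DI \<longleftrightarrow> \<not> adj G u v"
  by (auto simp: nbh_matrix_def Let_def)

lemma nbh_matrix_CD_iff: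
  "nbh_matrix G u v = CD \<longleftrightarrow> adj G u v \<and> closed_nbh G u \<subset> closed_nbh G v"
  by (auto simp: nbh_matrix_def Let_def)

lemma nbh_matrix_CS_iff:
  "nbh_matrix G u v = CS \<longleftrightarrow> adj G u v \<and> closed_nbh G v \<subset> closed_nbh G u"
  by (auto simp: nbh_matrix_def Let_def)

lemma nbh_matrix_CC_iff:
  "nbh_matrix G u v = CC \<longleftrightarrow> adj G u v \<and> \<not> closed_nbh G u \<subset> closed_nbh G v \<and>
    \<not> closed_nbh G v \<subset> closed_nbh G u \<and> overlap (closed_nbh G u) (closed_nbh G v) \<and> cc_cond G u v"
  by (auto simp: nbh_matrix_def Let_def cc_cond_def)

lemma nbh_matrix_OV_iff:
  "nbh_matrix G u v = OV \<longleftrightarrow> adj G u v \<and> \<not> closed_nbh G u \<subset> closed_nbh G v \<and>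
    \<not> closed_nbh G v \<subset> closed_nbh G u \<and> \<not> (overlap (closed_nbh G u) (closed_nbh G v) \<and> cc_cond G u v)"
  by (auto simp: nbh_matrix_def Let_def cc_cond_def)

lemma nbh_matrix_OV_commute: "nbh_matrix G u v = OV \<longleftrightarrow> nbh_matrix G v u = OV"
  using cc_cond_commute[of G u v]
  by (auto simp: nbh_matrix_OV_iff adj_commute overlap_def Int_commute)

text \<open>Adjacency gives a common neighbour, and by twin-freeness the neighbourhoods, neither
  strictly inside the other, are also distinct. They overlap, so only \<open>cc_cond\<close> can
  have prevented the entry \<open>CC\<close>.\<close>

lemma nbh_matrix_OV_not_cc:
  assumes "std_graph G" "u \<in> verts G" "v \<in> verts G" "nbh_matrix G u v = OV"
  shows "\<not> cc_cond G u v"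
proof -
  have "u \<noteq> v" using assms adj_verts[of G u v] by (auto simp: nbh_matrix_OV_iff std_graph_def)
  then have "closed_nbh G u \<noteq> closed_nbh G v"
    using assms by (auto simp: std_graph_def twin_free_def)
  moreover have "u \<in> closed_nbh G u \<inter> closed_nbh G v"
    using assms by (auto simp: closed_nbh_iff nbh_matrix_OV_iff adj_commute)
  ultimately show ?thesis using assms(4) by (auto simp: nbh_matrix_OV_iff overlap_def)
qed

subsection \<open>Flip sets from Helly triangles\<close>

definition helly_in :: "'v ugraph \<Rightarrow> ('v \<Rightarrow> complex set) \<Rightarrow> 'v set \<Rightarrow> bool" where
  "helly_in G \<rho> T \<longleftrightarrow> T \<in> Delta G \<and> \<Inter> (\<rho> ` T) \<noteq> {}"

lemma normalized_repsD:
  assumes "\<rho> \<in> normalized_reps G"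
  shows "x \<in> verts G \<Longrightarrow> \<rho> x \<subset> circle \<and> connected (\<rho> x) \<and> card (endpoints (\<rho> x)) = 2"
    and "x \<in> verts G \<Longrightarrow> y \<in> verts G \<Longrightarrow> x \<noteq> y \<Longrightarrow> endpoints (\<rho> x) \<inter> endpoints (\<rho> y) = {}"
    and "x \<in> verts G \<Longrightarrow> y \<in> verts G \<Longrightarrow> x \<noteq> y \<Longrightarrow> adj G x y \<longleftrightarrow> \<rho> x \<inter> \<rho> y \<noteq> {}"
    and "x \<in> verts G \<Longrightarrow> y \<in> verts G \<Longrightarrow> x \<noteq> y \<Longrightarrow> has_itype (nbh_matrix G x y) (\<rho> x) (\<rho> y)"
    and "inj_on \<rho> (verts G)"
  using assms unfolding normalized_reps_def ca_rep_def is_arc_def by auto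

lemma Delta_verts: "T \<in> Delta G \<Longrightarrow> T \<subseteq> verts G \<and> card T = 3"
  by (simp add: Delta_def ov_triangle_def)

lemma Delta_OV: "T \<in> Delta G \<Longrightarrow> x \<in> T \<Longrightarrow> y \<in> T \<Longrightarrow> x \<noteq> y \<Longrightarrow> nbh_matrix G x y = OV"
  by (simp add: Delta_def ov_triangle_def)

lemma Delta_cover: "T \<in> Delta G \<Longrightarrow> (\<Union>t\<in>T. closed_nbh G t) = verts G"
  by (simp add: Delta_def)

lemma Delta_private:
  "T \<in> Delta G \<Longrightarrow> x \<in> T \<Longrightarrow> y \<in> private_nbh G T x \<Longrightarrow> nbh_matrix G y x = CD"
  by (simp add: Delta_def)

text \<open>A vertex \<open>x\<close> containing \<open>u\<close> can replace it in the triangle, unless \<open>x\<close> also contains \<open>v\<close>, which makes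
  \<open>x\<close> and \<open>w\<close> satisfy the conditions for \<open>cc\<close>, or \<open>w\<close>, which makes \<open>x\<close> universal.\<close>

lemma extreme_arc_not_contained:
  assumes G: "std_graph G" and T: "{u, v, w} \<in> Delta G" "u \<noteq> v" "v \<noteq> w" "u \<noteq> w"
    and cover: "closed_nbh G u \<union> closed_nbh G w = verts G"
    and x: "x \<in> verts G" "nbh_matrix G x u = CS" "nbh_matrix G x v \<noteq> CC" "nbh_matrix G x w \<noteq> CC"
      "nbh_matrix G x v \<noteq> CD" "nbh_matrix G x w \<noteq> CD"
    and ext: "x \<notin> {u, v, w}" "{x, v, w} \<notin> Delta G"
  shows False
proof -
  let ?N = "closed_nbh G"
  have sg: "simple_graph G" using G by (simp add: std_graph_def)
  have V: "u \<in> verts G" "v \<in> verts G" "w \<in> verts G" using Delta_verts[OF T(1)] by auto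
  have NV: "?N y \<subseteq> verts G" if "y \<in> verts G" for y using that by (auto simp: closed_nbh_iff)
  have sub: "?N u \<subset> ?N x" using x(2) by (simp add: nbh_matrix_CS_iff)
  have ov: "nbh_matrix G u v = OV" "nbh_matrix G u w = OV" "nbh_matrix G v w = OV" "nbh_matrix G w v = OV"
    using Delta_OV[OF T(1)] T by auto
  then have "v \<in> ?N u" "w \<in> ?N u" using V by (auto simp: nbh_matrix_OV_iff closed_nbh_iff)
  then have adjx: "adj G x v" "adj G x w" using sub ext(1) by (auto simp: closed_nbh_iff)
  have notw: "nbh_matrix G x w \<noteq> CS"
  proof
    assume "nbh_matrix G x w = CS"
    then have "?N x = verts G" using sub cover NV[OF x(1)] by (auto simp: nbh_matrix_CS_iff)
    then show False using G x(1) by (auto simp: std_graph_def has_universal_vertex_def)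
  qed
  then have ovw: "nbh_matrix G x w = OV"
    using x adjx by (cases "nbh_matrix G x w") (auto simp: nbh_matrix_DI_iff)
  \<comment> \<open>By \<open>cover\<close>, a vertex outside the neighbourhoods of \<open>u\<close>
    and \<open>v\<close> is a private neighbour of \<open>w\<close>, so membership in
    \<open>Delta G\<close> applies to it.\<close>
  have priv: "nbh_matrix G y w = CD" if "y \<in> verts G" "y \<notin> ?N u" "y \<notin> ?N v" for y
  proof -
    have "y \<in> ?N w" using cover that by auto
    moreover have "y \<noteq> w" using that \<open>w \<in> ?N u\<close> by auto
    ultimately have "y \<in> private_nbh G {u, v, w} w"
      using that T by (auto simp: private_nbh_def closed_nbh_iff adj_commute)
    then show ?thesis using Delta_private[OF T(1)] by auto
  qed
  show False
  proof (cases "nbh_matrix G x v = CS")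
    case True
    then have sub': "?N v \<subset> ?N x" by (simp add: nbh_matrix_CS_iff)
    \<comment> \<open>A neighbour of \<open>s\<close> outside \<open>?N x\<close> would be private
      to \<open>w\<close>; its neighbourhood, which contains \<open>s\<close>, would then lie in
      \<open>?N w\<close>.\<close>
    have "?N s \<subseteq> ?N x" if s: "s \<in> ?N x - ?N w" for s
    proof
      fix y assume y: "y \<in> ?N s"
      show "y \<in> ?N x"
      proof (rule ccontr)
        assume n: "y \<notin> ?N x"
        have sV: "s \<in> verts G" using s NV[OF x(1)] by auto
        then have yV: "y \<in> verts G" using y NV by blast
        then have "nbh_matrix G y w = CD" using priv n sub sub' by blast
        then have "?N y \<subset> ?N w" by (simp add: nbh_matrix_CD_iff)
        moreover have "s \<in> ?N y" using y sV yV by (auto simp: closed_nbh_iff adj_commute)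
        ultimately show False using s by auto
      qed
    qed
    moreover have "?N s \<subseteq> ?N w" if s: "s \<in> ?N w - ?N x" for s
    proof -
      have "nbh_matrix G s w = CD" using priv[of s] s NV[OF V(3)] sub sub' by blast
      then show ?thesis by (auto simp: nbh_matrix_CD_iff)
    qed
    moreover have "?N x \<union> ?N w = verts G" using cover sub NV[OF x(1)] NV[OF V(3)] by blast
    ultimately have "cc_cond G x w" by (simp add: cc_cond_def)
    then show False using nbh_matrix_OV_not_cc[OF G x(1) V(3) ovw] by simp
  next
    case False
    then have ovv: "nbh_matrix G x v = OV"
      using x adjx by (cases "nbh_matrix G x v") (auto simp: nbh_matrix_DI_iff)
    \<comment> \<open>Here \<open>x\<close> takes the place of \<open>u\<close>. A private neighbour
      of \<open>x\<close> avoids \<open>?N w\<close>, so by \<open>cover\<close> it was already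
      private to \<open>u\<close>. Private neighbours of \<open>v\<close> and \<open>w\<close> avoid
      \<open>?N x\<close>, a superset of \<open>?N u\<close>, so they were private before as
      well.\<close>
    have "ov_triangle G {x, v, w}"
      using ovv ovw ov x(1) V ext(1) T nbh_matrix_OV_commute[of G] by (auto simp: ov_triangle_def card_3_iff)
    moreover have "(\<Union>t\<in>{x, v, w}. ?N t) = verts G"
      using cover sub NV x(1) V by blast
    moreover have "nbh_matrix G y x = CD" if y: "y \<in> private_nbh G {x, v, w} x" for y
    proof -
      have y': "y \<in> verts G" "\<not> adj G y v" "\<not> adj G y w" "y \<noteq> v" "y \<noteq> w" "adj G y x" "y \<noteq> x"
        using y ext(1) by (auto simp: private_nbh_def)
      then have "y \<notin> ?N w" by (simp add: closed_nbh_iff adj_commute)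
      then have yu: "y \<in> ?N u" using cover y'(1) by blast
      moreover have "y \<noteq> u" using y' ov by (auto simp: nbh_matrix_OV_iff)
      ultimately have "y \<in> private_nbh G {u, v, w} u"
        using y' T by (auto simp: private_nbh_def closed_nbh_iff adj_commute)
      then have "nbh_matrix G y u = CD" using Delta_private[OF T(1)] by auto
      then show ?thesis using sub y' by (auto simp: nbh_matrix_CD_iff)
    qed
    moreover have "nbh_matrix G y s = CD" if s: "s \<in> {v, w}" and y: "y \<in> private_nbh G {x, v, w} s" for s y
    proof -
      have y': "y \<in> verts G" "\<not> adj G y x" "adj G y s" "y \<notin> {x, v, w}" "\<forall>t\<in>{v, w}. t \<noteq> s \<longrightarrow> \<not> adj G y t"
        using y s ext(1) by (auto simp: private_nbh_def)
      then have "y \<notin> ?N x" by (auto simp: closed_nbh_iff adj_commute)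
      then have "y \<notin> ?N u" using sub by blast
      then have "y \<in> private_nbh G {u, v, w} s"
        using y' by (auto simp: private_nbh_def closed_nbh_iff adj_commute)
      then show ?thesis using Delta_private[OF T(1)] s by auto
    qed
    ultimately have "{x, v, w} \<in> Delta G" by (auto simp: Delta_def)
    then show False using ext(2) by simp
  qed
qed

text \<open>The flip set consists of the arcs through a point just outside \<open>u\<close> at its
  outer endpoint \<open>a\<close>. The vertex \<open>z\<close> serves to make it nonempty, and
  \<open>max\<close> keeps arcs containing \<open>u\<close> away from that point.\<close>

lemma flip_set_beyond_extreme_arc:
  fixes u v w :: 'v
  assumes G: "std_graph G" and \<rho>: "\<rho> \<in> normalized_reps G"
    and T: "helly_in G \<rho> {u, v, w}" "u \<noteq> v" "v \<noteq> w" "u \<noteq> w"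
    and max: "\<And>T'. helly_in G \<rho> T' \<Longrightarrow>
      (\<Sum>t\<in>T'. card (closed_nbh G t)) \<le> (\<Sum>t\<in>{u, v, w}. card (closed_nbh G t))"
    and ab: "endpoints (\<rho> u) = {a, b}" "a \<notin> \<rho> v" "a \<notin> \<rho> w" "b \<in> \<rho> v" "b \<in> \<rho> w"
    and cover: "closed_nbh G u \<union> closed_nbh G w = verts G"
    and z: "z \<in> closed_nbh G u" "z \<notin> closed_nbh G w" "\<not> closed_nbh G z \<subseteq> closed_nbh G u"
  shows "\<exists>X\<in>f_N G. flip_set G X"
proof -
  let ?N = "closed_nbh G" and ?T = "{u, v, w}"
  note rep = normalized_repsD[OF \<rho>]
  have sg: "simple_graph G" using G by (simp add: std_graph_def)
  then have fin: "finite (verts G)" by (simp add: simple_graph_def)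
  have \<Delta>: "?T \<in> Delta G" and hel: "\<Inter> (\<rho> ` ?T) \<noteq> {}" using T by (auto simp: helly_in_def)
  have V: "u \<in> verts G" "v \<in> verts G" "w \<in> verts G" using Delta_verts[OF \<Delta>] by auto
  have a: "a \<notin> endpoints (\<rho> x)" if "x \<in> verts G - {u}" for x
    using rep(2)[of x u] that V(1) ab(1) by auto
  obtain p p' where p: "p \<in> circle" "p \<notin> \<rho> u" "\<And>x. x \<in> verts G - {u} \<Longrightarrow> p \<in> \<rho> x \<longleftrightarrow> a \<in> \<rho> x"
    and p': "p' \<in> \<rho> u" "\<And>x. x \<in> verts G - {u} \<Longrightarrow> p' \<in> \<rho> x \<longleftrightarrow> a \<in> \<rho> x"
  proof (rule point_beyond_endpoint[of "\<rho> u" a "\<rho> ` (verts G - {u})"])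
    show "\<rho> u \<subseteq> circle" "a \<in> endpoints (\<rho> u)" "finite (\<rho> ` (verts G - {u}))"
      using rep(1)[OF V(1)] ab fin by auto
    show "B \<subseteq> circle \<and> a \<notin> endpoints B" if "B \<in> \<rho> ` (verts G - {u})" for B
      using that rep(1) a by blast
  qed (use that in auto)
  have pT: "p \<notin> \<rho> t" if "t \<in> ?T" for t using that p ab V T by auto
  \<comment> \<open>Leaving \<open>u\<close> means meeting one of its endpoints, and
    \<open>b\<close> is excluded because it lies in both \<open>v\<close> and
    \<open>w\<close>.\<close>
  have meets: "a \<in> \<rho> x"
    if x: "x \<in> verts G" "\<rho> x \<inter> \<rho> u \<noteq> {}" "\<not> \<rho> x \<subseteq> \<rho> u" and t: "t \<in> {v, w}" "\<rho> x \<inter> \<rho> t = {}" for x t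
  proof -
    have "\<rho> x \<inter> endpoints (\<rho> u) \<noteq> {}"
      using rep(1)[OF x(1)] rep(1)[OF V(1)] x by (intro connected_meets_endpoints) auto
    moreover have "b \<notin> \<rho> x" using t ab by auto
    ultimately show ?thesis using ab(1) by auto
  qed
  define X where "X = {x \<in> verts G. p \<in> \<rho> x}"
  have sup1: "x \<in> X" if "x \<in> Gamma_ov G u v w" for x
  proof -
    have x: "x \<in> verts G" "x \<notin> ?T" "nbh_matrix G x u = OV" "nbh_matrix G x w = DI"
      using that by (auto simp: Gamma_ov_def)
    have "has_itype OV (\<rho> x) (\<rho> u)" "has_itype DI (\<rho> x) (\<rho> w)"
      using rep(4)[of x u] rep(4)[of x w] x V by auto
    then have "a \<in> \<rho> x" using meets[of x w] x by (auto simp: overlap_def)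
    then show ?thesis using p(3) x by (auto simp: X_def)
  qed
  have sup2: "x \<in> X" if "x \<in> Gamma_cc G u v w" for x
  proof -
    have x: "x \<in> verts G" "x \<notin> ?T" using that by (auto simp: Gamma_cc_def)
    have "(nbh_matrix G x u = OV \<and> nbh_matrix G x w = OV \<and> nbh_matrix G x v = DI) \<or>
        (\<exists>t\<in>?T. nbh_matrix G x t = CC)"
      using that[unfolded Gamma_cc_def mem_Collect_eq] by (rule conjunct2)
    then show ?thesis
    proof (elim disjE bexE)
      assume 1: "nbh_matrix G x u = OV \<and> nbh_matrix G x w = OV \<and> nbh_matrix G x v = DI"
      have "has_itype OV (\<rho> x) (\<rho> u)" "has_itype DI (\<rho> x) (\<rho> v)"
        using rep(4)[of x u] rep(4)[of x v] x V 1 by auto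
      then have "a \<in> \<rho> x" using meets[of x v] x by (auto simp: overlap_def)
      then show ?thesis using p(3) x by (auto simp: X_def)
    next
      fix t assume 2: "t \<in> ?T" "nbh_matrix G x t = CC"
      have "has_itype CC (\<rho> x) (\<rho> t)"
        using rep(4)[of x t] x V 2 by auto
      then have "\<rho> x \<union> \<rho> t = circle" by simp
      then show ?thesis using pT[OF 2(1)] p(1) x(1) by (auto simp: X_def)
    qed
  qed
  have sub: "x \<in> Gamma_ov G u v w \<union> Gamma_cc G u v w \<union> Omega G u v w" if "x \<in> X" for x
  proof (rule ccontr)
    assume n: "\<not> ?thesis"
    have x: "x \<in> verts G" "p \<in> \<rho> x" using that by (auto simp: X_def)
    then have xT: "x \<notin> ?T" using pT by blast
    have ax: "a \<in> \<rho> x" using p(3)[of x] x xT by simp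
    have ty: "has_itype (nbh_matrix G x t) (\<rho> x) (\<rho> t)" if "t \<in> ?T" for t
      using rep(4)[of x t] x(1) xT V that by auto
    have notCD: "nbh_matrix G x t \<noteq> CD" if "t \<in> ?T" for t
      using ty[OF that] pT[OF that] x(2) by auto
    have notCC: "nbh_matrix G x t \<noteq> CC" if "t \<in> ?T" for t
      using n that x xT by (auto simp: Gamma_cc_def)
    \<comment> \<open>Points of \<open>u\<close> arbitrarily close to \<open>a\<close>, such as
      \<open>p'\<close>, belong to the same other arcs as \<open>a\<close>, so \<open>x\<close>
      meets \<open>u\<close>.\<close>
    have "nbh_matrix G x u \<noteq> DI"
      using ty[of u] p'(1) p'(2)[of x] ax x(1) xT by auto
    moreover have "nbh_matrix G x u \<noteq> CS"
    proof
      assume cs: "nbh_matrix G x u = CS"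
      then have sub: "?N u \<subset> ?N x" by (simp add: nbh_matrix_CS_iff)
      have "{x, v, w} \<notin> Delta G"
      proof
        assume d: "{x, v, w} \<in> Delta G"
        have "\<rho> u \<subset> \<rho> x" using ty[of u] cs by simp
        then have "helly_in G \<rho> {x, v, w}" using d hel by (auto simp: helly_in_def)
        then have "(\<Sum>t\<in>{x, v, w}. card (?N t)) \<le> (\<Sum>t\<in>?T. card (?N t))" by (rule max)
        then have "card (?N x) \<le> card (?N u)" using xT T(2-4) by auto
        moreover have "card (?N u) < card (?N x)"
          using sub fin x(1) by (intro psubset_card_mono) (auto simp: closed_nbh_def)
        ultimately show False by simp
      qed
      then show False
        using extreme_arc_not_contained[OF G \<Delta> T(2-4) cover x(1) cs] notCD notCC xT by auto
    qed
    ultimately have ovu: "nbh_matrix G x u = OV"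
      using notCD notCC by (cases "nbh_matrix G x u") auto
    then have "overlap (\<rho> x) (\<rho> u)" "\<rho> x \<union> \<rho> u \<noteq> circle" using ty[of u] by auto
    \<comment> \<open>An arc missing \<open>b\<close> contains neither \<open>v\<close> nor
      \<open>w\<close>, which leaves only \<open>DI\<close> and \<open>OV\<close> as entries for
      them.\<close>
    then have "b \<notin> \<rho> x"
      using arc_contains_overlapped[of "\<rho> u" "\<rho> x"] rep(1)[OF V(1)] rep(1)[OF x(1)] ax ab(1)
      by (auto simp: overlap_def)
    then have "nbh_matrix G x t \<noteq> CS" if "t \<in> {v, w}" for t
      using ty[of t] that ab by auto
    then have vw: "nbh_matrix G x t = DI \<or> nbh_matrix G x t = OV" if "t \<in> {v, w}" for t
      using that notCD notCC by (cases "nbh_matrix G x t") auto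
    \<comment> \<open>If \<open>u\<close> were the only neighbour of \<open>x\<close> in the
      triangle, \<open>x\<close> would be private to \<open>u\<close> and hence contained in it,
      although \<open>p\<close> is outside \<open>u\<close>.\<close>
    have "\<not> (nbh_matrix G x v = DI \<and> nbh_matrix G x w = DI)"
    proof
      assume "nbh_matrix G x v = DI \<and> nbh_matrix G x w = DI"
      then have "x \<in> private_nbh G ?T u"
        using x(1) xT ovu by (auto simp: private_nbh_def nbh_matrix_DI_iff nbh_matrix_OV_iff)
      then show False using Delta_private[OF \<Delta>, of u x] notCD by auto
    qed
    then show False
      using vw[of v] vw[of w] ovu n x(1) xT by (auto simp: Gamma_ov_def Gamma_cc_def Omega_def)
  qed
  \<comment> \<open>Nothing is known about which members of \<open>Omega\<close> contain
    \<open>p\<close>; their trace on \<open>X\<close> is the free subset in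
    \<open>f_N\<close>.\<close>
  have "X = Gamma_ov G u v w \<union> Gamma_cc G u v w \<union> (X \<inter> Omega G u v w)"
    using sup1 sup2 sub by blast
  moreover have "distinct [u, v, w]" using T(2-4) by simp
  ultimately have "X \<in> f_N G"
    unfolding f_N_def mem_Collect_eq using \<Delta> by (intro exI conjI) (assumption | rule Int_lower2)+
  moreover have "flip_set G X"
  proof -
    have "w \<in> ?N u" "v \<in> ?N w"
      using Delta_OV[OF \<Delta>] T V by (auto simp: nbh_matrix_OV_iff closed_nbh_iff)
    then have zT: "z \<notin> ?T" "z \<in> verts G" "adj G z u" "\<not> adj G z w"
      using z V by (auto simp: closed_nbh_iff adj_commute)
    have "nbh_matrix G z u \<noteq> CD" "nbh_matrix G z u \<noteq> DI"
      using z(3) zT by (auto simp: nbh_matrix_CD_iff nbh_matrix_DI_iff)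
    then have "\<not> \<rho> z \<subseteq> \<rho> u"
      using rep(4)[of z u] zT V by (cases "nbh_matrix G z u") (auto simp: overlap_def)
    moreover have "\<rho> z \<inter> \<rho> u \<noteq> {}" "\<rho> z \<inter> \<rho> w = {}"
      using rep(3)[of z u] rep(3)[of z w] zT V by auto
    ultimately have "a \<in> \<rho> z" using meets[of z w] zT by auto
    then have "z \<in> X" using p(3) zT by (auto simp: X_def)
    then show ?thesis
      unfolding flip_set_def using \<rho> p(1) by (auto simp: X_def intro!: bexI[of _ \<rho>] bexI[of _ p])
  qed
  ultimately show ?thesis by blast
qed

lemma nonuniform_flip_set:
  assumes "G \<in> nonuniform_ca_graphs"
  shows "\<exists>X\<in>f_N G. flip_set G X"
proof -
  let ?N = "closed_nbh G"
  have G: "std_graph G" and "\<not> uniform G" and ca: "ca_graph G"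
    using assms by (auto simp: nonuniform_ca_graphs_def ca_graph_def)
  then obtain T0 \<rho> where \<rho>: "\<rho> \<in> normalized_reps G" and T0: "T0 \<in> Delta G" "\<not> non_helly_triangle (\<rho> ` T0)"
    by (auto simp: uniform_def)
  note rep = normalized_repsD[OF \<rho>]
  have fin: "finite (verts G)" using G by (simp add: std_graph_def simple_graph_def)
  have ovr: "overlap (\<rho> x) (\<rho> y) \<and> \<rho> x \<union> \<rho> y \<noteq> circle"
    if "T \<in> Delta G" "x \<in> T" "y \<in> T" "x \<noteq> y" for T x y
    using rep(4)[of x y] Delta_verts[OF that(1)] Delta_OV[OF that] that by auto
  \<comment> \<open>An \<open>OV\<close> triangle has distinct, pairwise intersecting arcs, so
    failing to be non-Helly can only mean a common point.\<close>
  have "helly_in G \<rho> T0"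
  proof (rule ccontr)
    assume "\<not> helly_in G \<rho> T0"
    then have "\<Inter> (\<rho> ` T0) = {}" using T0 by (simp add: helly_in_def)
    moreover have "card (\<rho> ` T0) = 3"
      using card_image[of \<rho> T0] Delta_verts[OF T0(1)] rep(5) by (metis inj_on_subset)
    moreover have "\<forall>A\<in>\<rho> ` T0. is_arc A"
      using rep(1) Delta_verts[OF T0(1)] by (auto simp: is_arc_def)
    moreover have "\<rho> x \<inter> \<rho> y \<noteq> {}" if "x \<in> T0" "y \<in> T0" for x y
    proof (cases "x = y")
      case True
      obtain x' where "x' \<in> T0" "x' \<noteq> x"
        using Delta_verts[OF T0(1)] that by (metis card_3_iff insertCI)
      then have "\<rho> x \<inter> \<rho> x' \<noteq> {}" using ovr[OF T0(1) that(1)] by (auto simp: overlap_def)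
      then show ?thesis using True by auto
    next
      case False then show ?thesis using ovr[OF T0(1) that] by (auto simp: overlap_def)
    qed
    ultimately show False using T0(2) by (auto simp: non_helly_triangle_def)
  qed
  then have ne: "{T. helly_in G \<rho> T} \<noteq> {}" by blast
  \<comment> \<open>The maximum is taken over the triangles that are Helly in the one representation
    \<open>\<rho>\<close> fixed above. A triangle enlarged by exchange stays Helly there, since the
    new arc contains the old one.\<close>
  let ?m = "\<lambda>T. \<Sum>t\<in>T. card (?N t)"
  have fin_helly: "finite {T. helly_in G \<rho> T}"
    by (rule finite_subset[of _ "Pow (verts G)"]) (use fin Delta_verts[of _ G] in \<open>auto simp: helly_in_def subset_iff\<close>)
  then have "Max (?m ` {T. helly_in G \<rho> T}) \<in> ?m ` {T. helly_in G \<rho> T}"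
    using ne by (intro Max_in) auto
  then obtain T where T: "helly_in G \<rho> T" "?m T = Max (?m ` {T. helly_in G \<rho> T})" by auto
  have max: "?m T' \<le> ?m T" if "helly_in G \<rho> T'" for T'
    unfolding T(2) using that fin_helly by (intro Max_ge) auto
  have \<Delta>: "T \<in> Delta G" "\<Inter> (\<rho> ` T) \<noteq> {}" using T(1) by (auto simp: helly_in_def)
  have TV: "x \<in> verts G" if "x \<in> T" for x using Delta_verts[OF \<Delta>(1)] that by auto
  obtain u v w a b c d where uvw: "T = {u, v, w}" "u \<noteq> v" "v \<noteq> w" "u \<noteq> w"
    and ab: "endpoints (\<rho> u) = {a, b}" "a \<notin> \<rho> v" "a \<notin> \<rho> w" "b \<in> \<rho> v" "b \<in> \<rho> w"
    and cd: "endpoints (\<rho> w) = {c, d}" "c \<notin> \<rho> v" "c \<notin> \<rho> u" "d \<in> \<rho> v" "d \<in> \<rho> u"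
    and sub: "\<rho> v \<subseteq> \<rho> u \<union> \<rho> w"
  proof (rule helly_triangle_order[of T \<rho>])
    show "card T = 3" using Delta_verts[OF \<Delta>(1)] by simp
    show "\<rho> x \<subseteq> circle \<and> connected (\<rho> x) \<and> card (endpoints (\<rho> x)) = 2" if "x \<in> T" for x
      using rep(1) TV[OF that] by auto
    show "endpoints (\<rho> x) \<inter> endpoints (\<rho> y) = {}" if "x \<in> T" "y \<in> T" "x \<noteq> y" for x y
      using rep(2) TV that by blast
    show "overlap (\<rho> x) (\<rho> y) \<and> \<rho> x \<union> \<rho> y \<noteq> circle" if "x \<in> T" "y \<in> T" "x \<noteq> y" for x y
      using ovr[OF \<Delta>(1)] that by blast
  qed (use \<Delta> in auto)
  have V: "u \<in> verts G" "v \<in> verts G" "w \<in> verts G" using TV uvw by auto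
  have ov: "nbh_matrix G u w = OV" "nbh_matrix G u v = OV" using Delta_OV[OF \<Delta>(1)] uvw by auto
  \<comment> \<open>The triangle dominates the graph, and the middle arc lies in the union of the
    outer two, so whatever meets \<open>v\<close> meets \<open>u\<close> or
    \<open>w\<close>.\<close>
  have cover: "?N u \<union> ?N w = verts G"
  proof -
    have "y \<in> ?N u \<union> ?N w" if y: "y \<in> verts G" for y
    proof (rule ccontr)
      assume n: "y \<notin> ?N u \<union> ?N w"
      then have "y \<in> ?N v" using Delta_cover[OF \<Delta>(1)] uvw(1) y by auto
      moreover have "v \<in> ?N u" using ov V by (auto simp: nbh_matrix_OV_iff closed_nbh_iff)
      ultimately have "y \<noteq> v" "adj G v y" using n by (auto simp: closed_nbh_iff)
      then have "\<rho> v \<inter> \<rho> y \<noteq> {}" using rep(3)[of v y] V y by auto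
      then have "\<rho> u \<inter> \<rho> y \<noteq> {} \<or> \<rho> w \<inter> \<rho> y \<noteq> {}" using sub by auto
      then show False using n rep(3)[of u y] rep(3)[of w y] V y by (auto simp: closed_nbh_iff)
    qed
    moreover have "?N u \<subseteq> verts G" "?N w \<subseteq> verts G" using V by (auto simp: closed_nbh_iff)
    ultimately show ?thesis by blast
  qed
  have "\<not> cc_cond G u w" by (rule nbh_matrix_OV_not_cc[OF G V(1,3) ov(1)])
  \<comment> \<open>With \<open>cover\<close> established, the failure of \<open>cc_cond\<close>
    leaves a vertex violating one of its two inclusion clauses.\<close>
  then consider z where "z \<in> ?N u" "z \<notin> ?N w" "\<not> ?N z \<subseteq> ?N u"
    | z where "z \<in> ?N w" "z \<notin> ?N u" "\<not> ?N z \<subseteq> ?N w"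
    unfolding cc_cond_def using cover by blast
  then show ?thesis
  proof cases
    case 1
    show ?thesis
      by (rule flip_set_beyond_extreme_arc[OF G \<rho> T(1)[unfolded uvw(1)] uvw(2-4)
            max[unfolded uvw(1)] ab cover 1])
  next
    case 2
    \<comment> \<open>The order of the arcs may be read from the other side, with \<open>c\<close>
      and \<open>d\<close> in place of \<open>a\<close> and \<open>b\<close>.\<close>
    have swap: "{u, v, w} = {w, v, u}" "w \<noteq> v" "v \<noteq> u" "w \<noteq> u" using uvw by auto
    have cover': "?N w \<union> ?N u = verts G" using cover by blast
    show ?thesis
      by (rule flip_set_beyond_extreme_arc[OF G \<rho> T(1)[unfolded uvw(1) swap(1)] swap(2-4)
            max[unfolded uvw(1) swap(1)] cd cover' 2])
  qed
qed

subsection \<open>Label independence\<close>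

text \<open>Allows \<open>iso_Delta\<close> and \<open>iso_f_N\<close> to be one-way implications:
  the converse inclusion comes from transporting back.\<close>

lemma graph_iso_inv:
  assumes "graph_iso \<pi> G H"
  shows "graph_iso (inv_into (verts G) \<pi>) H G"
  using assms unfolding graph_iso_def
  by (auto simp: bij_betw_inv_into bij_betw_inv_into_right bij_betw_imp_surj_on inv_into_into)

context
  fixes G :: "'v ugraph" and H :: "'w ugraph" and \<pi> :: "'v \<Rightarrow> 'w"
  assumes iso: "graph_iso \<pi> G H"
begin

lemma iso_inj: "inj_on \<pi> (verts G)" and iso_verts: "\<pi> ` verts G = verts H"
  using iso by (auto simp: graph_iso_def bij_betw_def)

lemma iso_adj: "u \<in> verts G \<Longrightarrow> v \<in> verts G \<Longrightarrow> adj H (\<pi> u) (\<pi> v) \<longleftrightarrow> adj G u v"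
  using iso by (auto simp: graph_iso_def)

lemma iso_mem: "v \<in> verts G \<Longrightarrow> \<pi> v \<in> verts H"
  using iso_verts by auto

lemma iso_eq: "u \<in> verts G \<Longrightarrow> v \<in> verts G \<Longrightarrow> \<pi> u = \<pi> v \<longleftrightarrow> u = v"
  using iso_inj by (auto simp: inj_on_def)

lemma iso_closed_nbh: "v \<in> verts G \<Longrightarrow> closed_nbh H (\<pi> v) = \<pi> ` closed_nbh G v"
  by (auto simp: closed_nbh_iff iso_adj iso_mem iso_verts[symmetric])

lemma closed_nbh_subset_verts: "v \<in> verts G \<Longrightarrow> closed_nbh G v \<subseteq> verts G"
  by (auto simp: closed_nbh_iff)

lemma iso_subset: "A \<subseteq> verts G \<Longrightarrow> B \<subseteq> verts G \<Longrightarrow> \<pi> ` A \<subseteq> \<pi> ` B \<longleftrightarrow> A \<subseteq> B"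
  using inj_on_image_subset_iff[OF iso_inj] by blast

lemma iso_diff: "A \<subseteq> verts G \<Longrightarrow> B \<subseteq> verts G \<Longrightarrow> \<pi> ` A - \<pi> ` B = \<pi> ` (A - B)"
  using inj_on_image_set_diff[OF iso_inj, of A B] by blast

lemma iso_int: "A \<subseteq> verts G \<Longrightarrow> B \<subseteq> verts G \<Longrightarrow> \<pi> ` A \<inter> \<pi> ` B = \<pi> ` (A \<inter> B)"
  using inj_on_image_Int[OF iso_inj, of A B] by blast

lemma iso_psubset: "A \<subseteq> verts G \<Longrightarrow> B \<subseteq> verts G \<Longrightarrow> \<pi> ` A \<subset> \<pi> ` B \<longleftrightarrow> A \<subset> B"
  using iso_subset by (simp add: less_le_not_le)

lemma iso_cc_cond:
  assumes "u \<in> verts G" "v \<in> verts G"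
  shows "cc_cond H (\<pi> u) (\<pi> v) \<longleftrightarrow> cc_cond G u v"
proof -
  note N = closed_nbh_subset_verts
  have "closed_nbh H (\<pi> u) \<union> closed_nbh H (\<pi> v) = verts H \<longleftrightarrow>
      verts G \<subseteq> closed_nbh G u \<union> closed_nbh G v"
    using iso_subset[of "verts G" "closed_nbh G u \<union> closed_nbh G v"] N[OF assms(1)] N[OF assms(2)] assms
    by (auto simp: iso_closed_nbh iso_verts[symmetric] image_Un)
  moreover have "(\<forall>w\<in>closed_nbh H (\<pi> u') - closed_nbh H (\<pi> v'). closed_nbh H w \<subseteq> closed_nbh H (\<pi> u')) \<longleftrightarrow>
    (\<forall>w\<in>closed_nbh G u' - closed_nbh G v'. closed_nbh G w \<subseteq> closed_nbh G u')"
    if "u' \<in> verts G" "v' \<in> verts G" for u' v'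
  proof -
    have "closed_nbh H (\<pi> w) \<subseteq> closed_nbh H (\<pi> u') \<longleftrightarrow> closed_nbh G w \<subseteq> closed_nbh G u'"
      if "w \<in> closed_nbh G u'" for w
      using N that \<open>u' \<in> verts G\<close> iso_subset[of "closed_nbh G w" "closed_nbh G u'"]
      by (auto simp: iso_closed_nbh subset_iff)
    then show ?thesis
      using that N by (simp add: iso_closed_nbh iso_diff)
  qed
  ultimately show ?thesis
    using assms N[OF assms(1)] N[OF assms(2)] unfolding cc_cond_def by auto
qed

lemma iso_nbh_matrix:
  assumes "u \<in> verts G" "v \<in> verts G"
  shows "nbh_matrix H (\<pi> u) (\<pi> v) = nbh_matrix G u v"
proof -
  note N = closed_nbh_subset_verts
  have [simp]: "overlap (closed_nbh H (\<pi> u)) (closed_nbh H (\<pi> v)) \<longleftrightarrow> overlap (closed_nbh G u) (closed_nbh G v)"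
    using N assms by (simp add: overlap_def iso_closed_nbh iso_diff iso_int)
  have [simp]: "closed_nbh H (\<pi> u') \<subset> closed_nbh H (\<pi> v') \<longleftrightarrow> closed_nbh G u' \<subset> closed_nbh G v'"
    if "u' \<in> verts G" "v' \<in> verts G" for u' v'
    using N that by (simp add: iso_closed_nbh iso_psubset)
  show ?thesis
    using assms iso_cc_cond[OF assms] unfolding nbh_matrix_def Let_def cc_cond_def[symmetric]
    by (simp add: iso_adj flip: cc_cond_def)
qed

lemma iso_private_nbh:
  assumes "T \<subseteq> verts G" "x \<in> T"
  shows "private_nbh H (\<pi> ` T) (\<pi> x) = \<pi> ` private_nbh G T x"
proof -
  have x: "x \<in> verts G" using assms by auto
  have "\<pi> y \<in> private_nbh H (\<pi> ` T) (\<pi> x) \<longleftrightarrow> y \<in> private_nbh G T x" if "y \<in> verts G" for y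
    using that assms x iso_mem iso_adj iso_eq
    by (auto simp: private_nbh_def subset_iff image_iff)
  moreover have "private_nbh H (\<pi> ` T) (\<pi> x) \<subseteq> \<pi> ` verts G" "private_nbh G T x \<subseteq> verts G"
    by (auto simp: private_nbh_def iso_verts)
  ultimately show ?thesis by blast
qed

lemma iso_Delta:
  assumes "T \<in> Delta G"
  shows "\<pi> ` T \<in> Delta H"
proof -
  have T: "T \<subseteq> verts G" "card T = 3" using Delta_verts[OF assms] by auto
  have "card (\<pi> ` T) = 3" using T card_image inj_on_subset[OF iso_inj] by metis
  moreover have "(\<Union>t\<in>\<pi> ` T. closed_nbh H t) = \<pi> ` (\<Union>t\<in>T. closed_nbh G t)"
    using T by (auto simp: iso_closed_nbh subset_iff)
  moreover have "y \<in> verts G" if "y \<in> private_nbh G T x" for x y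
    using that by (simp add: private_nbh_def)
  ultimately show ?thesis
    using assms T iso_verts
    by (auto simp: Delta_def ov_triangle_def iso_private_nbh iso_nbh_matrix subset_iff)
qed

lemma iso_Gamma:
  assumes "u \<in> verts G" "v \<in> verts G" "w \<in> verts G"
  shows "Gamma_ov H (\<pi> u) (\<pi> v) (\<pi> w) = \<pi> ` Gamma_ov G u v w"
    "Gamma_cc H (\<pi> u) (\<pi> v) (\<pi> w) = \<pi> ` Gamma_cc G u v w"
    "Omega H (\<pi> u) (\<pi> v) (\<pi> w) = \<pi> ` Omega G u v w"
  using assms iso_verts[symmetric]
  by (auto simp: Gamma_ov_def Gamma_cc_def Omega_def iso_nbh_matrix iso_eq)

lemma iso_f_N:
  assumes "X \<in> f_N G"
  shows "\<pi> ` X \<in> f_N H"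
proof -
  obtain u v w \<Omega>' where X: "X = Gamma_ov G u v w \<union> Gamma_cc G u v w \<union> \<Omega>'" "distinct [u, v, w]"
    "{u, v, w} \<in> Delta G" "\<Omega>' \<subseteq> Omega G u v w"
    using assms by (auto simp: f_N_def)
  have V: "u \<in> verts G" "v \<in> verts G" "w \<in> verts G" using Delta_verts[OF X(3)] by auto
  have "\<pi> ` X = Gamma_ov H (\<pi> u) (\<pi> v) (\<pi> w) \<union> Gamma_cc H (\<pi> u) (\<pi> v) (\<pi> w) \<union> \<pi> ` \<Omega>'"
    by (simp add: X(1) iso_Gamma V image_Un)
  moreover have "{\<pi> u, \<pi> v, \<pi> w} \<in> Delta H" using iso_Delta[OF X(3)] by simp
  moreover have "distinct [\<pi> u, \<pi> v, \<pi> w]" using X(2) V by (simp add: iso_eq)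
  moreover have "\<pi> ` \<Omega>' \<subseteq> Omega H (\<pi> u) (\<pi> v) (\<pi> w)" using X(4) V by (auto simp: iso_Gamma)
  ultimately show ?thesis unfolding f_N_def by blast
qed

end

lemma f_N_verts: "X \<in> f_N G \<Longrightarrow> X \<subseteq> verts G"
  by (auto simp: f_N_def Gamma_ov_def Gamma_cc_def Omega_def)

lemma label_independent_f_N: "label_independent (f_N :: 'v ugraph \<Rightarrow> 'v set set)"
  unfolding label_independent_def
proof (intro allI impI)
  fix G H :: "'v ugraph" and \<pi> :: "'v \<Rightarrow> 'v" assume iso: "graph_iso \<pi> G H"
  have "X \<in> (\<lambda>X. \<pi> ` X) ` f_N G" if "X \<in> f_N H" for X
  proof -
    have "\<pi> ` verts G = verts H" using iso by (auto simp: graph_iso_def bij_betw_def)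
    then have "\<pi> ` inv_into (verts G) \<pi> ` X = X"
      using f_N_verts[OF that] by (auto simp: image_iff f_inv_into_f subset_iff)
    then show ?thesis using iso_f_N[OF graph_iso_inv[OF iso] that] by (metis image_eqI)
  qed
  then show "f_N H = (\<lambda>X. \<pi> ` X) ` f_N G" using iso_f_N[OF iso] by auto
qed

lemma candidate_function_f_N: "candidate_function (f_N :: 'v ugraph \<Rightarrow> 'v set set) nonuniform_ca_graphs"
  unfolding candidate_function_def
  using nonuniform_flip_set label_independent_f_N f_N_verts by (metis PowI subsetI)

subsection \<open>While programs over tapes\<close>

text \<open>Tapes are named by an arbitrary, possibly infinite type. A single program mentions only
  finitely many names, and only those become tapes of the machine.\<close>

datatype 'i act = Write 'i nat | Shift 'i move | Input move | Output io_sym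

datatype 'i test = Cell 'i nat | Same 'i 'i | Sees in_sym | Neg "'i test" | Both "'i test" "'i test"

datatype 'i prog = Act "'i act" | Seq "'i prog" "'i prog" (infixr ";;" 60)
  | Cond "'i test" "'i prog" "'i prog" | Loop "'i test" "'i prog"

text \<open>Input position, tapes and output.\<close>

type_synonym 'i mem = "nat \<times> ('i \<Rightarrow> work_tape) \<times> io_sym list"

fun scan :: "work_tape \<Rightarrow> nat" where
  "scan (t, h) = t h"

fun do_act :: "nat \<Rightarrow> 'i act \<Rightarrow> 'i mem \<Rightarrow> 'i mem" where
  "do_act l (Write i b) (p, m, o') = (p, m(i := ((fst (m i))(snd (m i) := b), snd (m i))), o')"
| "do_act l (Shift i d) (p, m, o') = (p, m(i := (fst (m i), move_work d (snd (m i)))), o')"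
| "do_act l (Input d) (p, m, o') = (move_input l d p, m, o')"
| "do_act l (Output a) (p, m, o') = (p, m, o' @ [a])"

fun passes :: "io_sym list \<Rightarrow> 'i test \<Rightarrow> 'i mem \<Rightarrow> bool" where
  "passes xs (Cell i b) (p, m, o') \<longleftrightarrow> scan (m i) = b"
| "passes xs (Same i j) (p, m, o') \<longleftrightarrow> scan (m i) = scan (m j)"
| "passes xs (Sees a) (p, m, o') \<longleftrightarrow> read_input xs p = a"
| "passes xs (Neg t) s \<longleftrightarrow> \<not> passes xs t s"
| "passes xs (Both t t') s \<longleftrightarrow> passes xs t s \<and> passes xs t' s"

fun pstep :: "io_sym list \<Rightarrow> 'i prog list \<times> 'i mem \<Rightarrow> 'i prog list \<times> 'i mem" where
  "pstep xs ([], s) = ([], s)"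
| "pstep xs (Act a # k, s) = (k, do_act (length xs) a s)"
| "pstep xs (Seq c d # k, s) = (c # d # k, s)"
| "pstep xs (Cond t c d # k, s) = ((if passes xs t s then c else d) # k, s)"
| "pstep xs (Loop t c # k, s) = (if passes xs t s then c # Loop t c # k else k, s)"

definition init_mem :: "'i mem" where
  "init_mem = (0, \<lambda>_. (\<lambda>_. 0, 0), [])"

fun bounded_heads :: "nat \<Rightarrow> 'i mem \<Rightarrow> bool" where
  "bounded_heads B (p, m, o') \<longleftrightarrow> (\<forall>i. - 1 \<le> snd (m i) \<and> snd (m i) \<le> int B)"

subsection \<open>Compilation to Turing machines\<close>

text \<open>The stacks of programs that can arise while executing \<open>c\<close> on top of \<open>k\<close>.\<close>

fun conts :: "'i prog \<Rightarrow> 'i prog list \<Rightarrow> 'i prog list set" where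
  "conts (Act a) k = {Act a # k, k}"
| "conts (Seq c d) k = insert (Seq c d # k) (conts c (d # k) \<union> conts d k)"
| "conts (Cond t c d) k = insert (Cond t c d # k) (conts c k \<union> conts d k)"
| "conts (Loop t c) k = {Loop t c # k, k} \<union> conts c (Loop t c # k)"

lemma finite_conts: "finite (conts c k)"
  by (induction c arbitrary: k) auto

lemma conts_start: "c # k \<in> conts c k"
  by (cases c) auto

lemma conts_end: "k \<in> conts c k"
  by (induction c arbitrary: k) auto

text \<open>The exception is the stack \<open>k\<close> itself: \<open>c\<close> has been executed,
  and what \<open>k\<close> does next need not belong to \<open>conts c k\<close>. For
  \<open>k = []\<close> it is harmless, since the empty stack does not move.\<close>

lemma conts_closed: "k' \<in> conts c k \<Longrightarrow> k' = k \<or> fst (pstep xs (k', s)) \<in> conts c k"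
proof (induction c arbitrary: k)
  case (Seq c d)
  then show ?case using conts_start[of c "d # k"] conts_start[of d k] by auto
next
  case (Cond t c d)
  then show ?case using conts_start[of c k] conts_start[of d k] by auto
next
  case (Loop t c)
  then show ?case using conts_start[of c "Loop t c # k"] Loop.IH[of "Loop t c # k"]
    by (cases "k' = Loop t c # k") auto
qed auto

section \<open>Finitely many tapes and symbols suffice for a program\<close>

fun act_ok :: "'i set \<Rightarrow> nat \<Rightarrow> 'i act \<Rightarrow> bool" where
  "act_ok U S (Write i b) \<longleftrightarrow> i \<in> U \<and> b < S"
| "act_ok U S (Shift i d) \<longleftrightarrow> i \<in> U"
| "act_ok U S (Input d) \<longleftrightarrow> True"
| "act_ok U S (Output a) \<longleftrightarrow> True"

fun test_ok :: "'i set \<Rightarrow> 'i test \<Rightarrow> bool" where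
  "test_ok U (Cell i b) \<longleftrightarrow> i \<in> U"
| "test_ok U (Same i j) \<longleftrightarrow> i \<in> U \<and> j \<in> U"
| "test_ok U (Sees a) \<longleftrightarrow> True"
| "test_ok U (Neg t) \<longleftrightarrow> test_ok U t"
| "test_ok U (Both t t') \<longleftrightarrow> test_ok U t \<and> test_ok U t'"

fun prog_ok :: "'i set \<Rightarrow> nat \<Rightarrow> 'i prog \<Rightarrow> bool" where
  "prog_ok U S (Act a) \<longleftrightarrow> act_ok U S a"
| "prog_ok U S (Seq c d) \<longleftrightarrow> prog_ok U S c \<and> prog_ok U S d"
| "prog_ok U S (Cond t c d) \<longleftrightarrow> test_ok U t \<and> prog_ok U S c \<and> prog_ok U S d"
| "prog_ok U S (Loop t c) \<longleftrightarrow> test_ok U t \<and> prog_ok U S c"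

lemma test_ok_mono: "test_ok U t \<Longrightarrow> U \<subseteq> U' \<Longrightarrow> test_ok U' t"
  by (induction t) auto

lemma prog_ok_mono: "prog_ok U S c \<Longrightarrow> U \<subseteq> U' \<Longrightarrow> S \<le> S' \<Longrightarrow> prog_ok U' S' c"
proof (induction c)
  case (Act a)
  then show ?case by (cases a) auto
qed (auto intro: test_ok_mono)

lemma test_ok_ex: "\<exists>U. finite U \<and> test_ok U t"
proof (induction t)
  case (Cell i b)
  have "test_ok {i} (Cell i b)" by simp
  then show ?case by (metis finite.emptyI finite.insertI)
next
  case (Same i j)
  have "test_ok {i, j} (Same i j)" by simp
  then show ?case by (metis finite.emptyI finite.insertI)
next
  case (Both t t')
  then obtain U U' where "finite U" "test_ok U t" "finite U'" "test_ok U' t'" by auto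
  then have "finite (U \<union> U') \<and> test_ok (U \<union> U') (Both t t')"
    using test_ok_mono[of U t "U \<union> U'"] test_ok_mono[of U' t' "U \<union> U'"] by auto
  then show ?case by blast
qed auto

lemma prog_ok_ex: "\<exists>U S. finite U \<and> prog_ok U S c"
proof -
  have join: "\<exists>U S. finite U \<and> prog_ok U S c \<and> prog_ok U S d \<and> test_ok U t"
    if "finite U" "prog_ok U S c" "finite U'" "prog_ok U' S' d" for U S U' S' and c d :: "'a prog" and t
  proof -
    obtain U'' where "finite U''" "test_ok U'' t" using test_ok_ex by blast
    then show ?thesis
      using that prog_ok_mono[of U S c "U \<union> U' \<union> U''" "max S S'"]
        prog_ok_mono[of U' S' d "U \<union> U' \<union> U''" "max S S'"] test_ok_mono[of U'' t "U \<union> U' \<union> U''"]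
      by (intro exI[of _ "U \<union> U' \<union> U''"] exI[of _ "max S S'"]) auto
  qed
  show ?thesis
  proof (induction c)
    case (Act a)
    show ?case
    proof (cases a)
      case (Write i b)
      then show ?thesis by (intro exI[of _ "{i}"] exI[of _ "Suc b"]) auto
    next
      case (Shift i d)
      then show ?thesis by (intro exI[of _ "{i}"]) auto
    qed auto
  next
    case (Seq c d)
    then show ?case using join[of _ _ c _ _ d] by (metis prog_ok.simps(2))
  next
    case (Cond t c d)
    then show ?case using join[of _ _ c _ _ d t] by (metis prog_ok.simps(3))
  next
    case (Loop t c)
    then show ?case using join[of _ _ c _ _ c t] by (metis prog_ok.simps(4))
  qed
qed

lemma conts_ok: "prog_ok U S c \<Longrightarrow> list_all (prog_ok U S) k \<Longrightarrow> k' \<in> conts c k \<Longrightarrow> list_all (prog_ok U S) k'"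
proof (induction c arbitrary: k)
  case (Seq c d)
  then show ?case using Seq.IH(1)[of "d # k"] Seq.IH(2)[of k] by auto
next
  case (Cond t c d)
  then show ?case using Cond.IH(1)[of k] Cond.IH(2)[of k] by auto
next
  case (Loop t c)
  then show ?case using Loop.IH(1)[of "Loop t c # k"] by auto
qed auto

section \<open>The Turing machine simulating a program\<close>

fun test_syms :: "in_sym \<Rightarrow> ('i \<Rightarrow> nat) \<Rightarrow> 'i test \<Rightarrow> bool" where
  "test_syms a r (Cell i b) \<longleftrightarrow> r i = b"
| "test_syms a r (Same i j) \<longleftrightarrow> r i = r j"
| "test_syms a r (Sees b) \<longleftrightarrow> a = b"
| "test_syms a r (Neg t) \<longleftrightarrow> \<not> test_syms a r t"
| "test_syms a r (Both t t') \<longleftrightarrow> test_syms a r t \<and> test_syms a r t'"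

lemma passes_test_syms:
  "test_ok U t \<Longrightarrow> \<forall>i\<in>U. r i = scan (m i) \<Longrightarrow> passes xs t (p, m, o') = test_syms (read_input xs p) r t"
  by (induction t) auto

fun act_effect :: "'i list \<Rightarrow> nat list \<Rightarrow> 'i act \<Rightarrow> move \<times> (nat \<times> move) list \<times> io_sym option" where
  "act_effect ts ws (Write i b) = (Stay, map2 (\<lambda>j w. (if j = i then b else w, Stay)) ts ws, None)"
| "act_effect ts ws (Shift i d) = (Stay, map2 (\<lambda>j w. (w, if j = i then d else Stay)) ts ws, None)"
| "act_effect ts ws (Input d) = (d, map2 (\<lambda>j w. (w, Stay)) ts ws, None)"
| "act_effect ts ws (Output a) = (Stay, map2 (\<lambda>j w. (w, Stay)) ts ws, Some a)"

text \<open>The effect of \<open>pstep\<close> on the stack, computed only from what a transition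
  function can see: the input symbol and the scanned work symbols.\<close>

fun stack_step :: "in_sym \<Rightarrow> ('i \<Rightarrow> nat) \<Rightarrow> 'i prog list \<Rightarrow> 'i prog list" where
  "stack_step a r [] = []"
| "stack_step a r (Act b # k) = k"
| "stack_step a r (Seq c d # k) = c # d # k"
| "stack_step a r (Cond t c d # k) = (if test_syms a r t then c else d) # k"
| "stack_step a r (Loop t c # k) = (if test_syms a r t then c # Loop t c # k else k)"

text \<open>Control steps change only the stack; \<open>Input Stay\<close> rewrites all scanned
  symbols and moves nothing.\<close>

fun head_effect :: "'i list \<Rightarrow> nat list \<Rightarrow> 'i prog list \<Rightarrow> move \<times> (nat \<times> move) list \<times> io_sym option" where
  "head_effect ts ws (Act b # k) = act_effect ts ws b"
| "head_effect ts ws k = act_effect ts ws (Input Stay)"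

definition tm_of :: "'i list \<Rightarrow> nat \<Rightarrow> ('i prog list \<Rightarrow> nat) \<Rightarrow> (nat \<Rightarrow> 'i prog list) \<Rightarrow> nat \<Rightarrow> 'i prog \<Rightarrow> tm" where
  "tm_of ts S enc dec Q c = \<lparr>n_states = Q, n_syms = S, n_tapes = length ts,
     start_state = enc [c], halt_state = enc [],
     delta = (\<lambda>q a ws. (enc (stack_step a (\<lambda>i. the (map_of (zip ts ws) i)) (dec q)),
       head_effect ts ws (dec q)))\<rparr>"

definition cfg :: "'i list \<Rightarrow> ('i prog list \<Rightarrow> nat) \<Rightarrow> 'i prog list \<times> 'i mem \<Rightarrow> tm_config" where
  "cfg ts enc = (\<lambda>(k, p, m, o'). \<lparr>state = enc k, in_pos = p, works = map m ts, out_tape = o'\<rparr>)"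

lemma stack_step_conts:
  assumes "k \<in> conts c []"
  shows "stack_step a r k \<in> conts c []"
proof -
  have *: "stack_step a r k \<in> conts c0 k0" if "k \<in> conts c0 k0" "k \<noteq> k0" for c0 k0
    using that
  proof (induction c0 arbitrary: k0)
    case (Seq c d)
    then show ?case using conts_start[of c "d # k0"] conts_start[of d k0] by (cases "k = d # k0") auto
  next
    case (Cond t c d)
    then show ?case using conts_start[of c k0] conts_start[of d k0] by auto
  next
    case (Loop t c)
    then show ?case using conts_start[of c "Loop t c # k0"] by (cases "k = Loop t c # k0") auto
  qed auto
  show ?thesis using *[OF assms] conts_end[of "[]" c] by (cases "k = []") auto
qed

lemma act_effect_ok:
  assumes "act_ok U S b" "set ws \<subseteq> {..<S}" "length ws = length ts" "act_effect ts ws b = (d, acts, out)"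
  shows "length acts = length ts \<and> fst ` set acts \<subseteq> {..<S}"
proof -
  have "w < S" if "(x, w) \<in> set (zip ts ws)" for x w
    using set_zip_rightD[OF that] assms(2) by auto
  then show ?thesis using assms by (cases b) auto
qed

text \<open>\<open>enc\<close> and \<open>dec\<close> number the reachable stacks. Every number
  below \<open>Q\<close> must decode to such a stack, because \<open>wf_tm\<close> speaks about all
  states and not only the reachable ones.\<close>

locale compiled =
  fixes c :: "'i prog" and U :: "'i set" and S :: nat and ts :: "'i list"
    and enc :: "'i prog list \<Rightarrow> nat" and dec :: "nat \<Rightarrow> 'i prog list" and Q :: nat
  assumes ok: "prog_ok U S c" and S: "0 < S"
    and ts: "set ts = U" "distinct ts"
    and enc: "\<And>k. k \<in> conts c [] \<Longrightarrow> enc k < Q \<and> dec (enc k) = k"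
    and dec: "\<And>q. q < Q \<Longrightarrow> dec q \<in> conts c []"
begin

abbreviation "M \<equiv> tm_of ts S enc dec Q c"

lemma stack_ok: "k \<in> conts c [] \<Longrightarrow> list_all (prog_ok U S) k"
  using conts_ok[OF ok, of "[]"] by simp

lemma wf_tm_of: "wf_tm M"
proof -
  have "length acts = length ts \<and> fst ` set acts \<subseteq> {..<S}"
    if q: "q < Q" and ws: "length ws = length ts" "set ws \<subseteq> {..<S}"
      and e: "head_effect ts ws (dec q) = (d, acts, out)" for q ws d acts out
  proof -
    have l: "list_all (prog_ok U S) (dec q)" using stack_ok dec q by blast
    consider b k where "dec q = Act b # k" | "head_effect ts ws (dec q) = act_effect ts ws (Input Stay)"
      by (cases "(ts, ws, dec q)" rule: head_effect.cases) auto
    then show ?thesis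
    proof cases
      case 1
      then show ?thesis using act_effect_ok[of U S b ws ts d acts out] l ws e by simp
    next
      case 2
      then show ?thesis using act_effect_ok[of U S "Input Stay" ws ts d acts out] ws e by simp
    qed
  qed
  moreover have "enc (stack_step a r (dec q)) < Q" if "q < Q" for a r q
    using enc[OF stack_step_conts[OF dec[OF that]]] by simp
  ultimately show ?thesis
    using S enc[OF conts_start[of c "[]"]] enc[OF conts_end[of "[]" c]]
    by (auto simp: wf_tm_def tm_of_def split: prod.splits)
qed

lemma act_work_same [simp]: "act_work x (scan x, Stay) = x"
  by (cases x) auto

lemma map2_act_work:
  "map2 act_work (map m ts) (map2 g ts (map (\<lambda>i. scan (m i)) ts)) = map (\<lambda>i. act_work (m i) (g i (scan (m i)))) ts"
  by (induction ts) auto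

lemma step_cfg:
  assumes k: "k \<in> conts c []"
  shows "step M xs (cfg ts enc (k, s)) = cfg ts enc (pstep xs (k, s))"
proof -
  obtain p m o' where s: "s = (p, m, o')" by (cases s)
  let ?ws = "map (\<lambda>i. scan (m i)) ts"
  have ws: "(\<lambda>(t, h). t h) = scan" by (rule ext) auto
  define r where "r = (\<lambda>i. the (map_of (zip ts ?ws) i))"
  have r: "\<forall>i\<in>U. r i = scan (m i)"
    using ts by (auto simp: r_def map_of_zip_map)
  have l: "list_all (prog_ok U S) k" using stack_ok k by blast
  show ?thesis
  proof (cases k)
    case Nil
    then show ?thesis by (simp add: step_def cfg_def tm_of_def s)
  next
    case (Cons d k')
    \<comment> \<open>The encoding is injective on reachable stacks, so a machine with work left is
      not in its halting state.\<close>
    have enc_ne: "enc k \<noteq> enc []"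
      using enc[OF k] enc[OF conts_end[of "[]" c]] Cons by force
    have st: "stack_step (read_input xs p) r k = fst (pstep xs (k, s))"
      using l r Cons by (cases d) (auto simp: s passes_test_syms)
    have unf: "step M xs (cfg ts enc (k, s)) =
      (case head_effect ts ?ws k of (d, acts, out) \<Rightarrow>
        \<lparr>state = enc (stack_step (read_input xs p) r k), in_pos = move_input (length xs) d p,
          works = map2 act_work (map m ts) acts,
          out_tape = o' @ (case out of None \<Rightarrow> [] | Some a \<Rightarrow> [a])\<rparr>)"
      using enc_ne enc[OF k] by (simp add: step_def cfg_def tm_of_def s r_def ws comp_def split: prod.splits)
    have *: "map (\<lambda>i. act_work (m i) (g i (scan (m i)))) ts = map m' ts"
      if "\<And>i. act_work (m i) (g i (scan (m i))) = m' i" for g m'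
      using that by simp
    have e: "act_work (m i) (b, Stay) = ((fst (m i))(snd (m i) := b), snd (m i))"
      "act_work (m i) (scan (m i), d) = (fst (m i), move_work d (snd (m i)))"
      "((fst (m i))(snd (m i) := scan (m i)), snd (m i)) = m i" for i b d
      by (cases "m i"; simp)+
    show ?thesis
    proof (cases d)
      case (Act b)
      then show ?thesis unfolding unf using st Cons
        by (cases b) (auto simp: s cfg_def map2_act_work e)
    next
      case (Seq b b')
      then show ?thesis unfolding unf using st Cons by (simp add: s cfg_def map2_act_work)
    next
      case (Cond t b b')
      then show ?thesis unfolding unf using st Cons by (auto simp: s cfg_def map2_act_work)
    next
      case (Loop t b)
      then show ?thesis unfolding unf using st Cons by (auto simp: s cfg_def map2_act_work)
    qed
  qed
qed

lemma pstep_conts: "k \<in> conts c [] \<Longrightarrow> fst ((pstep xs ^^ t) (k, s)) \<in> conts c []"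
proof (induction t)
  case (Suc t)
  obtain k' s' where e: "(pstep xs ^^ t) (k, s) = (k', s')" by (cases "(pstep xs ^^ t) (k, s)") auto
  then have "k' \<in> conts c []" using Suc by simp
  then have "fst (pstep xs (k', s')) \<in> conts c []"
    using conts_closed[of k' c "[]" xs s'] conts_end[of "[]" c] by auto
  then show ?case using e by simp
qed simp

lemma run_cfg: "run M xs t = cfg ts enc ((pstep xs ^^ t) ([c], init_mem))"
proof (induction t)
  case 0
  show ?case by (simp add: run_def init_config_def cfg_def tm_of_def init_mem_def map_replicate_const)
next
  case (Suc t)
  have "fst ((pstep xs ^^ t) ([c], init_mem)) \<in> conts c []"
    by (rule pstep_conts[OF conts_start])
  then have "step M xs (cfg ts enc ((pstep xs ^^ t) ([c], init_mem))) =
      cfg ts enc (pstep xs ((pstep xs ^^ t) ([c], init_mem)))"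
    using step_cfg by (metis prod.collapse)
  then show ?case using Suc by (simp add: run_def)
qed

text \<open>\<open>B + 2\<close> counts the cells from -1 to \<open>B\<close> that the head of each
  tape may visit.\<close>

lemma halts_in_space:
  assumes t: "(pstep xs ^^ t) ([c], init_mem) = ([], p, m, o')"
    and w: "\<And>t'. t' \<le> t \<Longrightarrow> bounded_heads B (snd ((pstep xs ^^ t') ([c], init_mem)))"
  shows "halts_with M xs o'" "space_used M xs \<le> length ts * (B + 2)"
proof -
  have M: "halt_state M = enc []" "n_tapes M = length ts" by (simp_all add: tm_of_def)
  show "halts_with M xs o'"
    unfolding halts_with_def by (rule exI[of _ t]) (simp add: run_cfg t cfg_def M)
  \<comment> \<open>\<open>visited_cells\<close> ranges over all times, so the bound must also cover
    the time after halting, when nothing changes any more.\<close>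
  have stay: "(pstep xs ^^ (t + n)) ([c], init_mem) = ([], p, m, o')" for n
    by (induction n) (auto simp: t)
  have w': "bounded_heads B (snd ((pstep xs ^^ t') ([c], init_mem)))" for t'
    using w[of t'] w[of t] stay[of "t' - t"] t by (cases "t' \<le> t") auto
  have "visited_cells M xs \<subseteq> {..<length ts} \<times> {- 1..int B}"
  proof
    fix x assume "x \<in> visited_cells M xs"
    then obtain i t' where x: "x = (i, snd (works (run M xs t') ! i))" "i < length ts"
      by (auto simp: visited_cells_def M)
    obtain k p' m' o'' where e: "(pstep xs ^^ t') ([c], init_mem) = (k, p', m', o'')"
      by (metis prod_cases4)
    then have "x = (i, snd (m' (ts ! i)))" using x by (simp add: run_cfg cfg_def)
    then show "x \<in> {..<length ts} \<times> {- 1..int B}" using w'[of t'] e x(2) by simp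
  qed
  then have "space_used M xs \<le> card ({..<length ts} \<times> {- 1..int B})"
    unfolding space_used_def by (intro card_mono) auto
  then show "space_used M xs \<le> length ts * (B + 2)" by (simp add: card_cartesian_product nat_add_distrib)
qed

end

subsection \<open>A space-bounded Hoare logic\<close>

text \<open>Quantifying over the remaining stack \<open>k\<close> lets executions be chained by
  transitivity. Every memory reached satisfies the head bound; the initial one is constrained
  separately in \<open>hoare\<close>.\<close>

definition exec :: "io_sym list \<Rightarrow> nat \<Rightarrow> 'i prog \<Rightarrow> 'i mem \<Rightarrow> 'i mem \<Rightarrow> bool" where
  "exec xs B c s s' \<longleftrightarrow>
    (\<forall>k. (\<lambda>a b. b = pstep xs a \<and> bounded_heads B (snd b))\<^sup>*\<^sup>* (c # k, s) (k, s'))"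

definition hoare :: "io_sym list \<Rightarrow> nat \<Rightarrow> ('i mem \<Rightarrow> bool) \<Rightarrow> 'i prog \<Rightarrow> ('i mem \<Rightarrow> bool) \<Rightarrow> bool" where
  "hoare xs B P c Q \<longleftrightarrow>
    (\<forall>s. P s \<and> bounded_heads B s \<longrightarrow> (\<exists>s'. Q s' \<and> bounded_heads B s' \<and> exec xs B c s s'))"

text \<open>The machine and \<open>K\<close>, the number of its tapes, are fixed before the input
  and the bound \<open>B\<close>, so one machine inherits every triple proved for the
  program.\<close>

theorem compile_prog:
  fixes c :: "'i prog"
  shows "\<exists>M K. wf_tm M \<and> (\<forall>xs B Q. hoare xs B (\<lambda>s. s = init_mem) c Q \<longrightarrow>
    (\<exists>p m o'. Q (p, m, o') \<and> halts_with M xs o' \<and> space_used M xs \<le> K * (B + 2)))"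
proof -
  obtain U S where US: "finite U" "prog_ok U S c" using prog_ok_ex by blast
  \<comment> \<open>The increase guarantees at least one work symbol, the blank, as
    \<open>wf_tm\<close> demands.\<close>
  then have ok: "prog_ok U (Suc S) c" using prog_ok_mono[of U S c U "Suc S"] by simp
  obtain ts where ts: "set ts = U" "distinct ts" using finite_distinct_list[OF US(1)] by blast
  obtain dec where dec: "bij_betw dec {..<card (conts c [])} (conts c [])"
    using ex_bij_betw_nat_finite[OF finite_conts[of c "[]"]] by (auto simp: atLeast0LessThan)
  define enc where "enc = inv_into {..<card (conts c [])} dec"
  interpret compiled c U "Suc S" ts enc dec "card (conts c [])"
  proof
    fix k assume k: "k \<in> conts c []"
    then show "enc k < card (conts c []) \<and> dec (enc k) = k"
      using dec unfolding enc_def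
      by (metis bij_betw_def f_inv_into_f inv_into_into lessThan_iff)
  qed (use ok ts dec in \<open>auto simp: bij_betw_def\<close>)
  show ?thesis
  proof (rule exI[of _ M], rule exI[of _ "length ts"], intro conjI allI impI)
    show "wf_tm M" by (rule wf_tm_of)
    fix xs B Q assume "hoare xs B (\<lambda>s. s = init_mem) c Q"
    moreover have w0: "bounded_heads B init_mem" by (simp add: init_mem_def)
    ultimately obtain s' where s': "Q s'" "exec xs B c init_mem s'" unfolding hoare_def by blast
    obtain p m o' where s'_eq: "s' = (p, m, o')" by (cases s')
    have Q: "Q (p, m, o')" and ex: "exec xs B c init_mem (p, m, o')" using s' s'_eq by simp_all
    have "\<exists>t. (pstep xs ^^ t) a = b \<and> (\<forall>t'\<le>t. bounded_heads B (snd ((pstep xs ^^ t') a)))"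
      if "(\<lambda>a b. b = pstep xs a \<and> bounded_heads B (snd b))\<^sup>*\<^sup>* a b" "bounded_heads B (snd a)" for a b :: "'i prog list \<times> 'i mem"
      using that
    proof (induction rule: rtranclp_induct)
      case base
      then show ?case by (intro exI[of _ 0]) simp
    next
      case (step y z)
      then obtain t where t: "(pstep xs ^^ t) a = y" "\<forall>t'\<le>t. bounded_heads B (snd ((pstep xs ^^ t') a))" by auto
      then show ?case using step(2) by (intro exI[of _ "Suc t"]) (auto simp: le_Suc_eq)
    qed
    from this[OF ex[unfolded exec_def, rule_format, of "[]"]] w0
    obtain t where t: "(pstep xs ^^ t) ([c], init_mem) = ([], p, m, o')"
      and w: "\<forall>t'\<le>t. bounded_heads B (snd ((pstep xs ^^ t') ([c], init_mem)))"
      by auto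
    then show "\<exists>p m o'. Q (p, m, o') \<and> halts_with M xs o' \<and> space_used M xs \<le> length ts * (B + 2)"
      using halts_in_space[OF t w[rule_format]] Q by blast
  qed
qed

lemma hoare_Act:
  assumes "\<And>s. P s \<Longrightarrow> bounded_heads B s \<Longrightarrow> Q (do_act (length xs) a s) \<and> bounded_heads B (do_act (length xs) a s)"
  shows "hoare xs B P (Act a) Q"
  unfolding hoare_def exec_def
proof (intro allI impI)
  fix s assume s: "P s \<and> bounded_heads B s"
  have "(\<lambda>a b. b = pstep xs a \<and> bounded_heads B (snd b))\<^sup>*\<^sup>* (Act a # k, s) (k, do_act (length xs) a s)" for k
    using assms s by (intro r_into_rtranclp) auto
  then show "\<exists>s'. Q s' \<and> bounded_heads B s' \<and>
      (\<forall>k. (\<lambda>a b. b = pstep xs a \<and> bounded_heads B (snd b))\<^sup>*\<^sup>* (Act a # k, s) (k, s'))"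
    using assms s by blast
qed

lemma exec_Seq: "exec xs B c s s' \<Longrightarrow> exec xs B d s' s'' \<Longrightarrow> bounded_heads B s \<Longrightarrow> exec xs B (c ;; d) s s''"
  unfolding exec_def
proof
  fix k let ?R = "\<lambda>a b. b = pstep xs a \<and> bounded_heads B (snd b)"
  assume a: "\<forall>k. ?R\<^sup>*\<^sup>* (c # k, s) (k, s')" "\<forall>k. ?R\<^sup>*\<^sup>* (d # k, s') (k, s'')" "bounded_heads B s"
  have "?R ((c ;; d) # k, s) (c # d # k, s)" using a(3) by simp
  moreover have "?R\<^sup>*\<^sup>* (c # d # k, s) (k, s'')" using a rtranclp_trans[of ?R] by blast
  ultimately show "?R\<^sup>*\<^sup>* ((c ;; d) # k, s) (k, s'')" by (rule converse_rtranclp_into_rtranclp)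
qed

lemma exec_Cond:
  assumes "exec xs B (if passes xs t s then c else d) s s'" "bounded_heads B s"
  shows "exec xs B (Cond t c d) s s'"
  unfolding exec_def
proof
  fix k let ?R = "\<lambda>a b. b = pstep xs a \<and> bounded_heads B (snd b)"
  have "?R (Cond t c d # k, s) ((if passes xs t s then c else d) # k, s)" using assms by simp
  moreover have "?R\<^sup>*\<^sup>* ((if passes xs t s then c else d) # k, s) (k, s')"
    using assms unfolding exec_def by blast
  ultimately show "?R\<^sup>*\<^sup>* (Cond t c d # k, s) (k, s')" by (rule converse_rtranclp_into_rtranclp)
qed

lemma exec_Loop_end:
  assumes "\<not> passes xs t s" "bounded_heads B s"
  shows "exec xs B (Loop t c) s s"
  using assms unfolding exec_def by (auto intro!: r_into_rtranclp)

lemma exec_Loop_step: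
  assumes "passes xs t s" "bounded_heads B s" "exec xs B c s s'" "exec xs B (Loop t c) s' s''"
  shows "exec xs B (Loop t c) s s''"
  unfolding exec_def
proof
  fix k let ?R = "\<lambda>a b. b = pstep xs a \<and> bounded_heads B (snd b)"
  have "?R (Loop t c # k, s) (c # Loop t c # k, s)" using assms by simp
  moreover have "?R\<^sup>*\<^sup>* (c # Loop t c # k, s) (k, s'')"
    using assms(3,4) rtranclp_trans[of ?R] unfolding exec_def by blast
  ultimately show "?R\<^sup>*\<^sup>* (Loop t c # k, s) (k, s'')" by (rule converse_rtranclp_into_rtranclp)
qed

lemma hoareE:
  assumes "hoare xs B P c Q" "P s" "bounded_heads B s"
  obtains s' where "Q s'" "bounded_heads B s'" "exec xs B c s s'"
  using assms unfolding hoare_def by blast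

lemma hoareI:
  assumes "\<And>s. P s \<Longrightarrow> bounded_heads B s \<Longrightarrow> \<exists>s'. Q s' \<and> bounded_heads B s' \<and> exec xs B c s s'"
  shows "hoare xs B P c Q"
  using assms unfolding hoare_def by blast

lemma hoare_Seq: "hoare xs B P c Q \<Longrightarrow> hoare xs B Q d R \<Longrightarrow> hoare xs B P (c ;; d) R"
  by (rule hoareI) (meson hoareE exec_Seq)

lemma hoare_Cond:
  assumes "hoare xs B (\<lambda>s. P s \<and> passes xs t s) c Q" "hoare xs B (\<lambda>s. P s \<and> \<not> passes xs t s) d Q"
  shows "hoare xs B P (Cond t c d) Q"
proof (rule hoareI)
  fix s assume s: "P s" "bounded_heads B s"
  show "\<exists>s'. Q s' \<and> bounded_heads B s' \<and> exec xs B (Cond t c d) s s'"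
  proof (cases "passes xs t s")
    case True
    then obtain s' where "Q s'" "bounded_heads B s'" "exec xs B c s s'"
      using hoareE[OF assms(1), of s] s by blast
    moreover from this have "exec xs B (Cond t c d) s s'"
      using exec_Cond[of xs B t s c d s'] True s by simp
    ultimately show ?thesis by blast
  next
    case False
    then obtain s' where "Q s'" "bounded_heads B s'" "exec xs B d s s'"
      using hoareE[OF assms(2), of s] s by blast
    moreover from this have "exec xs B (Cond t c d) s s'"
      using exec_Cond[of xs B t s c d s'] False s by simp
    ultimately show ?thesis by blast
  qed
qed

text \<open>The number \<open>n\<close> of rounds is known for every loop in use, so the indexed
  assertion \<open>P\<close> serves as invariant and variant at once. The induction is on the number
  of rounds still to come.\<close>

lemma hoare_Loop:
  assumes body: "\<And>i. i < n \<Longrightarrow> hoare xs B (P i) c (P (Suc i))"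
    and go: "\<And>i s. i < n \<Longrightarrow> P i s \<Longrightarrow> passes xs t s"
    and stop: "\<And>s. P n s \<Longrightarrow> \<not> passes xs t s"
  shows "hoare xs B (P 0) (Loop t c) (P n)"
proof -
  have "hoare xs B (P (n - j)) (Loop t c) (P n)" if "j \<le> n" for j
    using that
  proof (induction j)
    case 0
    show ?case
    proof (rule hoareI)
      fix s assume "P (n - 0) s" "bounded_heads B s"
      then show "\<exists>s'. P n s' \<and> bounded_heads B s' \<and> exec xs B (Loop t c) s s'"
        using exec_Loop_end[OF stop[of s]] unfolding diff_zero by blast
    qed
  next
    case (Suc j)
    then have lt: "n - Suc j < n" and eq: "Suc (n - Suc j) = n - j" by auto
    have step: "hoare xs B (P (n - Suc j)) c (P (n - j))" using body[OF lt] eq by simp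
    show ?case
    proof (rule hoareI)
      fix s assume s: "P (n - Suc j) s" "bounded_heads B s"
      then obtain s' where s': "P (n - j) s'" "bounded_heads B s'" "exec xs B c s s'"
        using hoareE[OF step] by blast
      moreover have "hoare xs B (P (n - j)) (Loop t c) (P n)" using Suc by simp
      ultimately obtain s'' where "P n s''" "bounded_heads B s''" "exec xs B (Loop t c) s' s''"
        using hoareE by blast
      then show "\<exists>s'. P n s' \<and> bounded_heads B s' \<and> exec xs B (Loop t c) s s'"
        using exec_Loop_step[OF go[OF lt s(1)] s(2) s'(3)] by blast
    qed
  qed
  from this[of n] show ?thesis by simp
qed

lemma hoare_conseq:
  assumes "hoare xs B P' c Q'" "\<And>s. P s \<Longrightarrow> P' s" "\<And>s. Q' s \<Longrightarrow> Q s"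
  shows "hoare xs B P c Q"
  using assms unfolding hoare_def by blast

text \<open>Reduces a triple to single initial states, so that tape operations can be executed
  symbolically on a concrete memory.\<close>

lemma hoare_pre:
  assumes "\<And>s. P s \<Longrightarrow> bounded_heads B s \<Longrightarrow> hoare xs B (\<lambda>s'. s' = s) c Q"
  shows "hoare xs B P c Q"
  using assms unfolding hoare_def by blast

subsection \<open>Binary counters\<close>

fun inc :: "bool list \<Rightarrow> bool list" where
  "inc [] = [True]"
| "inc (False # bs) = True # bs"
| "inc (True # bs) = False # inc bs"

fun val :: "bool list \<Rightarrow> nat" where
  "val [] = 0"
| "val (b # bs) = of_bool b + 2 * val bs"

text \<open>Least significant bit first. Building the list by increments yields what the machine
  holds after counting and avoids leading zeros, so comparing tapes compares numbers.\<close>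

definition bits :: "nat \<Rightarrow> bool list" where
  "bits n = (inc ^^ n) []"

lemma bits_0 [simp]: "bits 0 = []" and bits_Suc: "bits (Suc n) = inc (bits n)"
  by (simp_all add: bits_def)

lemma val_inc: "val (inc bs) = Suc (val bs)"
  by (induction bs rule: inc.induct) auto

lemma val_bits [simp]: "val (bits n) = n"
  by (induction n) (auto simp: bits_Suc val_inc)

lemma bits_inject: "bits m = bits n \<longleftrightarrow> m = n"
  by (metis val_bits)

lemma length_inc: "length bs \<le> length (inc bs)"
  by (induction bs rule: inc.induct) auto

lemma length_bits_mono: "m \<le> n \<Longrightarrow> length (bits m) \<le> length (bits n)"
  by (induction n rule: dec_induct) (auto simp: bits_Suc intro: order_trans length_inc)

lemma inc_canonical: "bs = [] \<or> last bs \<Longrightarrow> inc bs \<noteq> [] \<and> last (inc bs)"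
  by (induction bs rule: inc.induct) (auto split: if_splits)

text \<open>The most significant bit alone contributes half of the left-hand side; doubling the
  value avoids a subtraction in the exponent.\<close>

lemma canonical_val: "bs \<noteq> [] \<Longrightarrow> last bs \<Longrightarrow> 2 ^ length bs \<le> 2 * val bs"
  by (induction bs) (auto split: if_splits)

lemma length_bits: "real (length (bits n)) \<le> 1 + log 2 (real n)"
proof (cases "n = 0")
  case False
  have "bits n = [] \<or> last (bits n)"
    by (induction n) (use inc_canonical in \<open>auto simp: bits_Suc\<close>)
  moreover have "bits n \<noteq> []" using False by (metis val.simps(1) val_bits)
  ultimately have "2 ^ length (bits n) \<le> 2 * n" using canonical_val[of "bits n"] by simp
  then have "real (2 ^ length (bits n)) \<le> real (2 * n)" by (rule of_nat_mono)
  then have "log 2 (2 ^ length (bits n)) \<le> log 2 (2 * real n)"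
    using False by (subst log_le_cancel_iff) auto
  then show ?thesis using False by (simp add: log_mult log_nat_power)
qed (simp add: log_def)

text \<open>The form the tape program follows: clear the initial run of ones, then set the next bit.
  If there are only ones, that bit is new and the list grows.\<close>

lemma inc_eq: "inc bs = (let t = length (takeWhile id bs) in replicate t False @ True # drop (Suc t) bs)"
  by (induction bs rule: inc.induct) (auto simp: Let_def)

subsection \<open>Tapes holding bit lists\<close>

text \<open>Symbol \<open>0\<close> is the blank, \<open>1\<close> and \<open>2\<close> are the bits.  Cell \<open>-1\<close> stays blank, so that a head can
  find its way back to cell \<open>0\<close>.\<close>

definition tape_of :: "bool list \<Rightarrow> int \<Rightarrow> work_tape" where
  "tape_of bs h = (\<lambda>j. if 0 \<le> j \<and> j < int (length bs) then (if bs ! nat j then 2 else 1) else 0, h)"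

abbreviation "num n \<equiv> tape_of (bits n) 0"

text \<open>False is the blank tape rather than the bit for zero, so an untouched tape is already a
  legal flag.\<close>

definition flag :: "bool \<Rightarrow> work_tape" where
  "flag b = tape_of (if b then [True] else []) 0"

lemma snd_tape_of [simp]: "snd (tape_of bs h) = h"
  by (simp add: tape_of_def)

lemma tape_of_move [simp]: "(fst (tape_of bs h), h') = tape_of bs h'"
  by (simp add: tape_of_def)

lemma scan_tape_of [simp]:
  "scan (tape_of bs (int k)) = (if k < length bs then (if bs ! k then 2 else 1) else 0)"
  "scan (tape_of bs (- 1)) = 0"
  by (simp_all add: tape_of_def)

lemma scan_tape_of_0 [simp]:
  "scan (tape_of bs 0) = (if bs = [] then 0 else if hd bs then 2 else 1)"
  using scan_tape_of(1)[of bs 0] by (simp add: hd_conv_nth)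

lemma tape_of_write:
  assumes "k \<le> length bs"
  shows "((fst (tape_of bs (int k)))(int k := (if b then 2 else 1)), int k) =
    tape_of (if k < length bs then bs[k := b] else bs @ [b]) (int k)"
  using assms by (auto simp: tape_of_def fun_eq_iff nth_append nth_list_update nat_eq_iff)

lemma tape_of_erase:
  "((fst (tape_of (bs @ [b]) (int (length bs))))(int (length bs) := 0), h) = tape_of bs h"
  by (auto simp: tape_of_def fun_eq_iff nth_append)

lemma scan_flag [simp]: "scan (flag b) = (if b then 2 else 0)"
  by (simp add: flag_def)

lemma snd_flag [simp]: "snd (flag b) = 0"
  by (simp add: flag_def)

lemma flag_write:
  "((fst (flag b))(0 := 2), 0) = flag True" "((fst (flag b))(0 := 0), 0) = flag False"
  by (auto simp: flag_def tape_of_def fun_eq_iff)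

lemma blank_tape: "(\<lambda>_. 0, 0) = tape_of [] 0" "(\<lambda>_. 0, 0) = flag False"
  by (auto simp: flag_def tape_of_def)

subsection \<open>Tape operations\<close>

lemma hoare_Act_eq:
  assumes "do_act (length xs) a (p, m, o') = (p', m', o'')"
    and "\<And>j. - 1 \<le> snd (m j) \<Longrightarrow> snd (m j) \<le> int B \<Longrightarrow> - 1 \<le> snd (m' j) \<and> snd (m' j) \<le> int B"
  shows "hoare xs B (\<lambda>\<sigma>. \<sigma> = (p, m, o')) (Act a) (\<lambda>\<sigma>. \<sigma> = (p', m', o''))"
  using assms by (intro hoare_Act) auto

lemma hoare_Cond_eq:
  assumes "hoare xs B (\<lambda>\<sigma>. \<sigma> = s) (if passes xs t s then c else d) Q"
  shows "hoare xs B (\<lambda>\<sigma>. \<sigma> = s) (Cond t c d) Q"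
proof (rule hoareI)
  fix s0 assume s: "s0 = s" "bounded_heads B s0"
  then obtain s' where "Q s'" "bounded_heads B s'" "exec xs B (if passes xs t s0 then c else d) s0 s'"
    using hoareE[OF assms, of s] by blast
  then show "\<exists>s'. Q s' \<and> bounded_heads B s' \<and> exec xs B (Cond t c d) s0 s'"
    using exec_Cond s(2) by blast
qed

text \<open>The first step left is needed because the head may stand on the blank behind the last
  bit; the loop then runs to the blank in cell -1.\<close>

definition rewind :: "'i \<Rightarrow> 'i prog" where
  "rewind i = Act (Shift i MoveLeft) ;; Loop (Neg (Cell i 0)) (Act (Shift i MoveLeft)) ;;
    Act (Shift i MoveRight)"

lemma hoare_rewind:
  assumes "m i = tape_of bs (int h)" "h \<le> length bs" "length bs \<le> B"
  shows "hoare xs B (\<lambda>\<sigma>. \<sigma> = (p, m, o')) (rewind i) (\<lambda>\<sigma>. \<sigma> = (p, m(i := tape_of bs 0), o'))"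
proof -
  let ?P = "\<lambda>j \<sigma>. \<sigma> = (p, m(i := tape_of bs (int h - 1 - int j)), o')"
  have 1: "hoare xs B (\<lambda>\<sigma>. \<sigma> = (p, m, o')) (Act (Shift i MoveLeft)) (?P 0)"
    using assms by (intro hoare_Act_eq) (auto split: if_splits)
  have pos: "int h - 1 - int j = int (h - Suc j)" if "j < h" for j using that by simp
  have 2: "hoare xs B (?P 0) (Loop (Neg (Cell i 0)) (Act (Shift i MoveLeft))) (?P h)"
  proof (rule hoare_Loop)
    show "hoare xs B (?P j) (Act (Shift i MoveLeft)) (?P (Suc j))" if "j < h" for j
      using that assms by (intro hoare_Act_eq) (auto simp: algebra_simps split: if_splits)
    show "passes xs (Neg (Cell i 0)) s" if "j < h" "?P j s" for j s
    proof -
      have "scan (tape_of bs (int h - 1 - int j)) \<noteq> 0"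
        unfolding pos[OF that(1)] using that(1) assms(2) by (subst scan_tape_of) auto
      then show ?thesis using that(2) by simp
    qed
  qed simp
  have 3: "hoare xs B (?P h) (Act (Shift i MoveRight)) (\<lambda>\<sigma>. \<sigma> = (p, m(i := tape_of bs 0), o'))"
    using assms by (intro hoare_Act_eq) (auto split: if_splits)
  show ?thesis unfolding rewind_def using 1 2 3 by (intro hoare_Seq)
qed

definition carry :: "'i \<Rightarrow> 'i prog" where
  "carry i = Loop (Cell i 2) (Act (Write i 1) ;; Act (Shift i MoveRight))"

lemma hoare_carry:
  assumes "m i = tape_of bs 0" "length bs \<le> B" and t: "t = length (takeWhile id bs)"
  shows "hoare xs B (\<lambda>\<sigma>. \<sigma> = (p, m, o')) (carry i)
    (\<lambda>\<sigma>. \<sigma> = (p, m(i := tape_of (replicate t False @ drop t bs) (int t)), o'))"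
proof -
  let ?b = "\<lambda>j. replicate j False @ drop j bs"
  let ?P = "\<lambda>j \<sigma>. \<sigma> = (p, m(i := tape_of (?b j) (int j)), o')"
  have tl: "t \<le> length bs" unfolding t by (rule length_takeWhile_le)
  have tT: "bs ! j" if "j < t" for j
    using that nth_mem[of j "takeWhile id bs"] set_takeWhileD[of "bs ! j" id bs]
    by (auto simp: t takeWhile_nth)
  have "hoare xs B (?P 0) (carry i) (?P t)"
    unfolding carry_def
  proof (rule hoare_Loop)
    fix j assume j: "j < t"
    have "(?b j)[j := False] = ?b (Suc j)"
      using j tl by (simp add: list_update_append replicate_append_same[symmetric]
          Cons_nth_drop_Suc[symmetric])
    then have w: "((fst (tape_of (?b j) (int j)))(int j := 1), int j) =
        tape_of (?b (Suc j)) (int j)"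
      using tape_of_write[of j "?b j" False] j tl by simp
    show "hoare xs B (?P j) (Act (Write i 1) ;; Act (Shift i MoveRight)) (?P (Suc j))"
    proof (rule hoare_Seq)
      show "hoare xs B (?P j) (Act (Write i 1))
          (\<lambda>\<sigma>. \<sigma> = (p, m(i := tape_of (?b (Suc j)) (int j)), o'))"
        using w by (intro hoare_Act_eq) (auto split: if_splits)
      show "hoare xs B (\<lambda>\<sigma>. \<sigma> = (p, m(i := tape_of (?b (Suc j)) (int j)), o'))
          (Act (Shift i MoveRight)) (?P (Suc j))"
        using j tl assms by (intro hoare_Act_eq) (auto simp: add.commute split: if_splits)
    qed
  next
    show "passes xs (Cell i 2) s" if "j < t" "?P j s" for j s
      using that tT[OF that(1)] tl by (simp add: nth_append)
    show "\<not> passes xs (Cell i 2) s" if "?P t s" for s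
      using that nth_length_takeWhile[of id bs] tl by (auto simp: nth_append t)
  qed
  moreover have "(p, m, o') = (p, m(i := tape_of (replicate 0 False @ drop 0 bs) (int 0)), o')"
    using assms(1) by (simp add: fun_eq_iff)
  ultimately show ?thesis by simp
qed

definition increment :: "'i \<Rightarrow> 'i prog" where
  "increment i = carry i ;; Act (Write i 2) ;; rewind i"

lemma write_True:
  assumes t: "t = length (takeWhile id bs)"
  shows "((fst (tape_of (replicate t False @ drop t bs) (int t)))(int t := 2), int t) = tape_of (inc bs) (int t)"
proof -
  have tl: "t \<le> length bs" unfolding t by (rule length_takeWhile_le)
  have "(if t < length (replicate t False @ drop t bs) then (replicate t False @ drop t bs)[t := True]
      else (replicate t False @ drop t bs) @ [True]) = inc bs"
    using tl by (auto simp: inc_eq Let_def t[symmetric] list_update_append Cons_nth_drop_Suc[symmetric])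
  then show ?thesis
    using tape_of_write[of t "replicate t False @ drop t bs" True] tl by simp
qed

lemma hoare_increment:
  assumes "m i = tape_of bs 0" "length (inc bs) \<le> B"
  shows "hoare xs B (\<lambda>\<sigma>. \<sigma> = (p, m, o')) (increment i) (\<lambda>\<sigma>. \<sigma> = (p, m(i := tape_of (inc bs) 0), o'))"
proof -
  define t where t: "t = length (takeWhile id bs)"
  have tl: "t \<le> length bs" unfolding t by (rule length_takeWhile_le)
  have l: "length bs \<le> B" using assms length_inc[of bs] by simp
  note 1 = hoare_carry[of m i bs B t xs p o', OF assms(1) l t]
  have 2: "hoare xs B (\<lambda>\<sigma>. \<sigma> = (p, m(i := tape_of (replicate t False @ drop t bs) (int t)), o'))
      (Act (Write i 2)) (\<lambda>\<sigma>. \<sigma> = (p, m(i := tape_of (inc bs) (int t)), o'))"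
    using write_True[OF t] by (intro hoare_Act_eq) (auto split: if_splits)
  have 3: "hoare xs B (\<lambda>\<sigma>. \<sigma> = (p, m(i := tape_of (inc bs) (int t)), o')) (rewind i)
      (\<lambda>\<sigma>. \<sigma> = (p, m(i := tape_of (inc bs) 0), o'))"
    using hoare_rewind[of "m(i := tape_of (inc bs) (int t))" i "inc bs" t B xs p o'] assms tl length_inc[of bs]
    by simp
  show ?thesis unfolding increment_def using 1 2 3 by (intro hoare_Seq)
qed

text \<open>Counts at fixed width: if the carry runs off the end, the list is left at zero and
  \<open>f\<close> is raised instead of appending a bit. Thus the mask never outgrows its initial
  length.\<close>

definition next_mask :: "'i \<Rightarrow> 'i \<Rightarrow> 'i prog" where
  "next_mask i f = carry i ;; Cond (Cell i 0) (Act (Write f 2)) (Act (Write i 2)) ;; rewind i"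

lemma hoare_next_mask:
  assumes "m i = tape_of bs 0" "length bs \<le> B" "m f = flag False" "i \<noteq> f"
  shows "hoare xs B (\<lambda>\<sigma>. \<sigma> = (p, m, o')) (next_mask i f)
    (\<lambda>\<sigma>. \<sigma> = (p, if \<forall>b\<in>set bs. b then m(i := tape_of (replicate (length bs) False) 0, f := flag True)
      else m(i := tape_of (inc bs) 0), o'))"
proof -
  define t where t: "t = length (takeWhile id bs)"
  have tl: "t \<le> length bs" unfolding t by (rule length_takeWhile_le)
  have all: "(\<forall>b\<in>set bs. b) \<longleftrightarrow> t = length bs"
  proof -
    have "(\<forall>b\<in>set cs. b) \<longleftrightarrow> length (takeWhile id cs) = length cs" for cs
      by (induction cs) auto
    then show ?thesis by (simp add: t)
  qed
  let ?m = "m(i := tape_of (replicate t False @ drop t bs) (int t))"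
  note 1 = hoare_carry[of m i bs B t xs p o', OF assms(1,2) t]
  show ?thesis
  proof (cases "t = length bs")
    case True
    let ?m' = "m(i := tape_of (replicate (length bs) False) (int (length bs)), f := flag True)"
    have 2: "hoare xs B (\<lambda>\<sigma>. \<sigma> = (p, ?m, o')) (Cond (Cell i 0) (Act (Write f 2)) (Act (Write i 2)))
       (\<lambda>\<sigma>. \<sigma> = (p, ?m', o'))"
    proof (rule hoare_Cond_eq)
      have "hoare xs B (\<lambda>\<sigma>. \<sigma> = (p, ?m, o')) (Act (Write f 2)) (\<lambda>\<sigma>. \<sigma> = (p, ?m', o'))"
        using True assms flag_write[of False] by (intro hoare_Act_eq) (auto split: if_splits)
      then show "hoare xs B (\<lambda>\<sigma>. \<sigma> = (p, ?m, o'))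
          (if passes xs (Cell i 0) (p, ?m, o') then Act (Write f 2) else Act (Write i 2)) (\<lambda>\<sigma>. \<sigma> = (p, ?m', o'))"
        using True by simp
    qed
    have 3: "hoare xs B (\<lambda>\<sigma>. \<sigma> = (p, ?m', o')) (rewind i)
       (\<lambda>\<sigma>. \<sigma> = (p, ?m'(i := tape_of (replicate (length bs) False) 0), o'))"
      using assms by (intro hoare_rewind) auto
    have e: "?m'(i := tape_of (replicate (length bs) False) 0) =
        m(i := tape_of (replicate (length bs) False) 0, f := flag True)"
      using assms(4) by (auto simp: fun_eq_iff)
    have "hoare xs B (\<lambda>\<sigma>. \<sigma> = (p, m, o')) (next_mask i f)
       (\<lambda>\<sigma>. \<sigma> = (p, m(i := tape_of (replicate (length bs) False) 0, f := flag True), o'))"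
      unfolding next_mask_def using 1 2 3[unfolded e] by (intro hoare_Seq)
    then show ?thesis unfolding all using True by simp
  next
    case False
    let ?m' = "m(i := tape_of (inc bs) (int t))"
    have li: "length (inc bs) = length bs" using False tl by (simp add: inc_eq Let_def t[symmetric])
    have 2: "hoare xs B (\<lambda>\<sigma>. \<sigma> = (p, ?m, o')) (Cond (Cell i 0) (Act (Write f 2)) (Act (Write i 2)))
       (\<lambda>\<sigma>. \<sigma> = (p, ?m', o'))"
    proof (rule hoare_Cond_eq)
      have "hoare xs B (\<lambda>\<sigma>. \<sigma> = (p, ?m, o')) (Act (Write i 2)) (\<lambda>\<sigma>. \<sigma> = (p, ?m', o'))"
        using write_True[OF t] by (intro hoare_Act_eq) (auto split: if_splits)
      then show "hoare xs B (\<lambda>\<sigma>. \<sigma> = (p, ?m, o'))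
          (if passes xs (Cell i 0) (p, ?m, o') then Act (Write f 2) else Act (Write i 2)) (\<lambda>\<sigma>. \<sigma> = (p, ?m', o'))"
        using False tl by simp
    qed
    have 3: "hoare xs B (\<lambda>\<sigma>. \<sigma> = (p, ?m', o')) (rewind i)
       (\<lambda>\<sigma>. \<sigma> = (p, ?m'(i := tape_of (inc bs) 0), o'))"
      using assms li tl by (intro hoare_rewind) auto
    have "hoare xs B (\<lambda>\<sigma>. \<sigma> = (p, m, o')) (next_mask i f)
       (\<lambda>\<sigma>. \<sigma> = (p, m(i := tape_of (inc bs) 0), o'))"
      unfolding next_mask_def using 1 2 3 by (intro hoare_Seq) auto
    then show ?thesis unfolding all using False by simp
  qed
qed

text \<open>Erasing from the far end keeps the tape a contiguous bit list, so the walk back still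
  sees where the contents end.\<close>

definition clear :: "'i \<Rightarrow> 'i prog" where
  "clear i = Loop (Neg (Cell i 0)) (Act (Shift i MoveRight)) ;; Act (Shift i MoveLeft) ;;
    Loop (Neg (Cell i 0)) (Act (Write i 0) ;; Act (Shift i MoveLeft)) ;; Act (Shift i MoveRight)"

lemma hoare_clear:
  assumes "m i = tape_of bs 0" "length bs \<le> B"
  shows "hoare xs B (\<lambda>\<sigma>. \<sigma> = (p, m, o')) (clear i) (\<lambda>\<sigma>. \<sigma> = (p, m(i := tape_of [] 0), o'))"
proof -
  let ?n = "length bs"
  let ?P = "\<lambda>j \<sigma>. \<sigma> = (p, m(i := tape_of bs (int j)), o')"
  let ?Q = "\<lambda>j \<sigma>. \<sigma> = (p, m(i := tape_of (take (?n - j) bs) (int ?n - 1 - int j)), o')"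
  have e: "(\<lambda>\<sigma>. \<sigma> = (p, m, o')) = ?P 0" using assms(1) by (simp add: fun_eq_iff) (metis fun_upd_triv)
  have 1: "hoare xs B (?P 0) (Loop (Neg (Cell i 0)) (Act (Shift i MoveRight))) (?P ?n)"
  proof (rule hoare_Loop)
    show "hoare xs B (?P j) (Act (Shift i MoveRight)) (?P (Suc j))" if "j < ?n" for j
      using that assms by (intro hoare_Act_eq) (auto simp: add.commute split: if_splits)
  qed auto
  have 2: "hoare xs B (?P ?n) (Act (Shift i MoveLeft)) (?Q 0)"
    using assms by (intro hoare_Act_eq) (auto split: if_splits)
  have pos: "int ?n - 1 - int j = int (?n - Suc j)" if "j < ?n" for j using that by simp
  have 3: "hoare xs B (?Q 0) (Loop (Neg (Cell i 0)) (Act (Write i 0) ;; Act (Shift i MoveLeft))) (?Q ?n)"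
  proof (rule hoare_Loop)
    fix j assume j: "j < ?n"
    let ?R = "\<lambda>\<sigma>. \<sigma> = (p, m(i := tape_of (take (?n - Suc j) bs) (int ?n - 1 - int j)), o')"
    have "take (?n - j) bs = take (?n - Suc j) bs @ [bs ! (?n - Suc j)]"
      using j take_Suc_conv_app_nth[of "?n - Suc j" bs] by (simp add: Suc_diff_Suc)
    then have w: "((fst (tape_of (take (?n - j) bs) (int ?n - 1 - int j)))(int ?n - 1 - int j := 0),
        int ?n - 1 - int j) = tape_of (take (?n - Suc j) bs) (int ?n - 1 - int j)"
      using tape_of_erase[of "take (?n - Suc j) bs" "bs ! (?n - Suc j)" "int ?n - 1 - int j"] j pos[OF j]
      by simp
    show "hoare xs B (?Q j) (Act (Write i 0) ;; Act (Shift i MoveLeft)) (?Q (Suc j))"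
    proof (rule hoare_Seq)
      show "hoare xs B (?Q j) (Act (Write i 0)) ?R"
        using w by (intro hoare_Act_eq) (auto split: if_splits)
      show "hoare xs B ?R (Act (Shift i MoveLeft)) (?Q (Suc j))"
        using j assms by (intro hoare_Act_eq) (auto simp: algebra_simps split: if_splits)
    qed
    have "scan (tape_of (take (?n - j) bs) (int ?n - 1 - int j)) \<noteq> 0"
      unfolding pos[OF j] using j by (subst scan_tape_of) auto
    then show "passes xs (Neg (Cell i 0)) s" if "?Q j s" for s
      using that by simp
  qed simp
  have 4: "hoare xs B (?Q ?n) (Act (Shift i MoveRight)) (\<lambda>\<sigma>. \<sigma> = (p, m(i := tape_of [] 0), o'))"
    using assms by (intro hoare_Act_eq) (auto split: if_splits)
  show ?thesis unfolding clear_def e using 1 2 3 4 by (intro hoare_Seq)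
qed

text \<open>The heads advance together until the symbols differ or both are blank. One last
  comparison then decides equality, because the blank differs from both bits.\<close>

definition equal :: "'i \<Rightarrow> 'i \<Rightarrow> 'i \<Rightarrow> 'i prog" where
  "equal i j f = Loop (Both (Same i j) (Neg (Cell i 0))) (Act (Shift i MoveRight) ;; Act (Shift j MoveRight)) ;;
    Cond (Same i j) (Act (Write f 2)) (Act (Write f 0)) ;; rewind i ;; rewind j"

lemma common_prefix:
  "\<exists>zs xs' ys'. xs = zs @ xs' \<and> ys = zs @ ys' \<and> (xs' = [] \<or> ys' = [] \<or> hd xs' \<noteq> hd ys')"
proof (induction xs ys rule: list_induct2')
  case (4 x xs y ys)
  show ?case
  proof (cases "x = y")
    case True
    then show ?thesis using 4 by (metis append_Cons)
  next
    case False
    then have "x # xs = [] @ x # xs \<and> y # ys = [] @ y # ys \<and> hd (x # xs) \<noteq> hd (y # ys)" by simp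
    then show ?thesis by blast
  qed
qed auto

lemma hoare_equal:
  assumes "m i = tape_of bs 0" "m j = tape_of cs 0" "length bs \<le> B" "length cs \<le> B"
    and "m f = flag b" "i \<noteq> j" "i \<noteq> f" "j \<noteq> f"
  shows "hoare xs B (\<lambda>\<sigma>. \<sigma> = (p, m, o')) (equal i j f) (\<lambda>\<sigma>. \<sigma> = (p, m(f := flag (bs = cs)), o'))"
proof -
  obtain zs bs' cs' where z: "bs = zs @ bs'" "cs = zs @ cs'" "bs' = [] \<or> cs' = [] \<or> hd bs' \<noteq> hd cs'"
    using common_prefix by blast
  let ?n = "length zs"
  let ?P = "\<lambda>k \<sigma>. \<sigma> = (p, m(i := tape_of bs (int k), j := tape_of cs (int k)), o')"
  let ?m = "m(i := tape_of bs (int ?n), j := tape_of cs (int ?n), f := flag (bs = cs))"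
  have e: "(\<lambda>\<sigma>. \<sigma> = (p, m, o')) = ?P 0"
    using assms(1,2,6) by (simp add: fun_eq_iff) (metis fun_upd_triv)
  have 1: "hoare xs B (?P 0) (Loop (Both (Same i j) (Neg (Cell i 0)))
     (Act (Shift i MoveRight) ;; Act (Shift j MoveRight))) (?P ?n)"
  proof (rule hoare_Loop)
    fix k assume k: "k < ?n"
    show "hoare xs B (?P k) (Act (Shift i MoveRight) ;; Act (Shift j MoveRight)) (?P (Suc k))"
    proof (rule hoare_Seq)
      show "hoare xs B (?P k) (Act (Shift i MoveRight))
         (\<lambda>\<sigma>. \<sigma> = (p, m(i := tape_of bs (int (Suc k)), j := tape_of cs (int k)), o'))"
        using k assms z by (intro hoare_Act_eq) (auto simp: fun_upd_twist add.commute split: if_splits)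
      show "hoare xs B (\<lambda>\<sigma>. \<sigma> = (p, m(i := tape_of bs (int (Suc k)), j := tape_of cs (int k)), o'))
         (Act (Shift j MoveRight)) (?P (Suc k))"
        using k assms z by (intro hoare_Act_eq) (auto simp: add.commute split: if_splits)
    qed
    show "passes xs (Both (Same i j) (Neg (Cell i 0))) s" if "?P k s" for s
      using that k z(1,2) assms(6) by (simp add: nth_append)
  next
    show "\<not> passes xs (Both (Same i j) (Neg (Cell i 0))) s" if "?P ?n s" for s
      using that z assms(6) by (cases bs'; cases cs') (auto simp: nth_append split: if_splits)
  qed
  have bc: "bs = cs \<longleftrightarrow> bs' = [] \<and> cs' = []" using z by auto
  have 2: "hoare xs B (?P ?n) (Cond (Same i j) (Act (Write f 2)) (Act (Write f 0))) (\<lambda>\<sigma>. \<sigma> = (p, ?m, o'))"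
  proof (rule hoare_Cond_eq)
    have same: "passes xs (Same i j) (p, m(i := tape_of bs (int ?n), j := tape_of cs (int ?n)), o') \<longleftrightarrow> bs = cs"
      using z assms(6) bc by (cases bs'; cases cs') (auto simp: nth_append split: if_splits)
    have w: "hoare xs B (?P ?n) (Act (Write f (if bs = cs then 2 else 0))) (\<lambda>\<sigma>. \<sigma> = (p, ?m, o'))"
      using assms flag_write[of b] by (intro hoare_Act_eq) (auto split: if_splits)
    show "hoare xs B (?P ?n)
      (if passes xs (Same i j) (p, m(i := tape_of bs (int ?n), j := tape_of cs (int ?n)), o')
       then Act (Write f 2) else Act (Write f 0)) (\<lambda>\<sigma>. \<sigma> = (p, ?m, o'))"
      unfolding same using w by (cases "bs = cs") simp_all
  qed
  have 3: "hoare xs B (\<lambda>\<sigma>. \<sigma> = (p, ?m, o')) (rewind i) (\<lambda>\<sigma>. \<sigma> = (p, ?m(i := tape_of bs 0), o'))"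
    using assms z by (intro hoare_rewind) auto
  have 4: "hoare xs B (\<lambda>\<sigma>. \<sigma> = (p, ?m(i := tape_of bs 0), o')) (rewind j)
      (\<lambda>\<sigma>. \<sigma> = (p, ?m(i := tape_of bs 0, j := tape_of cs 0), o'))"
    using assms z by (intro hoare_rewind) auto
  have "?m(i := tape_of bs 0, j := tape_of cs 0) = m(f := flag (bs = cs))"
    using assms by (auto simp: fun_eq_iff)
  then show ?thesis unfolding equal_def e using 1 2 3 4 by (intro hoare_Seq) auto
qed

definition count :: "'i \<Rightarrow> 'i \<Rightarrow> 'i \<Rightarrow> 'i prog \<Rightarrow> 'i prog" where
  "count i l f c = equal i l f ;; Loop (Neg (Cell f 2)) (c ;; increment i ;; equal i l f) ;; clear i"

text \<open>\<open>A j\<close> describes everything outside the loop control after \<open>j\<close>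
  rounds. It must tolerate changes of the counter \<open>i\<close> and the flag \<open>f\<close>,
  since incrementing and comparing alter these between rounds.\<close>

lemma hoare_count:
  assumes ne: "i \<noteq> l" "i \<noteq> f" "l \<noteq> f" and len: "length (bits v) \<le> B"
    and body: "\<And>j. j < v \<Longrightarrow>
      hoare xs B (\<lambda>(p, m, o'). A j (p, m, o') \<and> m i = num j \<and> m l = num v \<and> m f \<in> range flag) c
        (\<lambda>(p, m, o'). A (Suc j) (p, m, o') \<and> m i = num j \<and> m l = num v \<and> m f \<in> range flag)"
    and indep: "\<And>j p m o' a b. A j (p, m, o') \<Longrightarrow> m i = num a \<Longrightarrow> A j (p, m(i := num b), o')"
      "\<And>j p m o' b. A j (p, m, o') \<Longrightarrow> m f \<in> range flag \<Longrightarrow> A j (p, m(f := flag b), o')"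
  shows "hoare xs B (\<lambda>(p, m, o'). A 0 (p, m, o') \<and> m i = num 0 \<and> m l = num v \<and> m f \<in> range flag) (count i l f c)
        (\<lambda>(p, m, o'). A v (p, m, o') \<and> m i = num 0 \<and> m l = num v \<and> m f \<in> range flag)"
proof -
  \<comment> \<open>Two indices are needed: between the body and the increment, \<open>A\<close> is
    already one step ahead of the counter.\<close>
  let ?R = "\<lambda>j k (p, m, o'). A k (p, m, o') \<and> m i = num j \<and> m l = num v \<and> m f \<in> range flag"
  let ?P = "\<lambda>j (p, m, o'). A j (p, m, o') \<and> m i = num j \<and> m l = num v \<and> m f = flag (j = v)"
  have lb: "length (bits j) \<le> B" if "j \<le> v" for j using length_bits_mono[OF that] len by simp
  have eq: "hoare xs B (?R j j) (equal i l f) (?P j)" if "j \<le> v" for j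
  proof (rule hoare_pre)
    fix s assume "?R j j s"
    then obtain p m o' b where s: "s = (p, m, o')" "A j (p, m, o')" "m i = num j" "m l = num v" "m f = flag b"
      by auto
    have "A j (p, m(f := flag (j = v)), o')" using indep(2) s by blast
    then show "hoare xs B (\<lambda>\<sigma>. \<sigma> = s) (equal i l f) (?P j)"
      unfolding s(1) using s ne
      by (intro hoare_conseq[OF hoare_equal[of m i "bits j" l "bits v" B f b xs p o']])
        (auto simp: lb that bits_inject)
  qed
  have ic: "hoare xs B (?R j (Suc j)) (increment i) (?R (Suc j) (Suc j))" if "j < v" for j
  proof (rule hoare_pre)
    fix s assume "?R j (Suc j) s"
    then obtain p m o' b where s: "s = (p, m, o')" "A (Suc j) (p, m, o')" "m i = num j" "m l = num v" "m f = flag b"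
      by auto
    have "A (Suc j) (p, m(i := num (Suc j)), o')" using indep(1) s by blast
    then show "hoare xs B (\<lambda>\<sigma>. \<sigma> = s) (increment i) (?R (Suc j) (Suc j))"
      unfolding s(1) using s ne lb[of "Suc j"] that
      by (intro hoare_conseq[OF hoare_increment[of m i "bits j" B xs p o']])
        (auto simp: bits_Suc)
  qed
  have cl: "hoare xs B (?P v) (clear i) (?R 0 v)"
  proof (rule hoare_pre)
    fix s assume "?P v s"
    then obtain p m o' where s: "s = (p, m, o')" "A v (p, m, o')" "m i = num v" "m l = num v" "m f = flag True"
      by auto
    have "A v (p, m(i := num 0), o')" using indep(1) s by blast
    then show "hoare xs B (\<lambda>\<sigma>. \<sigma> = s) (clear i) (?R 0 v)"
      unfolding s(1) using s ne lb[of v]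
      by (intro hoare_conseq[OF hoare_clear[of m i "bits v" B xs p o']]) auto
  qed
  have loop: "hoare xs B (?P 0) (Loop (Neg (Cell f 2)) (c ;; increment i ;; equal i l f)) (?P v)"
  proof (rule hoare_Loop)
    fix j assume j: "j < v"
    have "hoare xs B (?P j) c (?R j (Suc j))"
      by (rule hoare_conseq[OF body[OF j]]) auto
    then show "hoare xs B (?P j) (c ;; increment i ;; equal i l f) (?P (Suc j))"
      using ic[OF j] eq[of "Suc j"] j by (intro hoare_Seq) auto
  qed auto
  show ?thesis
    unfolding count_def using eq[of 0] loop cl by (intro hoare_Seq) auto
qed

subsection \<open>Evaluating first-order formulas\<close>

datatype tape = Var nat | Size | Scratch | Cmp | Flag nat | Mask

datatype fm = Edge nat nat | Equ nat nat | Ng fm | Cj fm fm | Exi nat fm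

fun holds :: "nat ugraph \<Rightarrow> nat \<Rightarrow> (nat \<Rightarrow> nat) \<Rightarrow> fm \<Rightarrow> bool" where
  "holds G n r (Edge x y) \<longleftrightarrow> adj G (r x) (r y)"
| "holds G n r (Equ x y) \<longleftrightarrow> r x = r y"
| "holds G n r (Ng \<phi>) \<longleftrightarrow> \<not> holds G n r \<phi>"
| "holds G n r (Cj \<phi> \<psi>) \<longleftrightarrow> holds G n r \<phi> \<and> holds G n r \<psi>"
| "holds G n r (Exi x \<phi>) \<longleftrightarrow> (\<exists>a<n. holds G n (r(x := a)) \<phi>)"

fun bound_vars :: "fm \<Rightarrow> nat set" where
  "bound_vars (Edge x y) = {}"
| "bound_vars (Equ x y) = {}"
| "bound_vars (Ng \<phi>) = bound_vars \<phi>"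
| "bound_vars (Cj \<phi> \<psi>) = bound_vars \<phi> \<union> bound_vars \<psi>"
| "bound_vars (Exi x \<phi>) = insert x (bound_vars \<phi>)"

fun wf_fm :: "fm \<Rightarrow> bool" where
  "wf_fm (Edge x y) \<longleftrightarrow> True"
| "wf_fm (Equ x y) \<longleftrightarrow> x \<noteq> y"
| "wf_fm (Ng \<phi>) \<longleftrightarrow> wf_fm \<phi>"
| "wf_fm (Cj \<phi> \<psi>) \<longleftrightarrow> wf_fm \<phi> \<and> wf_fm \<psi>"
| "wf_fm (Exi x \<phi>) \<longleftrightarrow> wf_fm \<phi> \<and> x \<notin> bound_vars \<phi>"

definition skip :: "tape prog" where
  "skip = Act (Input Stay)"

text \<open>A row ends with \<open>Hash\<close>, so skipping as many rows as \<open>x\<close> says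
  and then as many symbols as \<open>y\<close> says reaches the entry without any multiplication.
  The input head position costs no space.\<close>

definition seek :: "nat \<Rightarrow> nat \<Rightarrow> tape prog" where
  "seek x y = Loop (Neg (Sees LeftEnd)) (Act (Input MoveLeft)) ;; Act (Input MoveRight) ;;
    count Scratch (Var x) Cmp (Loop (Neg (Sees (Sym Hash))) (Act (Input MoveRight)) ;; Act (Input MoveRight)) ;;
    count Scratch (Var y) Cmp (Act (Input MoveRight))"

definition for_all :: "nat \<Rightarrow> tape prog \<Rightarrow> tape prog" where
  "for_all x c = count (Var x) Size Cmp c"

text \<open>The result is left in \<open>Flag d\<close>. Second conjuncts and quantifier bodies are
  evaluated one flag higher, so a partial result in \<open>Flag d\<close> survives; the nesting
  depth bounds the number of flags.\<close>

primrec check :: "fm \<Rightarrow> nat \<Rightarrow> tape prog" where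
  "check (Edge x y) d = seek x y ;; Cond (Sees (Sym One)) (Act (Write (Flag d) 2)) (Act (Write (Flag d) 0))"
| "check (Equ x y) d = equal (Var x) (Var y) (Flag d)"
| "check (Ng \<phi>) d = check \<phi> d ;; Cond (Cell (Flag d) 2) (Act (Write (Flag d) 0)) (Act (Write (Flag d) 2))"
| "check (Cj \<phi> \<psi>) d = check \<phi> d ;; check \<psi> (Suc d) ;;
    Cond (Cell (Flag (Suc d)) 2) skip (Act (Write (Flag d) 0))"
| "check (Exi x \<phi>) d = Act (Write (Flag d) 0) ;;
    for_all x (check \<phi> (Suc d) ;; Cond (Cell (Flag (Suc d)) 2) (Act (Write (Flag d) 2)) skip)"

text \<open>Flags below \<open>d\<close> are in use and have the values \<open>F\<close>; the others are arbitrary, and so are the input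
  position and the comparison flag \<open>Cmp\<close>.\<close>

definition rep :: "nat \<Rightarrow> (nat \<Rightarrow> nat) \<Rightarrow> nat \<Rightarrow> (nat \<Rightarrow> bool) \<Rightarrow> work_tape \<Rightarrow> io_sym list \<Rightarrow> tape mem \<Rightarrow> bool" where
  "rep n r d F mt ys = (\<lambda>(p, m, o'). o' = ys \<and> m Mask = mt \<and> (\<forall>x. m (Var x) = num (r x)) \<and>
     m Size = num n \<and> m Scratch = num 0 \<and> m Cmp \<in> range flag \<and> (\<forall>g. m (Flag g) \<in> range flag) \<and>
     (\<forall>g<d. m (Flag g) = flag (F g)))"

text \<open>Loop invariants relate flags, mask tape and output to each other; \<open>C\<close>
  expresses such a relation where \<open>rep\<close> requires fixed values.\<close>

definition reps :: "nat \<Rightarrow> (nat \<Rightarrow> nat) \<Rightarrow> nat \<Rightarrow> ((nat \<Rightarrow> bool) \<Rightarrow> work_tape \<Rightarrow> io_sym list \<Rightarrow> bool) \<Rightarrow> tape mem \<Rightarrow> bool" where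
  "reps n r d C s \<longleftrightarrow> (\<exists>F mt ys. C F mt ys \<and> rep n r d F mt ys s)"

section \<open>Reading entries of the encoded adjacency matrix\<close>

lemma encode_sets_map_Suc:
  "encode_sets n (map R [0..<Suc k]) = encode_sets n (map R [0..<k]) @ encode_set n (R k)"
  by (simp add: encode_sets_def)

lemma length_encode_set [simp]: "length (encode_set n X) = Suc n"
  by (simp add: encode_set_def)

lemma length_encode_sets [simp]: "length (encode_sets n (map R [0..<k])) = k * Suc n"
  by (induction k) (simp_all add: encode_sets_map_Suc encode_sets_def)

lemma nth_encode_sets:
  "a < k \<Longrightarrow> b \<le> n \<Longrightarrow> encode_sets n (map R [0..<k]) ! (a * Suc n + b) =
    (if b = n then Hash else if b \<in> R a then One else Zero)"
proof (induction k)
  case (Suc k)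
  show ?case
  proof (cases "a = k")
    case True
    then show ?thesis using Suc.prems
      by (auto simp: encode_sets_map_Suc nth_append encode_set_def simp del: upt_Suc)
  next
    case False
    then have "a < k" using Suc.prems by simp
    then have "a * Suc n + Suc n \<le> k * Suc n" by (metis Suc_leI add.commute mult_Suc mult_le_mono1)
    then have "a * Suc n + b < k * Suc n" using Suc.prems by simp
    then show ?thesis using Suc.IH[OF \<open>a < k\<close> Suc.prems(2)]
      by (simp add: encode_sets_map_Suc nth_append del: upt_Suc mult_Suc_right)
  qed
qed simp

locale graph_input =
  fixes G :: "nat ugraph" and n :: nat and xs :: "io_sym list" and B :: nat
  assumes G: "std_graph G" "verts G = {..<n}" and xs: "xs = encode_graph G"
    and B: "length (bits n) \<le> B"
begin

lemma encode_eq: "xs = encode_sets n (map (\<lambda>i. {j. adj G i j}) [0..<n])"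
  by (simp add: xs encode_graph_def G Let_def)

lemma length_xs: "length xs = n * Suc n"
  by (simp add: encode_eq)

lemma read_matrix:
  assumes "a < n" "b \<le> n"
  shows "read_input xs (Suc (a * Suc n + b)) = Sym (if b = n then Hash else if adj G a b then One else Zero)"
proof -
  have "Suc a * Suc n \<le> n * Suc n" using assms by (intro mult_le_mono1) simp
  then have "a * Suc n + b < length xs" using assms length_xs by simp
  then show ?thesis using nth_encode_sets[OF assms, of "\<lambda>i. {j. adj G i j}"]
    by (simp add: read_input_def encode_eq[symmetric])
qed

lemma position_bound: "a < n \<Longrightarrow> b \<le> n \<Longrightarrow> Suc (a * Suc n + b) \<le> length xs"
proof -
  assume "a < n" "b \<le> n"
  moreover from this have "Suc a * Suc n \<le> n * Suc n" by (intro mult_le_mono1) simp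
  ultimately show ?thesis using length_xs by simp
qed

lemma length_bits_le: "a \<le> n \<Longrightarrow> length (bits a) \<le> B"
  using length_bits_mono[of a n] B by simp

lemma hoare_Input:
  "hoare xs B (\<lambda>\<sigma>. \<sigma> = (p, m, o')) (Act (Input d)) (\<lambda>\<sigma>. \<sigma> = (move_input (length xs) d p, m, o'))"
  by (rule hoare_Act_eq) auto

lemma hoare_next_row:
  assumes "a < n"
  shows "hoare xs B (\<lambda>\<sigma>. \<sigma> = (Suc (a * Suc n), m, o'))
    (Loop (Neg (Sees (Sym Hash))) (Act (Input MoveRight)) ;; Act (Input MoveRight))
    (\<lambda>\<sigma>. \<sigma> = (Suc (Suc a * Suc n), m, o'))"
proof (rule hoare_Seq)
  let ?P = "\<lambda>j \<sigma>. \<sigma> = (Suc (a * Suc n + j), m, o')"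
  have "hoare xs B (?P 0) (Loop (Neg (Sees (Sym Hash))) (Act (Input MoveRight))) (?P n)"
  proof (rule hoare_Loop)
    show "hoare xs B (?P j) (Act (Input MoveRight)) (?P (Suc j))" if "j < n" for j
      using hoare_Input[of "Suc (a * Suc n + j)" m o' MoveRight] position_bound[OF assms, of j] that
      by (simp add: min_def)
    show "passes xs (Neg (Sees (Sym Hash))) s" if "j < n" "?P j s" for j s
      using that read_matrix[OF assms, of j] by simp
    show "\<not> passes xs (Neg (Sees (Sym Hash))) s" if "?P n s" for s
      using that read_matrix[OF assms, of n] by simp
  qed
  then show "hoare xs B (\<lambda>\<sigma>. \<sigma> = (Suc (a * Suc n), m, o')) (Loop (Neg (Sees (Sym Hash))) (Act (Input MoveRight))) (?P n)"
    by simp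
  show "hoare xs B (?P n) (Act (Input MoveRight)) (\<lambda>\<sigma>. \<sigma> = (Suc (Suc a * Suc n), m, o'))"
    using hoare_Input[of "Suc (a * Suc n + n)" m o' MoveRight] position_bound[OF assms, of n]
    by (simp add: min_def algebra_simps)
qed

lemma hoare_seek:
  assumes v: "m (Var x) = num a" "m (Var y) = num b" "a < n" "b < n"
    and s: "m Scratch = num 0" "m Cmp \<in> range flag"
  shows "hoare xs B (\<lambda>\<sigma>. \<sigma> = (p, m, o')) (seek x y)
    (\<lambda>\<sigma>. \<exists>c. \<sigma> = (Suc (a * Suc n + b), m(Cmp := flag c), o'))"
proof -
  have 1: "hoare xs B (\<lambda>\<sigma>. \<sigma> = (p, m, o')) (Loop (Neg (Sees LeftEnd)) (Act (Input MoveLeft))) (\<lambda>\<sigma>. \<sigma> = (0, m, o'))"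
  proof -
    let ?P = "\<lambda>j \<sigma>. \<sigma> = (p - j, m, o')"
    have "hoare xs B (?P 0) (Loop (Neg (Sees LeftEnd)) (Act (Input MoveLeft))) (?P p)"
    proof (rule hoare_Loop)
      show "hoare xs B (?P j) (Act (Input MoveLeft)) (?P (Suc j))" for j
        using hoare_Input[of "p - j" m o' MoveLeft] by simp
    qed (auto simp: read_input_def)
    then show ?thesis by simp
  qed
  \<comment> \<open>Only \<open>Scratch\<close> and \<open>Cmp\<close> are disturbed on the way;
    everything else is compared with the initial memory \<open>m\<close>.\<close>
  let ?A = "\<lambda>q (p, m', o''). p = q \<and> o'' = o' \<and> (\<forall>t. t \<noteq> Scratch \<and> t \<noteq> Cmp \<longrightarrow> m' t = m t)"
  let ?next = "Loop (Neg (Sees (Sym Hash))) (Act (Input MoveRight)) ;; Act (Input MoveRight)"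
  let ?S = "\<lambda>q l v j (p, m', o''). ?A q (p, m', o'') \<and> m' Scratch = num j \<and> m' l = num v \<and> m' Cmp \<in> range flag"
  let ?R = "\<lambda>q l v (p, m', o''). ?A q (p, m', o'') \<and> m' Scratch = num 0 \<and> m' l = num v \<and> m' Cmp \<in> range flag"
  have 2: "hoare xs B (\<lambda>\<sigma>. \<sigma> = (0, m, o')) (Act (Input MoveRight)) (?R (Suc (0 * Suc n)) (Var x) a)"
    using v s length_xs by (intro hoare_conseq[OF hoare_Input[of 0 m o' MoveRight]]) auto
  have 3: "hoare xs B (?R (Suc (0 * Suc n)) (Var x) a)
     (count Scratch (Var x) Cmp ?next)
     (?R (Suc (a * Suc n)) (Var x) a)"
  proof (rule hoare_count[where A = "\<lambda>j. ?A (Suc (j * Suc n))"])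
    fix j assume j: "j < a"
    show "hoare xs B (?S (Suc (j * Suc n)) (Var x) a j)
      ?next
      (?S (Suc (Suc j * Suc n)) (Var x) a j)"
    proof (rule hoare_pre)
      fix s assume "(?S (Suc (j * Suc n)) (Var x) a j) s"
      then obtain m' where s: "s = (Suc (j * Suc n), m', o')" "\<forall>t. t \<noteq> Scratch \<and> t \<noteq> Cmp \<longrightarrow> m' t = m t"
        "m' Scratch = num j" "m' (Var x) = num a" "m' Cmp \<in> range flag" by auto
      have "j < n" using j v by simp
      from hoare_next_row[OF this, of m' o'] show "hoare xs B (\<lambda>\<sigma>. \<sigma> = s)
          ?next
          (?S (Suc (Suc j * Suc n)) (Var x) a j)"
        by (rule hoare_conseq) (use s in auto)
    qed
  qed (use v in \<open>auto intro: length_bits_le\<close>)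
  have 4: "hoare xs B (?R (Suc (a * Suc n)) (Var x) a) (count Scratch (Var y) Cmp (Act (Input MoveRight)))
     (?R (Suc (a * Suc n + b)) (Var y) b)"
  proof -
    have "hoare xs B (?R (Suc (a * Suc n + 0)) (Var y) b) (count Scratch (Var y) Cmp (Act (Input MoveRight)))
       (?R (Suc (a * Suc n + b)) (Var y) b)"
    proof (rule hoare_count[where A = "\<lambda>j. ?A (Suc (a * Suc n + j))"])
      show "hoare xs B (?S (Suc (a * Suc n + j)) (Var y) b j)
        (Act (Input MoveRight))
        (?S (Suc (a * Suc n + Suc j)) (Var y) b j)"
        if "j < b" for j
        using position_bound[OF v(3), of j] that v by (intro hoare_Act) (auto simp: min_def)
    qed (use v in \<open>auto intro: length_bits_le\<close>)
    then show ?thesis by (rule hoare_conseq) (use v in auto)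
  qed
  show ?thesis
    unfolding seek_def
  proof (intro hoare_Seq[OF 1] hoare_Seq[OF 2] hoare_Seq[OF 3] hoare_conseq[OF 4])
    fix s assume "?R (Suc (a * Suc n + b)) (Var y) b s"
    then obtain m' c where s: "s = (Suc (a * Suc n + b), m', o')" "\<forall>t. t \<noteq> Scratch \<and> t \<noteq> Cmp \<longrightarrow> m' t = m t"
        "m' Scratch = num 0" "m' Cmp = flag c" by auto
    have "m' t = (m(Cmp := flag c)) t" for t
      using s(2-4) assms(5) by (cases "t = Scratch"; cases "t = Cmp") auto
    then have "m' = m(Cmp := flag c)" by (rule ext)
    then show "\<exists>c. s = (Suc (a * Suc n + b), m(Cmp := flag c), o')" using s by blast
  qed auto
qed

lemma flag_range_write: "t \<in> range flag \<Longrightarrow> ((fst t)(snd t := (if b then 2 else 0)), snd t) = flag b"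
  using flag_write by (auto split: if_splits)

lemma hoare_set_flag:
  assumes "\<And>h. h < d' \<Longrightarrow> h \<noteq> g \<Longrightarrow> h < d" and "k = (if b then 2 else 0)"
  shows "hoare xs B (rep n r d F mt ys) (Act (Write (Flag g) k)) (rep n r d' (F(g := b)) mt ys)"
proof (rule hoare_Act)
  fix s assume s: "rep n r d F mt ys s" "bounded_heads B s"
  obtain p m o' where e: "s = (p, m, o')" by (cases s)
  have "m (Flag g) \<in> range flag" using s e by (simp add: rep_def)
  then have "do_act (length xs) (Write (Flag g) k) s = (p, m(Flag g := flag b), o')"
    using flag_range_write[of "m (Flag g)" b] assms(2) by (simp add: e)
  then show "rep n r d' (F(g := b)) mt ys (do_act (length xs) (Write (Flag g) k) s) \<and>
      bounded_heads B (do_act (length xs) (Write (Flag g) k) s)"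
    using s assms(1) by (auto simp: rep_def e)
qed

lemma hoare_skip: "hoare xs B P skip P"
  unfolding skip_def by (rule hoare_Act) (metis do_act.simps(3) move_input.simps(2) prod_cases3)

lemma hoare_for_all:
  assumes r: "r x = 0"
    and body: "\<And>j. j < n \<Longrightarrow> hoare xs B (reps n (r(x := j)) d (C j)) c (reps n (r(x := j)) d (C (Suc j)))"
  shows "hoare xs B (reps n r d (C 0)) (for_all x c) (reps n r d (C n))"
proof -
  \<comment> \<open>Leaving the value of \<open>x\<close> existential makes the invariant
    insensitive to the counter, as \<open>hoare_count\<close> demands; \<open>var\<close> recovers
    the value from the tape.\<close>
  let ?A = "\<lambda>j s. \<exists>a. reps n (r(x := a)) d (C j) s"
  let ?R = "\<lambda>k j (p, m, o'). ?A k (p, m, o') \<and> m (Var x) = num j \<and> m Size = num n \<and> m Cmp \<in> range flag"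
  have var: "reps n (r(x := j)) d C' (p, m, o')" if "\<exists>a. reps n (r(x := a)) d C' (p, m, o')" "m (Var x) = num j" for j C' p m o'
    using that by (fastforce simp: reps_def rep_def)
  have "hoare xs B (?R 0 0)
     (count (Var x) Size Cmp c)
     (?R n 0)"
  proof (rule hoare_count[where A = ?A])
    fix j assume j: "j < n"
    show "hoare xs B (?R j j) c
      (?R (Suc j) j)"
    proof (rule hoare_conseq[OF body[OF j]])
      fix s assume "(?R j j) s"
      then show "reps n (r(x := j)) d (C j) s" using var by (cases s) simp
    next
      fix s assume "reps n (r(x := j)) d (C (Suc j)) s"
      then show "(?R (Suc j) j) s"
      proof -
        obtain p m o' where e: "s = (p, m, o')" by (cases s)
        have "m (Var x) = num j \<and> m Size = num n \<and> m Cmp \<in> range flag"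
          using \<open>reps n (r(x := j)) d (C (Suc j)) s\<close> e by (auto simp: reps_def rep_def)
        then show ?thesis using \<open>reps n (r(x := j)) d (C (Suc j)) s\<close> unfolding e by blast
      qed
    qed
  next
    fix j p m o' a b assume "?A j (p, m, o')"
    then show "?A j (p, m(Var x := num b), o')"
      by (intro exI[of _ b]) (fastforce simp: reps_def rep_def)
  next
    fix j p m o' b assume "?A j (p, m, o')"
    then show "?A j (p, m(Cmp := flag b), o')" by (fastforce simp: reps_def rep_def)
  qed (use B in auto)
  then show ?thesis
    unfolding for_all_def
  proof (rule hoare_conseq)
    fix s assume s: "reps n r d (C 0) s"
    have "r(x := 0) = r" using r by auto
    show "?R 0 0 s"
    proof -
      obtain p m o' where e: "s = (p, m, o')" by (cases s)
      have "m (Var x) = num 0 \<and> m Size = num n \<and> m Cmp \<in> range flag"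
        using s e r by (auto simp: reps_def rep_def)
      moreover have "?A 0 s" using s \<open>r(x := 0) = r\<close> by metis
      ultimately show ?thesis unfolding e by blast
    qed
  next
    fix s assume s: "?R n 0 s"
    moreover have "r(x := 0) = r" using r by auto
    ultimately show "reps n r d (C n) s" using var[where j = 0] by (cases s) simp
  qed
qed

lemma rep_flag: "rep n r d F mt ys (p, m, o') \<Longrightarrow> g < d \<Longrightarrow> scan (m (Flag g)) = (if F g then 2 else 0)"
  by (simp add: rep_def)

lemma rep_mono: "rep n r d F mt ys s \<Longrightarrow> d' \<le> d \<Longrightarrow> (\<And>g. g < d' \<Longrightarrow> F g = F' g) \<Longrightarrow> rep n r d' F' mt ys s"
  by (auto simp: rep_def split: prod.splits)

lemma passes_flag: "rep n r d F mt ys s \<Longrightarrow> g < d \<Longrightarrow> passes xs (Cell (Flag g) 2) s \<longleftrightarrow> F g"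
  using rep_flag by (cases s) auto

lemma hoare_Cond_flag:
  assumes "g < d" "F g \<Longrightarrow> hoare xs B (rep n r d F mt ys) c Q" "\<not> F g \<Longrightarrow> hoare xs B (rep n r d F mt ys) c' Q"
  shows "hoare xs B (rep n r d F mt ys) (Cond (Cell (Flag g) 2) c c') Q"
proof (rule hoare_Cond)
  show "hoare xs B (\<lambda>s. rep n r d F mt ys s \<and> passes xs (Cell (Flag g) 2) s) c Q"
  proof (cases "F g")
    case True
    then show ?thesis by (intro hoare_conseq[OF assms(2)]) auto
  next
    case False
    then have "\<not> (rep n r d F mt ys s \<and> passes xs (Cell (Flag g) 2) s)" for s
      using passes_flag[of r d F mt ys s g] assms(1) by blast
    then show ?thesis by (intro hoareI) blast
  qed
  show "hoare xs B (\<lambda>s. rep n r d F mt ys s \<and> \<not> passes xs (Cell (Flag g) 2) s) c' Q"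
  proof (cases "F g")
    case False
    then show ?thesis by (intro hoare_conseq[OF assms(3)]) auto
  next
    case True
    then have "\<not> (rep n r d F mt ys s \<and> \<not> passes xs (Cell (Flag g) 2) s)" for s
      using passes_flag[of r d F mt ys s g] assms(1) by blast
    then show ?thesis by (intro hoareI) blast
  qed
qed

text \<open>Bound variables are required to be zero because their loops start from an idle counter;
  each loop restores this, so the formula can be evaluated again.\<close>

theorem hoare_check:
  assumes "wf_fm \<phi>" "\<And>x. r x < n" "\<And>x. x \<in> bound_vars \<phi> \<Longrightarrow> r x = 0"
  shows "hoare xs B (rep n r d F mt ys) (check \<phi> d) (rep n r (Suc d) (F(d := holds G n r \<phi>)) mt ys)"
  using assms
proof (induction \<phi> arbitrary: r d F mt ys)
  case (Edge x y)
  let ?R = "rep n r (Suc d) (F(d := holds G n r (Edge x y))) mt ys"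
  let ?c = "Cond (Sees (Sym One)) (Act (Write (Flag d) 2)) (Act (Write (Flag d) 0))"
  show ?case
  proof (rule hoare_pre)
    fix s assume s: "rep n r d F mt ys s"
    obtain p m o' where e: "s = (p, m, o')" by (cases s)
    let ?p = "Suc (r x * Suc n + r y)"
    let ?Q = "\<lambda>s. rep n r d F mt ys s \<and> fst s = ?p"
    have 1: "hoare xs B (\<lambda>\<sigma>. \<sigma> = s) (seek x y) ?Q"
      unfolding e
      by (rule hoare_conseq[OF hoare_seek[of m x "r x" y "r y"]]) (use s e Edge in \<open>auto simp: rep_def\<close>)
    have see: "passes xs (Sees (Sym One)) s \<longleftrightarrow> adj G (r x) (r y)" if "?Q s" for s
      using that read_matrix[of "r x" "r y"] Edge by (cases s) (auto simp: less_imp_le)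
    have 2: "hoare xs B ?Q ?c
        ?R"
    proof (rule hoare_pre)
      fix s assume s: "?Q s"
      have w: "hoare xs B (rep n r d F mt ys) (Act (Write (Flag d) (if adj G (r x) (r y) then 2 else 0)))
          (rep n r (Suc d) (F(d := adj G (r x) (r y))) mt ys)"
        by (rule hoare_set_flag) auto
      have "hoare xs B (\<lambda>\<sigma>. \<sigma> = s) (Act (Write (Flag d) (if adj G (r x) (r y) then 2 else 0)))
          (rep n r (Suc d) (F(d := adj G (r x) (r y))) mt ys)"
        by (rule hoare_conseq[OF w]) (use s in auto)
      then have "hoare xs B (\<lambda>\<sigma>. \<sigma> = s) (if passes xs (Sees (Sym One)) s then Act (Write (Flag d) 2) else Act (Write (Flag d) 0))
          ?R"
        unfolding see[OF s] by (cases "adj G (r x) (r y)") simp_all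
      then show "hoare xs B (\<lambda>\<sigma>. \<sigma> = s) ?c
          ?R" by (rule hoare_Cond_eq)
    qed
    show "hoare xs B (\<lambda>\<sigma>. \<sigma> = s) (check (Edge x y) d) ?R"
      using hoare_Seq[OF 1 2] by simp
  qed
next
  case (Equ x y)
  show ?case
  proof (rule hoare_pre)
    fix s assume s: "rep n r d F mt ys s"
    obtain p m o' where e: "s = (p, m, o')" by (cases s)
    then have "m (Flag d) \<in> range flag" using s by (simp add: rep_def)
    then obtain b where b: "m (Flag d) = flag b" by blast
    have lb: "length (bits (r z)) \<le> B" for z using Equ by (intro length_bits_le less_imp_le)
    show "hoare xs B (\<lambda>\<sigma>. \<sigma> = s) (check (Equ x y) d) (rep n r (Suc d) (F(d := holds G n r (Equ x y))) mt ys)"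
      unfolding e check.simps
      by (rule hoare_conseq[OF hoare_equal[of m "Var x" "bits (r x)" "Var y" "bits (r y)" B "Flag d" b]])
        (use s e b Equ lb in \<open>auto simp: rep_def bits_inject less_Suc_eq\<close>)
  qed
next
  case (Ng \<phi>)
  have 1: "hoare xs B (rep n r d F mt ys) (check \<phi> d) (rep n r (Suc d) (F(d := holds G n r \<phi>)) mt ys)"
    using Ng.prems by (intro Ng.IH) auto
  have 2: "hoare xs B (rep n r (Suc d) (F(d := holds G n r \<phi>)) mt ys)
     (Cond (Cell (Flag d) 2) (Act (Write (Flag d) 0)) (Act (Write (Flag d) 2)))
     (rep n r (Suc d) ((F(d := holds G n r \<phi>))(d := holds G n r (Ng \<phi>))) mt ys)"
    by (rule hoare_Cond_flag; (rule hoare_set_flag)?) auto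
  show ?case unfolding check.simps using hoare_Seq[OF 1 2] unfolding fun_upd_upd .
next
  case (Cj \<phi> \<psi>)
  let ?F = "F(d := holds G n r \<phi>)"
  let ?P = "rep n r (Suc (Suc d)) (?F(Suc d := holds G n r \<psi>)) mt ys"
  let ?R = "rep n r (Suc d) (F(d := holds G n r (Cj \<phi> \<psi>))) mt ys"
  have 1: "hoare xs B (rep n r d F mt ys) (check \<phi> d) (rep n r (Suc d) ?F mt ys)"
    using Cj.prems by (intro Cj.IH) auto
  have 2: "hoare xs B (rep n r (Suc d) ?F mt ys) (check \<psi> (Suc d))
      ?P"
    using Cj.prems by (intro Cj.IH) auto
  have 3: "hoare xs B ?P
     (Cond (Cell (Flag (Suc d)) 2) skip (Act (Write (Flag d) 0)))
     ?R"
  proof (rule hoare_Cond_flag)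
    assume a: "(?F(Suc d := holds G n r \<psi>)) (Suc d)"
    show "hoare xs B ?P skip
       ?R"
      by (rule hoare_conseq[OF hoare_skip]) (use a in \<open>auto elim!: rep_mono\<close>)
  next
    assume a: "\<not> (?F(Suc d := holds G n r \<psi>)) (Suc d)"
    show "hoare xs B ?P (Act (Write (Flag d) 0))
       ?R"
      by (rule hoare_conseq[OF hoare_set_flag[of "Suc d" d "Suc (Suc d)" 0 False r "?F(Suc d := holds G n r \<psi>)" mt ys]])
        (use a in \<open>auto elim!: rep_mono\<close>)
  qed simp
  show ?case unfolding check.simps by (rule hoare_Seq[OF 1 hoare_Seq[OF 2 3]])
next
  case (Exi x \<phi>)
  let ?t = "Cond (Cell (Flag (Suc d)) 2) (Act (Write (Flag d) 2)) skip"
  \<comment> \<open>After \<open>j\<close> rounds \<open>Flag d\<close> tells whether a witness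
    below \<open>j\<close> has been found.\<close>
  let ?C = "\<lambda>j F' mt' ys'. F' = F(d := \<exists>a<j. holds G n (r(x := a)) \<phi>) \<and> mt' = mt \<and> ys' = ys"
  have 1: "hoare xs B (rep n r d F mt ys) (Act (Write (Flag d) 0)) (reps n r (Suc d) (?C 0))"
    by (rule hoare_conseq[OF hoare_set_flag[of "Suc d" d d 0 False r F mt ys]]) (auto simp: reps_def)
  have 2: "hoare xs B (reps n r (Suc d) (?C 0))
     (for_all x (check \<phi> (Suc d) ;; ?t))
     (reps n r (Suc d) (?C n))"
  proof (rule hoare_for_all)
    show "r x = 0" using Exi by simp
    fix j assume j: "j < n"
    let ?r = "r(x := j)" and ?F = "F(d := \<exists>a<j. holds G n (r(x := a)) \<phi>)"
    let ?P = "rep n ?r (Suc (Suc d)) (?F(Suc d := holds G n ?r \<phi>)) mt ys"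
    have 1: "hoare xs B (rep n ?r (Suc d) ?F mt ys) (check \<phi> (Suc d))
       ?P"
      using Exi.prems j by (intro Exi.IH) auto
    have 2: "hoare xs B ?P
       ?t (reps n ?r (Suc d) (?C (Suc j)))"
    proof (rule hoare_Cond_flag)
      assume a: "(?F(Suc d := holds G n ?r \<phi>)) (Suc d)"
      then have "\<exists>a<Suc j. holds G n (r(x := a)) \<phi>" by auto
      then show "hoare xs B ?P (Act (Write (Flag d) 2))
         (reps n ?r (Suc d) (?C (Suc j)))"
        by (intro hoare_conseq[OF hoare_set_flag[of "Suc d" d "Suc (Suc d)" 2 True ?r "?F(Suc d := holds G n ?r \<phi>)" mt ys]])
          (auto simp: reps_def elim!: rep_mono)
    next
      assume a: "\<not> (?F(Suc d := holds G n ?r \<phi>)) (Suc d)"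
      then have "(\<exists>a<Suc j. holds G n (r(x := a)) \<phi>) \<longleftrightarrow> (\<exists>a<j. holds G n (r(x := a)) \<phi>)"
        by (auto simp: less_Suc_eq)
      then show "hoare xs B ?P skip
         (reps n ?r (Suc d) (?C (Suc j)))"
        by (intro hoare_conseq[OF hoare_skip]) (auto simp: reps_def elim!: rep_mono)
    qed simp
    show "hoare xs B (reps n ?r (Suc d) (?C j))
       (check \<phi> (Suc d) ;; ?t)
       (reps n ?r (Suc d) (?C (Suc j)))"
      by (rule hoare_conseq[OF hoare_Seq[OF 1 2]]) (auto simp: reps_def)
  qed
  show ?case
    unfolding check.simps
    by (rule hoare_conseq[OF hoare_Seq[OF 1 2]]) (auto simp: reps_def elim!: rep_mono)
qed

end

subsection \<open>Formulas for the neighbourhood matrix\<close>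

abbreviation "Disj \<phi> \<psi> \<equiv> Ng (Cj (Ng \<phi>) (Ng \<psi>))"
abbreviation "Imp \<phi> \<psi> \<equiv> Ng (Cj \<phi> (Ng \<psi>))"
abbreviation "Univ x \<phi> \<equiv> Ng (Exi x (Ng \<phi>))"

text \<open>The variables \<open>0, 1, 2\<close> hold \<open>u, v, w\<close>, and \<open>3\<close> holds the vertex whose membership is tested.  Each
  bound variable has a counter of its own that is zero when idle.\<close>

definition "Nbh x y = Disj (Equ x y) (Edge x y)"
definition "Sub x y z = Univ z (Imp (Nbh x z) (Nbh y z))"
definition "PSub x y z = Cj (Sub x y z) (Ng (Sub y x z))"
definition "IsCD x y z = Cj (Edge x y) (PSub x y z)"
definition "CcCond x y z t = Cj (Univ z (Disj (Nbh x z) (Nbh y z)))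
  (Cj (Univ z (Imp (Cj (Nbh x z) (Ng (Nbh y z))) (Sub z x t)))
      (Univ z (Imp (Cj (Nbh y z) (Ng (Nbh x z))) (Sub z y t))))"
definition "OvlCc x y z t = Cj (Cj (Ng (Sub x y z)) (Ng (Sub y x z))) (CcCond x y z t)"
definition "IsCC x y z t = Cj (Edge x y) (OvlCc x y z t)"
definition "IsOV x y z t = Cj (Cj (Edge x y) (Ng (OvlCc x y z t))) (Cj (Ng (PSub x y z)) (Ng (PSub y x z)))"
definition "PrivateCD a b c = Univ 4 (Imp (Cj (Cj (Ng (Equ 4 a)) (Cj (Ng (Equ 4 b)) (Ng (Equ 4 c))))
  (Cj (Edge 4 a) (Cj (Ng (Edge 4 b)) (Ng (Edge 4 c))))) (IsCD 4 a 5))"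
definition "InDelta = Cj (Cj (Ng (Equ 0 1)) (Cj (Ng (Equ 0 2)) (Ng (Equ 1 2))))
  (Cj (Cj (IsOV 0 1 4 5) (Cj (IsOV 0 2 4 5) (IsOV 1 2 4 5)))
  (Cj (Univ 4 (Disj (Nbh 0 4) (Disj (Nbh 1 4) (Nbh 2 4))))
  (Cj (PrivateCD 0 1 2) (Cj (PrivateCD 1 0 2) (PrivateCD 2 0 1)))))"
definition "OffT = Cj (Ng (Equ 3 0)) (Cj (Ng (Equ 3 1)) (Ng (Equ 3 2)))"
definition "InGamma = Cj OffT (Disj (Cj (IsOV 3 0 4 5) (Cj (IsOV 3 1 4 5) (Ng (Edge 3 2))))
  (Disj (Cj (IsOV 3 0 4 5) (Cj (IsOV 3 2 4 5) (Ng (Edge 3 1))))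
    (Disj (IsCC 3 0 4 5) (Disj (IsCC 3 1 4 5) (IsCC 3 2 4 5)))))"
definition "InOmega = Cj OffT (Cj (IsOV 3 0 4 5) (Cj (IsOV 3 1 4 5) (IsOV 3 2 4 5)))"

lemma bound_vars_macros:
  "bound_vars (Sub x y z) = {z}" "bound_vars (PSub x y z) = {z}" "bound_vars (IsCD x y z) = {z}"
  "bound_vars (CcCond x y z t) = {z, t}" "bound_vars (OvlCc x y z t) = {z, t}"
  "bound_vars (IsCC x y z t) = {z, t}" "bound_vars (IsOV x y z t) = {z, t}"
  "bound_vars (PrivateCD a b c) = {4, 5}" "bound_vars OffT = {}"
  by (auto simp: Nbh_def Sub_def PSub_def IsCD_def CcCond_def OvlCc_def IsCC_def IsOV_def
      PrivateCD_def OffT_def)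

lemma bound_vars_formulas:
  "bound_vars InDelta = {4, 5}" "bound_vars InGamma = {4, 5}" "bound_vars InOmega = {4, 5}"
  by (auto simp: InDelta_def InGamma_def InOmega_def bound_vars_macros Nbh_def)

lemma wf_macros:
  "x \<noteq> y \<Longrightarrow> wf_fm (Nbh x y)"
  "z \<noteq> x \<Longrightarrow> z \<noteq> y \<Longrightarrow> wf_fm (Sub x y z)" "z \<noteq> x \<Longrightarrow> z \<noteq> y \<Longrightarrow> wf_fm (PSub x y z)"
  "z \<noteq> x \<Longrightarrow> z \<noteq> y \<Longrightarrow> wf_fm (IsCD x y z)"
  by (auto simp: Nbh_def Sub_def PSub_def IsCD_def)

lemma wf_CcCond:
  assumes "z \<noteq> x" "z \<noteq> y" "t \<noteq> x" "t \<noteq> y" "t \<noteq> z"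
  shows "wf_fm (CcCond x y z t)" "wf_fm (OvlCc x y z t)" "wf_fm (IsCC x y z t)" "wf_fm (IsOV x y z t)"
proof -
  show c: "wf_fm (CcCond x y z t)"
    using assms by (simp add: CcCond_def wf_macros bound_vars_macros Nbh_def)
  then show o: "wf_fm (OvlCc x y z t)" using assms by (simp add: OvlCc_def wf_macros)
  then show "wf_fm (IsCC x y z t)" "wf_fm (IsOV x y z t)"
    using assms by (simp_all add: IsCC_def IsOV_def wf_macros)
qed

lemma wf_formulas: "wf_fm InDelta" "wf_fm InGamma" "wf_fm InOmega"
  by (simp_all add: InDelta_def InGamma_def InOmega_def PrivateCD_def OffT_def wf_macros wf_CcCond
      bound_vars_macros Nbh_def)

context graph_input
begin

abbreviation "N \<equiv> closed_nbh G"

lemma N_subset: "a < n \<Longrightarrow> N a \<subseteq> {..<n}"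
  by (auto simp: closed_nbh_iff G)

lemma holds_Nbh: "r y < n \<Longrightarrow> holds G n r (Nbh x y) \<longleftrightarrow> r y \<in> N (r x)"
  by (auto simp: Nbh_def closed_nbh_iff G)

lemma holds_Sub:
  assumes "z \<noteq> x" "z \<noteq> y" "r x < n"
  shows "holds G n r (Sub x y z) \<longleftrightarrow> N (r x) \<subseteq> N (r y)"
  using assms N_subset[of "r x"] by (auto simp: Sub_def holds_Nbh)

lemma holds_PSub:
  assumes "z \<noteq> x" "z \<noteq> y" "r x < n" "r y < n"
  shows "holds G n r (PSub x y z) \<longleftrightarrow> N (r x) \<subset> N (r y)"
  using assms by (auto simp: PSub_def holds_Sub)

lemma holds_IsCD:
  assumes "z \<noteq> x" "z \<noteq> y" "r x < n" "r y < n"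
  shows "holds G n r (IsCD x y z) \<longleftrightarrow> nbh_matrix G (r x) (r y) = CD"
  using assms by (simp add: IsCD_def holds_PSub nbh_matrix_CD_iff)

lemma holds_CcCond:
  assumes "z \<noteq> x" "z \<noteq> y" "t \<noteq> x" "t \<noteq> y" "t \<noteq> z" "r x < n" "r y < n"
  shows "holds G n r (CcCond x y z t) \<longleftrightarrow> cc_cond G (r x) (r y)"
proof -
  have *: "(\<forall>a<n. a \<in> N (r p) \<and> a \<notin> N (r q) \<longrightarrow> Q a) \<longleftrightarrow> (\<forall>a\<in>N (r p) - N (r q). Q a)" if "r p < n" for p q Q
    using N_subset[OF that] by auto
  have "(\<forall>a<n. a \<notin> N (r x) \<longrightarrow> a \<in> N (r y)) \<longleftrightarrow> N (r x) \<union> N (r y) = verts G"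
    using N_subset assms G by auto
  moreover have "holds G n r (CcCond x y z t) \<longleftrightarrow> (\<forall>a<n. a \<notin> N (r x) \<longrightarrow> a \<in> N (r y)) \<and>
    (\<forall>a<n. a \<in> N (r x) \<and> a \<notin> N (r y) \<longrightarrow> N a \<subseteq> N (r x)) \<and>
    (\<forall>a<n. a \<in> N (r y) \<and> a \<notin> N (r x) \<longrightarrow> N a \<subseteq> N (r y))"
  proof -
    have h: "holds G n (r(z := a)) (Nbh x z) \<longleftrightarrow> a \<in> N (r x)" "holds G n (r(z := a)) (Nbh y z) \<longleftrightarrow> a \<in> N (r y)"
      "holds G n (r(z := a)) (Sub z x t) \<longleftrightarrow> N a \<subseteq> N (r x)"
      "holds G n (r(z := a)) (Sub z y t) \<longleftrightarrow> N a \<subseteq> N (r y)" if "a < n" for a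
      using that assms holds_Nbh[of "r(z := a)" z x] holds_Nbh[of "r(z := a)" z y]
        holds_Sub[of t z x "r(z := a)"] holds_Sub[of t z y "r(z := a)"] by auto
    show ?thesis unfolding CcCond_def holds.simps by (simp only: h cong: conj_cong) blast
  qed
  ultimately show ?thesis
    using *[of x y "\<lambda>a. N a \<subseteq> N (r x)"] *[of y x "\<lambda>a. N a \<subseteq> N (r y)"] assms
    unfolding cc_cond_def by presburger
qed

text \<open>The formula states only the two non-inclusions; the common element needed for
  \<open>overlap\<close> comes from adjacency.\<close>

lemma holds_OvlCc:
  assumes "z \<noteq> x" "z \<noteq> y" "t \<noteq> x" "t \<noteq> y" "t \<noteq> z" "r x < n" "r y < n" "adj G (r x) (r y)"
  shows "holds G n r (OvlCc x y z t) \<longleftrightarrow> overlap (N (r x)) (N (r y)) \<and> cc_cond G (r x) (r y)"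
proof -
  have "r x \<in> N (r x) \<inter> N (r y)" using assms G by (auto simp: closed_nbh_iff adj_commute)
  then show ?thesis using assms by (auto simp: OvlCc_def holds_CcCond holds_Sub overlap_def)
qed

lemma holds_IsCC:
  assumes "z \<noteq> x" "z \<noteq> y" "t \<noteq> x" "t \<noteq> y" "t \<noteq> z" "r x < n" "r y < n"
  shows "holds G n r (IsCC x y z t) \<longleftrightarrow> nbh_matrix G (r x) (r y) = CC"
  using holds_OvlCc[OF assms] by (auto simp: IsCC_def nbh_matrix_CC_iff overlap_def)

lemma holds_IsOV:
  assumes "z \<noteq> x" "z \<noteq> y" "t \<noteq> x" "t \<noteq> y" "t \<noteq> z" "r x < n" "r y < n"
  shows "holds G n r (IsOV x y z t) \<longleftrightarrow> nbh_matrix G (r x) (r y) = OV"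
  using holds_OvlCc[OF assms] assms by (auto simp: IsOV_def nbh_matrix_OV_iff holds_PSub)

lemma holds_PrivateCD:
  assumes "r a < n" "{a, b, c} \<subseteq> {0, 1, 2}" "r a \<noteq> r b" "r a \<noteq> r c"
  shows "holds G n r (PrivateCD a b c) \<longleftrightarrow>
    (\<forall>y\<in>private_nbh G {r a, r b, r c} (r a). nbh_matrix G y (r a) = CD)"
proof -
  have ne: "a \<noteq> 4" "b \<noteq> 4" "c \<noteq> 4" "a \<noteq> 5" using assms by auto
  have "holds G n (r(4 := y)) (IsCD 4 a 5) \<longleftrightarrow> nbh_matrix G y (r a) = CD" if "y < n" for y
    using ne assms(1) that by (subst holds_IsCD) auto
  then show ?thesis
    using ne assms(3,4) by (auto simp: PrivateCD_def private_nbh_def G)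
qed

lemma holds_InDelta:
  assumes "r 0 < n" "r 1 < n" "r 2 < n"
  shows "holds G n r InDelta \<longleftrightarrow> distinct [r 0, r 1, r 2] \<and> {r 0, r 1, r 2} \<in> Delta G"
proof (cases "distinct [r 0, r 1, r 2]")
  case True
  have ins: "{r 1, r 0, r 2} = {r 0, r 1, r 2}" "{r 2, r 0, r 1} = {r 0, r 1, r 2}" by auto
  have "holds G n r (Univ 4 (Disj (Nbh 0 4) (Disj (Nbh 1 4) (Nbh 2 4)))) \<longleftrightarrow>
      (\<Union>t\<in>{r 0, r 1, r 2}. N t) = verts G"
    using assms N_subset[OF assms(1)] N_subset[OF assms(2)] N_subset[OF assms(3)] G
    by (auto simp: holds_Nbh)
  moreover have "ov_triangle G {r 0, r 1, r 2} \<longleftrightarrow>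
      nbh_matrix G (r 0) (r 1) = OV \<and> nbh_matrix G (r 0) (r 2) = OV \<and> nbh_matrix G (r 1) (r 2) = OV"
    using assms True nbh_matrix_OV_commute[of G] by (auto simp: ov_triangle_def G)
  ultimately show ?thesis
    using True assms holds_PrivateCD[of r 0 1 2] holds_PrivateCD[of r 1 0 2] holds_PrivateCD[of r 2 0 1]
    unfolding InDelta_def ins by (auto simp: holds_IsOV Delta_def simp del: holds.simps(5))
qed (auto simp: InDelta_def)

lemma holds_InGamma:
  assumes "r 0 < n" "r 1 < n" "r 2 < n" "r 3 < n"
  shows "holds G n r InGamma \<longleftrightarrow> r 3 \<in> Gamma_ov G (r 0) (r 1) (r 2) \<union> Gamma_cc G (r 0) (r 1) (r 2)"
  using assms by (auto simp: InGamma_def OffT_def holds_IsOV holds_IsCC Gamma_ov_def Gamma_cc_def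
      nbh_matrix_DI_iff G)

lemma holds_InOmega:
  assumes "r 0 < n" "r 1 < n" "r 2 < n" "r 3 < n"
  shows "holds G n r InOmega \<longleftrightarrow> r 3 \<in> Omega G (r 0) (r 1) (r 2)"
  using assms by (auto simp: InOmega_def OffT_def holds_IsOV Omega_def G)

end

subsection \<open>Enumerating subsets by binary counting\<close>

text \<open>The low \<open>k\<close> bits of \<open>i\<close> at fixed width; at
  \<open>i = 2 ^ k\<close> it wraps around to zeros, just as \<open>next_mask\<close> does.\<close>

fun bit_mask :: "nat \<Rightarrow> nat \<Rightarrow> bool list" where
  "bit_mask 0 i = []"
| "bit_mask (Suc k) i = odd i # bit_mask k (i div 2)"

lemma length_bit_mask [simp]: "length (bit_mask k i) = k"
  by (induction k arbitrary: i) auto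

lemma bit_mask_0: "bit_mask k 0 = replicate k False"
  by (induction k) auto

lemma bit_mask_power: "bit_mask k (2 ^ k) = replicate k False"
  by (induction k) auto

lemma bit_mask_val: "bit_mask (length bs) (val bs) = bs"
  by (induction bs) auto

lemma val_less: "val bs < 2 ^ length bs"
  by (induction bs) auto

lemma bit_mask_Suc:
  "i < 2 ^ k \<Longrightarrow> if Suc i = 2 ^ k then (\<forall>b\<in>set (bit_mask k i). b)
    else \<not> (\<forall>b\<in>set (bit_mask k i). b) \<and> inc (bit_mask k i) = bit_mask k (Suc i)"
proof (induction k arbitrary: i)
  case (Suc k)
  have lt: "i div 2 < 2 ^ k" using Suc.prems by simp
  show ?case
  proof (cases "even i")
    case True
    then have "odd (Suc i)" by simp
    moreover have "even (2 ^ Suc k :: nat)" by simp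
    ultimately have "Suc i \<noteq> 2 ^ Suc k" by metis
    then show ?thesis using True by (auto elim!: evenE)
  next
    case False
    then have "Suc i = 2 ^ Suc k \<longleftrightarrow> Suc (i div 2) = 2 ^ k" "Suc i div 2 = Suc (i div 2)"
      by (auto elim!: oddE)
    then show ?thesis using Suc.IH[OF lt] False by (auto split: if_splits)
  qed
qed simp

text \<open>The position of \<open>x\<close> when \<open>W\<close> is listed in increasing order,
  and thus the mask cell belonging to a member \<open>x\<close>.\<close>

definition rank :: "nat set \<Rightarrow> nat \<Rightarrow> nat" where
  "rank W x = card {y \<in> W. y < x}"

lemma rank_0 [simp]: "rank W 0 = 0"
  by (simp add: rank_def)

lemma rank_Suc: "finite W \<Longrightarrow> rank W (Suc x) = (if x \<in> W then Suc (rank W x) else rank W x)"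
proof -
  assume f: "finite W"
  have "{y \<in> W. y < Suc x} = (if x \<in> W then insert x {y \<in> W. y < x} else {y \<in> W. y < x})"
    by (auto simp: less_Suc_eq)
  then show ?thesis using f by (simp add: rank_def)
qed

lemma rank_less:
  assumes "finite W" "x \<in> W"
  shows "rank W x < card W"
  unfolding rank_def using assms by (intro psubset_card_mono) auto

lemma rank_strict: "finite W \<Longrightarrow> x \<in> W \<Longrightarrow> x < y \<Longrightarrow> rank W x < rank W y"
  unfolding rank_def by (intro psubset_card_mono) auto

definition selected :: "nat set \<Rightarrow> bool list \<Rightarrow> nat set" where
  "selected W bs = {x \<in> W. bs ! rank W x}"

text \<open>The witness is the value of the characteristic list of \<open>W'\<close> along the
  increasing listing of \<open>W\<close>; this list is well defined because ranks are distinct on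
  \<open>W\<close>.\<close>

lemma selected_surj:
  assumes "finite W" "W' \<subseteq> W"
  shows "\<exists>i<2 ^ card W. selected W (bit_mask (card W) i) = W'"
proof -
  define bs where "bs = map (\<lambda>j. \<exists>x\<in>W'. rank W x = j) [0..<card W]"
  have l: "length bs = card W" by (simp add: bs_def)
  have inj: "x = y" if "x \<in> W" "y \<in> W" "rank W x = rank W y" for x y
    using that rank_strict[OF assms(1)] by (metis less_irrefl linorder_less_linear)
  have "bs ! rank W x \<longleftrightarrow> x \<in> W'" if "x \<in> W" for x
    using rank_less[OF assms(1) that] inj that assms(2) by (auto simp: bs_def)
  then have "selected W bs = W'" using assms(2) by (auto simp: selected_def)
  then show ?thesis using bit_mask_val[of bs] val_less[of bs] l by metis
qed

subsection \<open>The enumeration program\<close>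

text \<open>The first row has one symbol per vertex. The test asks for bits rather than for the
  absence of \<open>Hash\<close>, since for the empty graph the input is empty and the right end
  marker must stop the loop as well.\<close>

definition read_size :: "tape prog" where
  "read_size = Act (Input MoveRight) ;;
    Loop (Neg (Both (Neg (Sees (Sym Zero))) (Neg (Sees (Sym One))))) (increment Size ;; Act (Input MoveRight))"

text \<open>One zero bit is written per member of \<open>Omega\<close>, so the mask obtains its
  width without the cardinality being computed.\<close>

definition blank_mask :: "tape prog" where
  "blank_mask = for_all 3 (check InOmega 0 ;;
    Cond (Cell (Flag 0) 2) (Act (Write Mask 1) ;; Act (Shift Mask MoveRight)) skip) ;; rewind Mask"

text \<open>Flags 1 and 2 hold membership in the \<open>Gamma\<close> sets and in
  \<open>Omega\<close>. The mask head advances exactly at members of \<open>Omega\<close>, which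
  keeps it on the cell of the next member.\<close>

definition output_bit :: "tape prog" where
  "output_bit = Cond (Cell (Flag 1) 2) (Act (Output One))
      (Cond (Both (Cell (Flag 2) 2) (Cell Mask 2)) (Act (Output One)) (Act (Output Zero))) ;;
    Cond (Cell (Flag 2) 2) (Act (Shift Mask MoveRight)) skip"

definition output_set :: "tape prog" where
  "output_set = for_all 3 (check InGamma 1 ;; check InOmega 2 ;; output_bit) ;;
    Act (Output Hash) ;; rewind Mask"

text \<open>\<open>Flag 0\<close> receives the overflow of the mask; \<open>output_set\<close>
  evaluates its formulas from \<open>Flag 1\<close> upwards and so preserves it.\<close>

definition output_family :: "tape prog" where
  "output_family = blank_mask ;; Act (Write (Flag 0) 0) ;;
    Loop (Neg (Cell (Flag 0) 2)) (output_set ;; next_mask Mask (Flag 0)) ;; clear Mask"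

definition enumerate :: "tape prog" where
  "enumerate = read_size ;;
    for_all 0 (for_all 1 (for_all 2 (check InDelta 0 ;; Cond (Cell (Flag 0) 2) output_family skip)))"

lemma hoare_Cond_known:
  assumes "\<And>s. P s \<Longrightarrow> passes xs t s \<longleftrightarrow> b" "hoare xs B P (if b then c else d) Q"
  shows "hoare xs B P (Cond t c d) Q"
proof (rule hoare_pre)
  fix s assume s: "P s"
  have "hoare xs B (\<lambda>\<sigma>. \<sigma> = s) (if b then c else d) Q"
    by (rule hoare_conseq[OF assms(2)]) (use s in simp_all)
  then show "hoare xs B (\<lambda>\<sigma>. \<sigma> = s) (Cond t c d) Q"
    unfolding assms(1)[OF s, symmetric] by (rule hoare_Cond_eq)
qed

context graph_input
begin

lemma hoare_reps_pre:
  assumes "\<And>F mt ys. C F mt ys \<Longrightarrow> hoare xs B (rep n r d F mt ys) c Q"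
  shows "hoare xs B (reps n r d C) c Q"
proof (rule hoare_pre)
  fix s assume "reps n r d C s"
  then obtain F mt ys where C: "C F mt ys" "rep n r d F mt ys s" by (auto simp: reps_def)
  show "hoare xs B (\<lambda>\<sigma>. \<sigma> = s) c Q"
    by (rule hoare_conseq[OF assms[OF C(1)]]) (use C in auto)
qed

lemma hoare_reps_post:
  assumes "hoare xs B P c (rep n r d' F mt ys)" "d \<le> d'" "C F mt ys"
  shows "hoare xs B P c (reps n r d C)"
proof (rule hoare_conseq[OF assms(1)])
  fix s assume "rep n r d' F mt ys s"
  then have "rep n r d F mt ys s" using assms(2) rep_mono[of r d' F mt ys s d F] by blast
  then show "reps n r d C s" unfolding reps_def using assms(3) by blast
qed

lemma hoare_Output: "hoare xs B (rep n r d F mt ys) (Act (Output a)) (rep n r d F mt (ys @ [a]))"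
  by (rule hoare_Act) (auto simp: rep_def)

lemma hoare_Write_Mask:
  "hoare xs B (rep n r d F mt ys) (Act (Write Mask b)) (rep n r d F ((fst mt)(snd mt := b), snd mt) ys)"
  by (rule hoare_Act) (auto simp: rep_def)

lemma hoare_Shift_Mask:
  assumes "- 1 \<le> h'" "h' \<le> int B" "h' = move_work e h"
  shows "hoare xs B (rep n r d F (tape_of bs h) ys) (Act (Shift Mask e)) (rep n r d F (tape_of bs h') ys)"
  using assms by (intro hoare_Act) (auto simp: rep_def)

lemma hoare_rewind_Mask:
  assumes "h \<le> length bs" "length bs \<le> B"
  shows "hoare xs B (rep n r d F (tape_of bs (int h)) ys) (rewind Mask) (rep n r d F (tape_of bs 0) ys)"
proof (rule hoare_pre)
  fix s assume s: "rep n r d F (tape_of bs (int h)) ys s"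
  obtain p m o' where e: "s = (p, m, o')" by (cases s)
  then have "m Mask = tape_of bs (int h)" using s by (simp add: rep_def)
  from hoare_rewind[of m, OF this assms]
  show "hoare xs B (\<lambda>\<sigma>. \<sigma> = s) (rewind Mask) (rep n r d F (tape_of bs 0) ys)"
    unfolding e by (rule hoare_conseq) (use s e in \<open>auto simp: rep_def\<close>)
qed

lemma hoare_clear_Mask:
  assumes "length bs \<le> B"
  shows "hoare xs B (rep n r d F (tape_of bs 0) ys) (clear Mask) (rep n r d F (tape_of [] 0) ys)"
proof (rule hoare_pre)
  fix s assume s: "rep n r d F (tape_of bs 0) ys s"
  obtain p m o' where e: "s = (p, m, o')" by (cases s)
  then have "m Mask = tape_of bs 0" using s by (simp add: rep_def)
  from hoare_clear[of m, OF this assms]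
  show "hoare xs B (\<lambda>\<sigma>. \<sigma> = s) (clear Mask) (rep n r d F (tape_of [] 0) ys)"
    unfolding e by (rule hoare_conseq) (use s e in \<open>auto simp: rep_def\<close>)
qed

lemma hoare_read_size:
  "hoare xs B (\<lambda>s. s = init_mem) read_size (rep n (\<lambda>_. 0) 0 F (tape_of [] 0) [])"
proof -
  let ?P = "\<lambda>j \<sigma>. \<sigma> = (Suc j, (\<lambda>_. tape_of [] 0)(Size := num j), [])"
  have pos: "n > 0 \<Longrightarrow> j \<le> n \<Longrightarrow> Suc j \<le> length xs" for j using position_bound[of 0 j] by simp
  have 1: "hoare xs B (\<lambda>s. s = init_mem) (Act (Input MoveRight)) (?P 0)"
    by (rule hoare_conseq[OF hoare_Input[of 0 "\<lambda>_. tape_of [] 0" "[]" MoveRight]])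
      (auto simp: init_mem_def blank_tape fun_eq_iff)
  have 2: "hoare xs B (?P 0) (Loop (Neg (Both (Neg (Sees (Sym Zero))) (Neg (Sees (Sym One)))))
      (increment Size ;; Act (Input MoveRight))) (?P n)"
  proof (rule hoare_Loop)
    fix j assume j: "j < n"
    show "hoare xs B (?P j) (increment Size ;; Act (Input MoveRight)) (?P (Suc j))"
    proof (rule hoare_Seq)
      let ?m = "(\<lambda>_. tape_of [] 0)(Size := num j)"
      show "hoare xs B (?P j) (increment Size)
          (\<lambda>\<sigma>. \<sigma> = (Suc j, (\<lambda>_. tape_of [] 0)(Size := num (Suc j)), []))"
        using hoare_increment[of ?m Size "bits j" B xs "Suc j" "[]"] length_bits_le[of "Suc j"] j
        by (simp add: bits_Suc)
      show "hoare xs B (\<lambda>\<sigma>. \<sigma> = (Suc j, (\<lambda>_. tape_of [] 0)(Size := num (Suc j)), []))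
          (Act (Input MoveRight)) (?P (Suc j))"
        using hoare_Input[of "Suc j" "(\<lambda>_. tape_of [] 0)(Size := num (Suc j))" "[]" MoveRight] pos[of j] j
        by (simp add: min_def)
    qed
    show "passes xs (Neg (Both (Neg (Sees (Sym Zero))) (Neg (Sees (Sym One))))) s" if "?P j s" for s
      using that j read_matrix[of 0 j] by simp
  next
    have "read_input xs (Suc n) = Sym Hash \<or> read_input xs (Suc n) = RightEnd"
    proof (cases "n = 0")
      case True
      then show ?thesis using length_xs by (simp add: read_input_def)
    next
      case False
      then show ?thesis using read_matrix[of 0 n] by simp
    qed
    then show "\<not> passes xs (Neg (Both (Neg (Sees (Sym Zero))) (Neg (Sees (Sym One))))) s" if "?P n s" for s
      using that by auto
  qed
  have "rep n (\<lambda>_. 0) 0 F (tape_of [] 0) [] s" if "?P n s" for s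
    using that blank_tape by (auto simp: rep_def flag_def intro!: image_eqI[of _ flag False])
  then show ?thesis
    unfolding read_size_def by (intro hoare_conseq[OF hoare_Seq[OF 1 2]]) auto
qed

context
  fixes r :: "nat \<Rightarrow> nat" and W \<Gamma> :: "nat set" and k :: nat
  assumes r: "\<And>x. x > 2 \<Longrightarrow> r x = 0" and rn: "\<And>x. r x < n"
  defines "W \<equiv> Omega G (r 0) (r 1) (r 2)"
    and "\<Gamma> \<equiv> Gamma_ov G (r 0) (r 1) (r 2) \<union> Gamma_cc G (r 0) (r 1) (r 2)"
    and "k \<equiv> card W"
  assumes kB: "k \<le> B"
begin

lemma fin_W: "finite W"
  unfolding W_def by (rule finite_subset[of _ "{..<n}"]) (auto simp: Omega_def G)

lemma W_sub: "x \<in> W \<Longrightarrow> x < n"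
  unfolding W_def by (auto simp: Omega_def G)

lemma rank_n: "rank W n = k"
proof -
  have "{y \<in> W. y < n} = W" using W_sub by auto
  then show ?thesis by (simp add: rank_def k_def)
qed

lemma rank_le: "rank W x \<le> k"
  unfolding rank_def k_def by (intro card_mono fin_W) auto

lemma hoare_check_Omega:
  assumes "j < n"
  shows "hoare xs B (rep n (r(3 := j)) d F mt ys) (check InOmega d) (rep n (r(3 := j)) (Suc d) (F(d := j \<in> W)) mt ys)"
proof -
  have "holds G n (r(3 := j)) InOmega \<longleftrightarrow> j \<in> W"
    using rn assms unfolding W_def by (subst holds_InOmega) auto
  from this[symmetric] show ?thesis
    by (simp only:) (rule hoare_check, use wf_formulas bound_vars_formulas rn r assms in \<open>auto split: if_splits\<close>)
qed

lemma hoare_check_Gamma: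
  assumes "j < n"
  shows "hoare xs B (rep n (r(3 := j)) d F mt ys) (check InGamma d) (rep n (r(3 := j)) (Suc d) (F(d := j \<in> \<Gamma>)) mt ys)"
proof -
  have "holds G n (r(3 := j)) InGamma \<longleftrightarrow> j \<in> \<Gamma>"
    using rn assms unfolding \<Gamma>_def by (subst holds_InGamma) auto
  from this[symmetric] show ?thesis
    by (simp only:) (rule hoare_check, use wf_formulas bound_vars_formulas rn r assms in \<open>auto split: if_splits\<close>)
qed

lemma hoare_blank_mask:
  "hoare xs B (rep n r 0 F (tape_of [] 0) ys) blank_mask
    (reps n r 0 (\<lambda>F' mt ys'. mt = tape_of (replicate k False) 0 \<and> ys' = ys))"
proof -
  let ?t = "\<lambda>h. tape_of (replicate h False) (int h)"
  let ?c = "check InOmega 0 ;;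
    Cond (Cell (Flag 0) 2) (Act (Write Mask 1) ;; Act (Shift Mask MoveRight)) skip"
  let ?Q = "reps n r 0 (\<lambda>F' mt ys'. mt = tape_of (replicate k False) 0 \<and> ys' = ys)"
  \<comment> \<open>After \<open>j\<close> vertices the mask has one zero for each member of
    \<open>W\<close> below \<open>j\<close>, and the head stands behind them.\<close>
  let ?C = "\<lambda>j F' mt ys'. mt = ?t (rank W j) \<and> ys' = ys"
  have 1: "hoare xs B (reps n r 0 (?C 0)) (for_all 3 ?c) (reps n r 0 (?C n))"
  proof (rule hoare_for_all)
    show "r 3 = 0" using r by simp
    fix j assume j: "j < n"
    let ?r = "r(3 := j)"
    show "hoare xs B (reps n ?r 0 (?C j)) ?c (reps n ?r 0 (?C (Suc j)))"
    proof (rule hoare_reps_pre)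
      fix F :: "nat \<Rightarrow> bool" and mt ys' assume C: "?C j F mt ys'"
      let ?F = "F(0 := j \<in> W)"
      have 2: "hoare xs B (rep n ?r (Suc 0) ?F mt ys')
        (Cond (Cell (Flag 0) 2) (Act (Write Mask 1) ;; Act (Shift Mask MoveRight)) skip) (reps n ?r 0 (?C (Suc j)))"
      proof (rule hoare_Cond_flag)
        assume "?F 0"
        then have j': "j \<in> W" by simp
        then have rk: "rank W (Suc j) = Suc (rank W j)" using rank_Suc[OF fin_W] by simp
        have "((fst mt)(snd mt := 1), snd mt) = tape_of (replicate (Suc (rank W j)) False) (int (rank W j))"
          using tape_of_write[of "rank W j" "replicate (rank W j) False" False] C
          by (simp add: replicate_append_same)
        then have w: "hoare xs B (rep n ?r (Suc 0) ?F mt ys') (Act (Write Mask 1))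
            (rep n ?r (Suc 0) ?F (tape_of (replicate (Suc (rank W j)) False) (int (rank W j))) ys')"
          using hoare_Write_Mask[of ?r "Suc 0" ?F mt ys' 1] by simp
        have "hoare xs B (rep n ?r (Suc 0) ?F (tape_of (replicate (Suc (rank W j)) False) (int (rank W j))) ys')
            (Act (Shift Mask MoveRight)) (rep n ?r (Suc 0) ?F (?t (Suc (rank W j))) ys')"
          using rank_le[of "Suc j"] kB rk by (intro hoare_Shift_Mask) auto
        from hoare_Seq[OF w this] show "hoare xs B (rep n ?r (Suc 0) ?F mt ys')
            (Act (Write Mask 1) ;; Act (Shift Mask MoveRight)) (reps n ?r 0 (?C (Suc j)))"
          by (rule hoare_reps_post) (use rk C in auto)
      next
        assume "\<not> ?F 0"
        then have "rank W (Suc j) = rank W j" using rank_Suc[OF fin_W] by simp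
        then show "hoare xs B (rep n ?r (Suc 0) ?F mt ys') skip (reps n ?r 0 (?C (Suc j)))"
          by (intro hoare_reps_post[OF hoare_skip]) (use C in auto)
      qed simp
      show "hoare xs B (rep n ?r 0 F mt ys') ?c (reps n ?r 0 (?C (Suc j)))"
        by (rule hoare_Seq[OF hoare_check_Omega[OF j] 2])
    qed
  qed
  have 2: "hoare xs B (reps n r 0 (?C n)) (rewind Mask)
     ?Q"
  proof (rule hoare_reps_pre)
    fix F :: "nat \<Rightarrow> bool" and mt ys' assume C: "?C n F mt ys'"
    have "hoare xs B (rep n r 0 F mt ys') (rewind Mask) (rep n r 0 F (tape_of (replicate k False) 0) ys')"
      using hoare_rewind_Mask[of k "replicate k False" r 0 F ys'] C kB by (simp add: rank_n)
    then show "hoare xs B (rep n r 0 F mt ys') (rewind Mask)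
       ?Q"
      by (rule hoare_reps_post) (use C in auto)
  qed
  show ?thesis
    unfolding blank_mask_def
    by (rule hoare_conseq[OF hoare_Seq[OF 1 2]]) (auto simp: reps_def)
qed

lemma hoare_output_bit:
  assumes j: "j < n" and bs: "length bs = k" and F: "F 1 \<longleftrightarrow> j \<in> \<Gamma>" "F 2 \<longleftrightarrow> j \<in> W"
  shows "hoare xs B (rep n (r(3 := j)) 3 F (tape_of bs (int (rank W j))) ys) output_bit
    (rep n (r(3 := j)) 3 F (tape_of bs (int (rank W (Suc j))))
      (ys @ [if j \<in> \<Gamma> \<union> selected W bs then One else Zero]))"
proof -
  let ?r = "r(3 := j)" and ?t = "\<lambda>j. tape_of bs (int (rank W j))"
  let ?b = "j \<in> \<Gamma> \<union> selected W bs"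
  let ?P = "rep n ?r 3 F (?t j) ys" and ?Q = "rep n ?r 3 F (?t j) (ys @ [if ?b then One else Zero])"
  have inner: "hoare xs B ?P (Cond (Both (Cell (Flag 2) 2) (Cell Mask 2)) (Act (Output One)) (Act (Output Zero))) ?Q"
    if "j \<notin> \<Gamma>"
  proof (rule hoare_Cond_known)
    fix s assume s: "?P s"
    obtain p m o' where e: "s = (p, m, o')" by (cases s)
    have "passes xs (Cell Mask 2) s \<longleftrightarrow> bs ! rank W j" if "j \<in> W"
      using s e rank_less[OF fin_W that] bs by (simp add: rep_def k_def)
    then show "passes xs (Both (Cell (Flag 2) 2) (Cell Mask 2)) s \<longleftrightarrow> j \<in> selected W bs"
      using passes_flag[OF s, of 2] F by (cases s) (auto simp: selected_def)
  next
    show "hoare xs B ?P (if j \<in> selected W bs then Act (Output One) else Act (Output Zero)) ?Q"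
      using that hoare_Output by auto
  qed
  have 1: "hoare xs B ?P (Cond (Cell (Flag 1) 2) (Act (Output One))
      (Cond (Both (Cell (Flag 2) 2) (Cell Mask 2)) (Act (Output One)) (Act (Output Zero)))) ?Q"
  proof (rule hoare_Cond_flag)
    show "hoare xs B ?P (Act (Output One)) ?Q" if "F 1"
      using that F hoare_Output[of ?r 3 F "?t j" ys One] by simp
  qed (use inner F in auto)
  have 2: "hoare xs B ?Q (Cond (Cell (Flag 2) 2) (Act (Shift Mask MoveRight)) skip)
      (rep n ?r 3 F (?t (Suc j)) (ys @ [if ?b then One else Zero]))"
  proof (rule hoare_Cond_flag)
    assume "F 2"
    then have "rank W (Suc j) = Suc (rank W j)" using F rank_Suc[OF fin_W] by simp
    then show "hoare xs B ?Q (Act (Shift Mask MoveRight)) (rep n ?r 3 F (?t (Suc j)) (ys @ [if ?b then One else Zero]))"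
      using rank_le[of "Suc j"] kB by (intro hoare_Shift_Mask) auto
  next
    assume "\<not> F 2"
    then have "rank W (Suc j) = rank W j" using F rank_Suc[OF fin_W] by simp
    then show "hoare xs B ?Q skip (rep n ?r 3 F (?t (Suc j)) (ys @ [if ?b then One else Zero]))"
      using hoare_skip by simp
  qed simp
  show ?thesis unfolding output_bit_def by (rule hoare_Seq[OF 1 2])
qed

lemma hoare_output_set:
  assumes bs: "length bs = k"
  shows "hoare xs B (rep n r 1 F (tape_of bs 0) ys) output_set
    (reps n r 1 (\<lambda>F' mt ys'. F' 0 = F 0 \<and> mt = tape_of bs 0 \<and> ys' = ys @ encode_set n (\<Gamma> \<union> selected W bs)))"
proof -
  let ?X = "\<Gamma> \<union> selected W bs"
  let ?Q = "reps n r 1 (\<lambda>F' mt ys'. F' 0 = F 0 \<and> mt = tape_of bs 0 \<and> ys' = ys @ encode_set n ?X)"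
  let ?c = "check InGamma 1 ;; check InOmega 2 ;; output_bit"
  let ?w = "\<lambda>j. map (\<lambda>i. if i \<in> ?X then One else Zero) [0..<j]"
  let ?C = "\<lambda>j F' mt ys'. F' 0 = F 0 \<and> mt = tape_of bs (int (rank W j)) \<and> ys' = ys @ ?w j"
  have 1: "hoare xs B (reps n r 1 (?C 0)) (for_all 3 ?c)
     (reps n r 1 (?C n))"
  proof (rule hoare_for_all)
    show "r 3 = 0" using r by simp
    fix j assume j: "j < n"
    let ?r = "r(3 := j)"
    show "hoare xs B (reps n ?r 1 (?C j)) ?c (reps n ?r 1 (?C (Suc j)))"
    proof (rule hoare_reps_pre)
      fix F' :: "nat \<Rightarrow> bool" and mt ys' assume C: "?C j F' mt ys'"
      let ?F1 = "F'(1 := j \<in> \<Gamma>)" let ?F2 = "?F1(2 := j \<in> W)"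
      have c1: "hoare xs B (rep n ?r 1 F' mt ys') (check InGamma 1) (rep n ?r 2 ?F1 mt ys')"
        using hoare_check_Gamma[OF j, of 1 F' mt ys'] by (simp add: numeral_2_eq_2)
      have c2: "hoare xs B (rep n ?r 2 ?F1 mt ys') (check InOmega 2) (rep n ?r 3 ?F2 mt ys')"
        using hoare_check_Omega[OF j, of 2 ?F1 mt ys'] by (simp add: numeral_3_eq_3 numeral_2_eq_2)
      have c3: "hoare xs B (rep n ?r 3 ?F2 mt ys') output_bit
          (rep n ?r 3 ?F2 (tape_of bs (int (rank W (Suc j)))) (ys' @ [if j \<in> ?X then One else Zero]))"
        using hoare_output_bit[OF j bs, of ?F2 ys'] C by simp
      show "hoare xs B (rep n ?r 1 F' mt ys') ?c (reps n ?r 1 (?C (Suc j)))"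
        by (rule hoare_reps_post[OF hoare_Seq[OF c1 hoare_Seq[OF c2 c3]]]) (use C in auto)
    qed
  qed
  have 2: "hoare xs B (reps n r 1 (?C n)) (Act (Output Hash) ;; rewind Mask)
    ?Q"
  proof (rule hoare_reps_pre)
    fix F' :: "nat \<Rightarrow> bool" and mt ys' assume C: "?C n F' mt ys'"
    have "hoare xs B (rep n r 1 F' mt (ys' @ [Hash])) (rewind Mask) (rep n r 1 F' (tape_of bs 0) (ys' @ [Hash]))"
      using hoare_rewind_Mask[of k bs r 1 F'] C kB bs by (simp add: rank_n)
    from hoare_Seq[OF hoare_Output this]
    show "hoare xs B (rep n r 1 F' mt ys') (Act (Output Hash) ;; rewind Mask)
      ?Q"
      by (rule hoare_reps_post) (use C in \<open>auto simp: encode_set_def\<close>)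
  qed
  show ?thesis
    unfolding output_set_def
    by (rule hoare_conseq[OF hoare_Seq[OF 1 2]]) (auto simp: reps_def)
qed

lemma hoare_next_Mask:
  assumes i: "i < 2 ^ k" and F: "\<not> F 0"
  shows "hoare xs B (rep n r 1 F (tape_of (bit_mask k i) 0) ys) (next_mask Mask (Flag 0))
    (rep n r 1 (F(0 := Suc i = 2 ^ k)) (tape_of (bit_mask k (Suc i)) 0) ys)"
proof (rule hoare_pre)
  fix s assume s: "rep n r 1 F (tape_of (bit_mask k i) 0) ys s"
  obtain p m o' where e: "s = (p, m, o')" by (cases s)
  have m: "m Mask = tape_of (bit_mask k i) 0" "m (Flag 0) = flag False" using s e F by (auto simp: rep_def)
  have eq: "(if \<forall>b\<in>set (bit_mask k i). b
      then m(Mask := tape_of (replicate (length (bit_mask k i)) False) 0, Flag 0 := flag True)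
      else m(Mask := tape_of (inc (bit_mask k i)) 0)) =
    m(Mask := tape_of (bit_mask k (Suc i)) 0, Flag 0 := flag (Suc i = 2 ^ k))"
  proof (cases "Suc i = 2 ^ k")
    case True
    then have all: "\<forall>b\<in>set (bit_mask k i). b" using bit_mask_Suc[OF i] by simp
    have "bit_mask k (Suc i) = replicate k False" unfolding True by (rule bit_mask_power)
    then show ?thesis unfolding if_P[OF all] using True by simp
  next
    case False
    then have some: "\<not> (\<forall>b\<in>set (bit_mask k i). b)" and "inc (bit_mask k i) = bit_mask k (Suc i)"
      using bit_mask_Suc[OF i] by simp_all
    moreover have "m(Mask := t) = m(Mask := t, Flag 0 := flag False)" for t
      using m(2) by (intro ext) simp
    ultimately show ?thesis unfolding if_not_P[OF some] using False by simp
  qed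
  have "length (bit_mask k i) \<le> B" using kB by simp
  from hoare_next_mask[of m Mask "bit_mask k i" B "Flag 0" xs p o', OF m(1) this m(2)]
  have "hoare xs B (\<lambda>\<sigma>. \<sigma> = (p, m, o')) (next_mask Mask (Flag 0))
    (\<lambda>\<sigma>. \<sigma> = (p, m(Mask := tape_of (bit_mask k (Suc i)) 0, Flag 0 := flag (Suc i = 2 ^ k)), o'))"
    unfolding eq by simp
  then show "hoare xs B (\<lambda>\<sigma>. \<sigma> = s) (next_mask Mask (Flag 0))
    (rep n r 1 (F(0 := Suc i = 2 ^ k)) (tape_of (bit_mask k (Suc i)) 0) ys)"
    unfolding e by (rule hoare_conseq) (use s e in \<open>auto simp: rep_def\<close>)
qed

definition family :: "nat set list" where
  "family = map (\<lambda>i. \<Gamma> \<union> selected W (bit_mask k i)) [0..<2 ^ k]"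

lemma set_family: "set family = {\<Gamma> \<union> W' | W'. W' \<subseteq> W}"
proof -
  have "\<Gamma> \<union> W' \<in> set family" if W': "W' \<subseteq> W" for W'
  proof -
    obtain i where "i < 2 ^ k" "selected W (bit_mask k i) = W'"
      using selected_surj[OF fin_W W', folded k_def] by blast
    then show ?thesis by (auto simp: family_def intro!: image_eqI[of _ _ i])
  qed
  moreover have "\<exists>W'. X = \<Gamma> \<union> W' \<and> W' \<subseteq> W" if X: "X \<in> set family" for X
  proof -
    obtain i where "X = \<Gamma> \<union> selected W (bit_mask k i)"
      using X unfolding family_def by auto
    moreover have "selected W (bit_mask k i) \<subseteq> W" unfolding selected_def by blast
    ultimately show ?thesis by blast
  qed
  ultimately show ?thesis by blast
qed

lemma hoare_output_family:
  "hoare xs B (rep n r 0 F (tape_of [] 0) ys) output_family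
    (reps n r 0 (\<lambda>F' mt ys'. mt = tape_of [] 0 \<and> ys' = ys @ encode_sets n family))"
proof -
  let ?R = "\<lambda>i. encode_sets n (map (\<lambda>i. \<Gamma> \<union> selected W (bit_mask k i)) [0..<i])"
  let ?X = "\<lambda>i. \<Gamma> \<union> selected W (bit_mask k i)"
  let ?Q = "reps n r 0 (\<lambda>F' mt ys'. mt = tape_of [] 0 \<and> ys' = ys @ encode_sets n family)"
  let ?L = "output_set ;; next_mask Mask (Flag 0)"
  \<comment> \<open>The mask shows \<open>i\<close> and the overflow flag is raised exactly at
    \<open>2 ^ k\<close>. For \<open>k = 0\<close> there is still one round, after which the empty
    mask overflows.\<close>
  let ?C = "\<lambda>i F' mt ys'. (F' 0 \<longleftrightarrow> i = 2 ^ k) \<and> mt = tape_of (bit_mask k i) 0 \<and> ys' = ys @ ?R i"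
  have 1: "hoare xs B (reps n r 0 (\<lambda>F' mt ys'. mt = tape_of (replicate k False) 0 \<and> ys' = ys))
     (Act (Write (Flag 0) 0)) (reps n r 1 (?C 0))"
  proof (rule hoare_reps_pre)
    fix F :: "nat \<Rightarrow> bool" and mt ys' assume C: "mt = tape_of (replicate k False) 0 \<and> ys' = ys"
    have "hoare xs B (rep n r 0 F mt ys') (Act (Write (Flag 0) 0)) (rep n r 1 (F(0 := False)) mt ys')"
      by (rule hoare_set_flag) auto
    then show "hoare xs B (rep n r 0 F mt ys') (Act (Write (Flag 0) 0)) (reps n r 1 (?C 0))"
      by (rule hoare_reps_post) (use C in \<open>auto simp: bit_mask_0 encode_sets_def\<close>)
  qed
  have 2: "hoare xs B (reps n r 1 (?C 0)) (Loop (Neg (Cell (Flag 0) 2)) ?L)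
     (reps n r 1 (?C (2 ^ k)))"
  proof (rule hoare_Loop[where P = "\<lambda>i. reps n r 1 (?C i)"])
    fix i :: nat assume i: "i < 2 ^ k"
    show "hoare xs B (reps n r 1 (?C i)) ?L (reps n r 1 (?C (Suc i)))"
    proof (rule hoare_reps_pre)
      fix F :: "nat \<Rightarrow> bool" and mt ys' assume C: "?C i F mt ys'"
      let ?D = "\<lambda>F' mt ys''. F' 0 = F 0 \<and> mt = tape_of (bit_mask k i) 0 \<and> ys'' = ys' @ encode_set n (?X i)"
      from C have a: "hoare xs B (rep n r 1 F mt ys') output_set
         (reps n r 1 ?D)"
        using hoare_output_set[of "bit_mask k i" F ys'] by simp
      have b: "hoare xs B (reps n r 1 ?D)
         (next_mask Mask (Flag 0)) (reps n r 1 (?C (Suc i)))"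
      proof (rule hoare_reps_pre)
        fix F' :: "nat \<Rightarrow> bool" and mt' ys'' assume C': "?D F' mt' ys''"
        then have "hoare xs B (rep n r 1 F' mt' ys'') (next_mask Mask (Flag 0))
            (rep n r 1 (F'(0 := Suc i = 2 ^ k)) (tape_of (bit_mask k (Suc i)) 0) ys'')"
          using hoare_next_Mask[OF i, of F' ys''] C i by simp
        then show "hoare xs B (rep n r 1 F' mt' ys'') (next_mask Mask (Flag 0)) (reps n r 1 (?C (Suc i)))"
          by (rule hoare_reps_post) (use C C' in \<open>auto simp: encode_sets_map_Suc simp del: upt_Suc\<close>)
      qed
      show "hoare xs B (rep n r 1 F mt ys') ?L (reps n r 1 (?C (Suc i)))"
        by (rule hoare_Seq[OF a b])
    qed
    show "passes xs (Neg (Cell (Flag 0) 2)) s" if s: "reps n r 1 (?C i) s" for s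
    proof -
      obtain F mt ys' where "?C i F mt ys'" "rep n r 1 F mt ys' s"
        using s unfolding reps_def by blast
      then show ?thesis using passes_flag[of r 1 F mt ys' s 0] i by simp
    qed
  next
    show "\<not> passes xs (Neg (Cell (Flag 0) 2)) s" if s: "reps n r 1 (?C (2 ^ k)) s" for s
    proof -
      obtain F mt ys' where "?C (2 ^ k) F mt ys'" "rep n r 1 F mt ys' s"
        using s unfolding reps_def by blast
      then show ?thesis using passes_flag[of r 1 F mt ys' s 0] by simp
    qed
  qed
  have 3: "hoare xs B (reps n r 1 (?C (2 ^ k))) (clear Mask)
     ?Q"
  proof (rule hoare_reps_pre)
    fix F :: "nat \<Rightarrow> bool" and mt ys' assume C: "?C (2 ^ k) F mt ys'"
    then have "hoare xs B (rep n r 1 F mt ys') (clear Mask) (rep n r 1 F (tape_of [] 0) ys')"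
      using hoare_clear_Mask[of "bit_mask k (2 ^ k)" r 1 F ys'] kB by simp
    then show "hoare xs B (rep n r 1 F mt ys') (clear Mask)
     ?Q"
      by (rule hoare_reps_post) (use C in \<open>auto simp: family_def\<close>)
  qed
  show ?thesis
    unfolding output_family_def
    by (rule hoare_Seq[OF hoare_blank_mask hoare_Seq[OF 1 hoare_Seq[OF 2 3]]])
qed

end

section \<open>Ranging over all triples, and the resulting space bound\<close>

definition lists_sets :: "nat set set \<Rightarrow> io_sym list \<Rightarrow> bool" where
  "lists_sets \<X> ys \<longleftrightarrow> (\<exists>Xs. ys = encode_sets n Xs \<and> set Xs = \<X>)"

lemma lists_sets_append: "lists_sets \<X> ys \<Longrightarrow> lists_sets (\<X> \<union> set Xs) (ys @ encode_sets n Xs)"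
proof -
  assume "lists_sets \<X> ys"
  then obtain Ys where "ys = encode_sets n Ys" "set Ys = \<X>" by (auto simp: lists_sets_def)
  then show ?thesis
    unfolding lists_sets_def by (intro exI[of _ "Ys @ Xs"]) (simp add: encode_sets_def)
qed

definition triple_sets :: "nat \<Rightarrow> nat \<Rightarrow> nat \<Rightarrow> nat set set" where
  "triple_sets u v w = (if distinct [u, v, w] \<and> {u, v, w} \<in> Delta G
    then {Gamma_ov G u v w \<union> Gamma_cc G u v w \<union> \<Omega>' | \<Omega>'. \<Omega>' \<subseteq> Omega G u v w} else {})"

lemma f_N_triples: "f_N G = (\<Union>u<n. \<Union>v<n. \<Union>w<n. triple_sets u v w)"
proof -
  have range: "u < n \<and> v < n \<and> w < n" if "{u, v, w} \<in> Delta G" for u v w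
    using Delta_verts[OF that] G by auto
  show ?thesis
  proof (intro equalityI subsetI)
    fix X assume "X \<in> f_N G"
    then obtain u v w \<Omega>' where X: "X = Gamma_ov G u v w \<union> Gamma_cc G u v w \<union> \<Omega>'" "\<Omega>' \<subseteq> Omega G u v w"
      and D: "distinct [u, v, w] \<and> {u, v, w} \<in> Delta G" unfolding f_N_def by blast
    then have "X \<in> triple_sets u v w" unfolding triple_sets_def if_P[OF D] by blast
    then show "X \<in> (\<Union>u<n. \<Union>v<n. \<Union>w<n. triple_sets u v w)" using range[of u v w] D by blast
  next
    fix X assume "X \<in> (\<Union>u<n. \<Union>v<n. \<Union>w<n. triple_sets u v w)"
    then obtain u v w where X: "X \<in> triple_sets u v w" by blast
    then have D: "distinct [u, v, w] \<and> {u, v, w} \<in> Delta G"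
      by (auto simp: triple_sets_def split: if_splits)
    then show "X \<in> f_N G" using X unfolding triple_sets_def if_P[OF D] f_N_def by blast
  qed
qed

lemma hoare_enumerate:
  assumes K: "\<And>u v w. distinct [u, v, w] \<Longrightarrow> {u, v, w} \<in> Delta G \<Longrightarrow> card (Omega G u v w) \<le> B"
  shows "hoare xs B (\<lambda>s. s = init_mem) enumerate (reps n (\<lambda>_. 0) 0 (\<lambda>F mt ys. lists_sets (f_N G) ys))"
proof -
  let ?c3 = "check InDelta 0 ;; Cond (Cell (Flag 0) 2) output_family skip"
  \<comment> \<open>The output so far lists exactly the sets collected in \<open>\<X>\<close>, in
    any order and with repetitions. The blank mask lets the next triple start afresh.\<close>
  let ?I = "\<lambda>\<X> F mt ys. mt = tape_of [] 0 \<and> lists_sets \<X> ys"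
  have triple: "hoare xs B (reps n r 0 (?I \<X>)) ?c3 (reps n r 0 (?I (\<X> \<union> triple_sets (r 0) (r 1) (r 2))))"
    if r: "\<And>x. x > 2 \<Longrightarrow> r x = 0" "\<And>x. r x < n" for r \<X>
  proof (rule hoare_reps_pre)
    let ?T = "triple_sets (r 0) (r 1) (r 2)"
    fix F :: "nat \<Rightarrow> bool" and mt ys assume C: "?I \<X> F mt ys"
    let ?D = "distinct [r 0, r 1, r 2] \<and> {r 0, r 1, r 2} \<in> Delta G"
    let ?F = "F(0 := ?D)"
    have iff: "holds G n r InDelta \<longleftrightarrow> ?D" using holds_InDelta[of r] r(2) by blast
    have 1: "hoare xs B (rep n r 0 F mt ys) (check InDelta 0) (rep n r (Suc 0) ?F mt ys)"
      unfolding iff[symmetric]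
      by (rule hoare_check) (use wf_formulas bound_vars_formulas r in auto)
    have 2: "hoare xs B (rep n r (Suc 0) ?F mt ys) (Cond (Cell (Flag 0) 2) output_family skip)
        (reps n r 0 (?I (\<X> \<union> ?T)))"
    proof (rule hoare_Cond_flag)
      assume "?F 0"
      then have D: ?D by simp
      then have kB: "card (Omega G (r 0) (r 1) (r 2)) \<le> B" using K by blast
      have s: "set (family r) = ?T"
        using set_family[of r] r kB D by (simp add: triple_sets_def)
      show "hoare xs B (rep n r (Suc 0) ?F mt ys) output_family (reps n r 0 (?I (\<X> \<union> ?T)))"
      proof (rule hoare_conseq)
        show "hoare xs B (rep n r 0 ?F (tape_of [] 0) ys) output_family
            (reps n r 0 (\<lambda>F' mt ys'. mt = tape_of [] 0 \<and> ys' = ys @ encode_sets n (family r)))"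
          using hoare_output_family[of r ?F ys] r kB by simp
        show "rep n r 0 ?F (tape_of [] 0) ys s" if "rep n r (Suc 0) ?F mt ys s" for s
          using that C by (auto elim: rep_mono)
        show "reps n r 0 (?I (\<X> \<union> ?T)) s"
          if "reps n r 0 (\<lambda>F' mt ys'. mt = tape_of [] 0 \<and> ys' = ys @ encode_sets n (family r)) s" for s
          using that lists_sets_append[of \<X> ys "family r"] C s by (auto simp: reps_def)
      qed
    next
      assume "\<not> ?F 0"
      then have "?T = {}" by (auto simp: triple_sets_def)
      then show "hoare xs B (rep n r (Suc 0) ?F mt ys) skip (reps n r 0 (?I (\<X> \<union> ?T)))"
        by (intro hoare_reps_post[OF hoare_skip]) (use C in auto)
    qed simp
    show "hoare xs B (rep n r 0 F mt ys) ?c3 (reps n r 0 (?I (\<X> \<union> ?T)))"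
      by (rule hoare_Seq[OF 1 2])
  qed
  let ?V = "\<lambda>u v j. \<Union>w<j. triple_sets u v w" let ?U = "\<lambda>u j. \<Union>v<j. ?V u v n"
  have loop3: "hoare xs B (reps n r 0 (?I \<X>)) (for_all 2 ?c3) (reps n r 0 (?I (\<X> \<union> ?V (r 0) (r 1) n)))"
    if r: "\<And>x. x > 1 \<Longrightarrow> r x = 0" "\<And>x. r x < n" for r \<X>
  proof -
    have "hoare xs B (reps n r 0 (?I (\<X> \<union> ?V (r 0) (r 1) 0))) (for_all 2 ?c3)
       (reps n r 0 (?I (\<X> \<union> ?V (r 0) (r 1) n)))"
    proof (rule hoare_for_all)
      show "r 2 = 0" using r by simp
      show "hoare xs B (reps n (r(2 := j)) 0 (?I (\<X> \<union> ?V (r 0) (r 1) j))) ?c3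
          (reps n (r(2 := j)) 0 (?I (\<X> \<union> ?V (r 0) (r 1) (Suc j))))" if "j < n" for j
        using triple[of "r(2 := j)" "\<X> \<union> ?V (r 0) (r 1) j"] r that by (simp add: lessThan_Suc Un_ac)
    qed
    then show ?thesis by simp
  qed
  have loop2: "hoare xs B (reps n r 0 (?I \<X>)) (for_all 1 (for_all 2 ?c3)) (reps n r 0 (?I (\<X> \<union> ?U (r 0) n)))"
    if r: "\<And>x. x > 0 \<Longrightarrow> r x = 0" "\<And>x. r x < n" for r \<X>
  proof -
    have "hoare xs B (reps n r 0 (?I (\<X> \<union> ?U (r 0) 0))) (for_all 1 (for_all 2 ?c3))
       (reps n r 0 (?I (\<X> \<union> ?U (r 0) n)))"
    proof (rule hoare_for_all)
      show "r 1 = 0" using r by simp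
      show "hoare xs B (reps n (r(1 := j)) 0 (?I (\<X> \<union> ?U (r 0) j))) (for_all 2 ?c3)
          (reps n (r(1 := j)) 0 (?I (\<X> \<union> ?U (r 0) (Suc j))))" if "j < n" for j
        using loop3[of "r(1 := j)" "\<X> \<union> ?U (r 0) j"] r that by (simp add: lessThan_Suc Un_ac)
    qed
    then show ?thesis by simp
  qed
  have loop1: "hoare xs B (reps n (\<lambda>_. 0) 0 (?I {})) (for_all 0 (for_all 1 (for_all 2 ?c3)))
      (reps n (\<lambda>_. 0) 0 (?I (\<Union>u<n. ?U u n)))"
  proof -
    have "hoare xs B (reps n (\<lambda>_. 0) 0 (?I (\<Union>u<0. ?U u n))) (for_all 0 (for_all 1 (for_all 2 ?c3)))
       (reps n (\<lambda>_. 0) 0 (?I (\<Union>u<n. ?U u n)))"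
    proof (rule hoare_for_all)
      show "hoare xs B (reps n ((\<lambda>_. 0)(0 := j)) 0 (?I (\<Union>u<j. ?U u n))) (for_all 1 (for_all 2 ?c3))
          (reps n ((\<lambda>_. 0)(0 := j)) 0 (?I (\<Union>u<Suc j. ?U u n)))" if "j < n" for j
        using loop2[of "(\<lambda>_. 0)(0 := j)" "\<Union>u<j. ?U u n"] that by (simp add: lessThan_Suc Un_ac)
    qed simp
    then show ?thesis by simp
  qed
  have "hoare xs B (\<lambda>s. s = init_mem) read_size (reps n (\<lambda>_. 0) 0 (?I {}))"
    by (rule hoare_reps_post[OF hoare_read_size[of "\<lambda>_. False"]])
      (auto simp: lists_sets_def encode_sets_def)
  from hoare_Seq[OF this loop1] show ?thesis
    unfolding enumerate_def f_N_triples
    by (rule hoare_conseq) (assumption | (unfold reps_def, blast))+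
qed

end

lemma Omega_subset_K_set:
  "{u, v, w} \<in> Delta G \<Longrightarrow> Omega G u v w \<subseteq> K_set G"
  by (auto simp: Omega_def K_set_def)

lemma computable_f_N:
  "computable_in_O_space f_N (\<lambda>G. real (card (K_set G)) + log 2 (real (card (verts G))))"
proof -
  obtain M K where M: "wf_tm M" and run: "\<And>xs B Q. hoare xs B (\<lambda>s. s = init_mem) enumerate Q \<Longrightarrow>
    \<exists>p m o'. Q (p, m, o') \<and> halts_with M xs o' \<and> space_used M xs \<le> K * (B + 2)"
    using compile_prog[of enumerate] by blast
  show ?thesis
    unfolding computable_in_O_space_def
  \<comment> \<open>\<open>computable_in_O_space\<close> uses one constant both as factor and as
    summand; the summand needs \<open>3 * K\<close>.\<close>
  proof (rule exI[of _ M], rule exI[of _ "3 * real K"], intro conjI allI impI)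
    show "wf_tm M" by (rule M)
  next
    fix G :: "nat ugraph" and n :: nat assume G: "std_graph G" "verts G = {..<n}"
    let ?xs = "encode_graph G" and ?k = "card (K_set G)"
    \<comment> \<open>The first summand accommodates the binary counters, the second the mask, whose
      width is at most \<open>?k\<close> because \<open>Omega\<close> lies in
      \<open>K_set G\<close>.\<close>
    let ?B = "length (bits n) + ?k"
    interpret graph_input G n ?xs ?B by unfold_locales (use G in auto)
    have "finite (K_set G)" using G by (auto simp: K_set_def)
    then have "card (Omega G u v w) \<le> ?B" if "{u, v, w} \<in> Delta G" for u v w
      using card_mono[OF _ Omega_subset_K_set[OF that]] by simp
    from run[OF hoare_enumerate[OF this]]
    obtain p m o' where o': "reps n (\<lambda>_. 0) 0 (\<lambda>F mt ys. lists_sets (f_N G) ys) (p, m, o')"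
      and h: "halts_with M ?xs o'" and sp: "space_used M ?xs \<le> K * (?B + 2)" by blast
    have "lists_sets (f_N G) o'" using o' by (auto simp: reps_def rep_def)
    then show "\<exists>Xs. set Xs = f_N G \<and> halts_with M ?xs (encode_sets n Xs)"
      using h by (auto simp: lists_sets_def)
    let ?s = "real ?k + log 2 (real (card (verts G)))"
    have cn: "card (verts G) = n" using G by simp
    \<comment> \<open>The empty graph needs a separate look, since the logarithm is then taken at
      0.\<close>
    have l0: "0 \<le> log 2 (real n)" by (cases "n = 0") (auto simp: log_def)
    have "real (space_used M ?xs) \<le> real K * (real (length (bits n)) + real ?k + 2)"
      using sp by (metis (mono_tags, lifting) of_nat_add of_nat_le_iff of_nat_mult of_nat_numeral)
    \<comment> \<open>A counter has at most \<open>1 + log 2 (real n)\<close> cells, so the bracket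
      is at most \<open>?s + 3\<close>; tripling the nonnegative \<open>?s\<close> gives the shape
      of the goal.\<close>
    also have "\<dots> \<le> real K * (3 * ?s + 3)"
      using length_bits[of n] l0 cn by (intro mult_left_mono) auto
    finally show "real (space_used M ?xs) \<le> 3 * real K * ?s + 3 * real K" by (simp add: algebra_simps)
  qed
qed

theorem theorem25:
  shows "candidate_function (f_N :: 'v ugraph \<Rightarrow> 'v set set) nonuniform_ca_graphs \<and>
    computable_in_O_space f_N
      (\<lambda>G. real (card (K_set G)) + log 2 (real (card (verts G))))"
  using candidate_function_f_N computable_f_N by blast

end
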